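(* Suppose that $\mu,\sigma:\mathbb{X}\to\mathbb{R}$ are Lipschitz continuous with $\sigma^2(x)>0$ for all $x\in\mathbb{X}$, that $\delta(t+s)\ge\delta(t)\delta(s)$ for all $s,t\ge0$, that $f$ satisfies the growth condition and the piecewise-$C^2$ condition, and that the value-function regularity condition holds (all defined in the context). Let $S$ be an admissible stopping policy that is a weak equilibrium. Then for every $x\in\partial S$ at which $f'(x)$ exists, $$V_x(0,x-,S)=V_x(0,x+,S).$$
   Context: Setting. A filtered probability space $(\Omega,\mathcal F,(\mathcal F_t)_{t\ge0},\mathbb P)$ supports a standard Brownian motion $W$. $X$ is a one-dimensional diffusion $dX_t=\mu(X_t)dt+\sigma(X_t)dW_t$ taking values in an interval $\mathbb X\subset\mathbb R$; $\mathbb P^x,\mathbb E^x$ refer to $X_0=x$. Closure $\overline A$, interior $A^\circ$ and boundary $\partial A=\overline A\setminus A^\circ$ are taken in the Euclidean topology within $\mathbb X$; $A^c=\mathbb X\setminus A$; $B(x,r)=(x-r,x+r)\cap\mathbb X$. For Borel $A\subset\mathbb X$, $\rho_A=\inf\{t>0:X_t\in A\}$. The discount function $\delta:[0,\infty)\to[0,1]$ is non-increasing and continuously differentiable with $\delta(0)=1$ and $\delta(t)<1$ for $t>0$. The payoff $f:\mathbb X\to[0,\infty)$ is continuous. For Borel $A$, $V(t,x,A)=\mathbb E^x[\delta(t+\rho_A)f(X_{\rho_A})]$ and $J(x,A)=V(0,x,A)$, the random variable being $0$ on $\{\rho_A=\infty\}$. Function classes. $C^{1,k}([0,\infty)\times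 E)$: functions $v(t,x)$ continuously differentiable in $t$ and $k$ times continuously differentiable in $x$ on $[0,\infty)\times E$; $C^k(E)$ is analogous for functions of $x$; at boundary points included in $E$, regularity means that the function coincides on $E$ with a function of that regularity on all of $\mathbb X$. $v_x(t,x\pm)$ denote right/left derivatives in $x$. Admissible stopping policy: a Borel set $S\subset\mathbb X$, closed in $\mathbb X$, such that each $x\in\partial S$ satisfies either (a) for some $h>0$, one of $(x-h,x),(x,x+h)$ is contained in $S^\circ$ and the other in $S^c$; or (b) $B(x,h)\setminus\{x\}\subset S^c$ for some $h>0$. Growth condition: for every $x\in\mathbb X$, $\lim_{t\to\infty}\delta(t)f(X_t)=0$ $\mathbb P^x$-a.s., and there is $\zeta>0$ with $\mathbb E^x[\sup_{t\ge0}(\delta(t)f(X_t))^{1+\zeta}]<\infty$ for all $x\in\mathbb X$. Piecewise-$C^2$ condition: there is a finite or countable set $(\theta_n)_{n\in I}\subset\mathbb X$, $I\subset\mathbb Z$, $\theta_n<\theta_{n+1}$, with $f\in C^2([\theta_n,\theta_{n+1}])$ for all $n\in I$ (with the obvious reading for outermost pieces of $\mathbb X$) and $\inf_{n\in I}(\theta_{n+1}-\theta_n)>0$. Value-function regularity condition: for every admissible stopping policy $S$ and all $a<b$ in $\mathbb X$ with $(a,b)\subset S^c$, $V(\cdot,\cdot,S)\in C^{1,2}([0,\infty)\times[a,b])$, and $\limsup_{t\searrow0}\frac1{\sqrt t}|V_x(t,x\pm,S)-V_x(0,x\pm,S)|=0$ for all $x\in\mathbb X$. Weak equilibrium: a closed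 set $S\subset\mathbb X$ with $f(x)\le J(x,S)$ for all $x\notin S$ and $\liminf_{\varepsilon\searrow0}\frac{f(x)-\mathbb E^x[\delta(\rho_S^\varepsilon)f(X_{\rho_S^\varepsilon})]}{\varepsilon}\ge0$ for all $x\in S$, where $\rho^\varepsilon_S=\inf\{t\ge\varepsilon:X_t\in S\}$. *)

theory Defs
  imports "HOL-Probability.Probability"
begin

section \<open>Filtrations, Brownian motion and the Ito integral\<close>

text \<open>Time is the half-line of nonnegative reals; objects indexed by \<^typ>\<open>real\<close> carry the guard
  \<open>0 \<le> t\<close>, and their values at negative times are irrelevant.\<close>

definition filtered_prob_space :: "'w measure \<Rightarrow> (real \<Rightarrow> 'w measure) \<Rightarrow> bool" where
  "filtered_prob_space M F \<longleftrightarrow>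
     prob_space M \<and>
     (\<forall>t\<ge>0. subalgebra M (F t)) \<and>
     (\<forall>s t. 0 \<le> s \<and> s \<le> t \<longrightarrow> sets (F s) \<subseteq> sets (F t))"

definition adapted :: "(real \<Rightarrow> 'w measure) \<Rightarrow> (real \<Rightarrow> 'w \<Rightarrow> real) \<Rightarrow> bool" where
  "adapted F Y \<longleftrightarrow> (\<forall>t\<ge>0. Y t \<in> borel_measurable (F t))"

definition brownian_motion ::
  "'w measure \<Rightarrow> (real \<Rightarrow> 'w measure) \<Rightarrow> (real \<Rightarrow> 'w \<Rightarrow> real) \<Rightarrow> bool" where
  "brownian_motion M F W \<longleftrightarrow>
     adapted F W \<and>
     (AE \<omega> in M. W 0 \<omega> = 0) \<and>
     (AE \<omega> in M. continuous_on {0..} (\<lambda>t. W t \<omega>)) \<and>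
     (\<forall>s t. 0 \<le> s \<and> s < t \<longrightarrow>
        distributed M lborel (\<lambda>\<omega>. W t \<omega> - W s \<omega>) (normal_density 0 (sqrt (t - s))) \<and>
        prob_space.indep_set M (sets (F s))
          {(\<lambda>\<omega>. W t \<omega> - W s \<omega>) -` B \<inter> space M |B. B \<in> sets borel})"

text \<open>The data \<open>n\<close>, \<open>\<tau>\<close>, \<open>\<xi>\<close> encode the simple process that is equal to \<open>\<xi> i\<close> on
  \<open>{\<tau> i<..\<tau> (Suc i)}\<close> for \<open>i < n\<close> and vanishes elsewhere.\<close>

definition simple_process ::
  "'w measure \<Rightarrow> (real \<Rightarrow> 'w measure) \<Rightarrow> nat \<Rightarrow> (nat \<Rightarrow> real) \<Rightarrow> (nat \<Rightarrow> 'w \<Rightarrow> real) \<Rightarrow> bool" where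
  "simple_process M F n \<tau> \<xi> \<longleftrightarrow>
     0 \<le> \<tau> 0 \<and>
     (\<forall>i<n. \<tau> i < \<tau> (Suc i) \<and> \<xi> i \<in> borel_measurable (F (\<tau> i)) \<and> bounded (\<xi> i ` space M))"

definition simple_value ::
  "nat \<Rightarrow> (nat \<Rightarrow> real) \<Rightarrow> (nat \<Rightarrow> 'w \<Rightarrow> real) \<Rightarrow> real \<Rightarrow> 'w \<Rightarrow> real" where
  "simple_value n \<tau> \<xi> s \<omega> = (\<Sum>i<n. \<xi> i \<omega> * indicator {\<tau> i<..\<tau> (Suc i)} s)"

definition simple_integral ::
  "(real \<Rightarrow> 'w \<Rightarrow> real) \<Rightarrow> nat \<Rightarrow> (nat \<Rightarrow> real) \<Rightarrow> (nat \<Rightarrow> 'w \<Rightarrow> real) \<Rightarrow> real \<Rightarrow> 'w \<Rightarrow> real" where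
  "simple_integral W n \<tau> \<xi> t \<omega> =
     (\<Sum>i<n. \<xi> i \<omega> * (W (min t (\<tau> (Suc i))) \<omega> - W (min t (\<tau> i)) \<omega>))"

text \<open>\<open>I\<close> is (a continuous version of) the Ito integral process of \<open>H\<close> against \<open>W\<close>: the limit in
  probability of the integrals of simple processes that approximate \<open>H\<close> in \<open>L\<^sup>2(0,T)\<close> in
  probability.  Convergence is required at each fixed time, not uniformly in time, which together
  with continuity of paths determines \<open>I\<close> up to indistinguishability; in this form all events
  are measurable without completeness of \<open>M\<close>.\<close>

definition is_ito_integral ::
  "'w measure \<Rightarrow> (real \<Rightarrow> 'w measure) \<Rightarrow> (real \<Rightarrow> 'w \<Rightarrow> real) \<Rightarrow>
   (real \<Rightarrow> 'w \<Rightarrow> real) \<Rightarrow> (real \<Rightarrow> 'w \<Rightarrow> real) \<Rightarrow> bool" where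
  "is_ito_integral M F W H I \<longleftrightarrow>
     adapted F I \<and>
     (AE \<omega> in M. continuous_on {0..} (\<lambda>t. I t \<omega>)) \<and>
     (\<exists>n \<tau> \<xi>.
        (\<forall>k::nat. simple_process M F (n k) (\<tau> k) (\<xi> k)) \<and>
        (\<forall>T\<ge>0. \<forall>e>0.
           (\<lambda>k. measure M {\<omega> \<in> space M. ennreal e <
              (\<integral>\<^sup>+s\<in>{0..T}. ennreal ((simple_value (n k) (\<tau> k) (\<xi> k) s \<omega> - H s \<omega>)\<^sup>2) \<partial>lborel)})
             \<longlonglongrightarrow> 0 \<and>
           (\<lambda>k. measure M {\<omega> \<in> space M.
              e < \<bar>simple_integral W (n k) (\<tau> k) (\<xi> k) T \<omega> - I T \<omega>\<bar>})
             \<longlonglongrightarrow> 0))"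

section \<open>The diffusion\<close>

text \<open>The family \<open>(P\<^sup>x)\<close> is rendered by the solutions \<open>X x\<close> started at the points \<open>x\<close> of the state
  space \<open>\<X>\<close>, all driven by the same Brownian motion; the expectation under \<open>P\<^sup>x\<close> of a functional of
  the diffusion is the expectation under \<open>M\<close> of that functional of \<open>X x\<close>.\<close>

definition diffusion ::
  "'w measure \<Rightarrow> (real \<Rightarrow> 'w measure) \<Rightarrow> (real \<Rightarrow> 'w \<Rightarrow> real) \<Rightarrow> real set \<Rightarrow>
   (real \<Rightarrow> real) \<Rightarrow> (real \<Rightarrow> real) \<Rightarrow> (real \<Rightarrow> real \<Rightarrow> 'w \<Rightarrow> real) \<Rightarrow> bool" where
  "diffusion M F W \<X> \<mu> \<sigma> X \<longleftrightarrow>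
     (\<forall>x\<in>\<X>.
        adapted F (X x) \<and>
        (\<forall>\<omega>\<in>space M. X x 0 \<omega> = x \<and> continuous_on {0..} (\<lambda>t. X x t \<omega>) \<and> (\<forall>t\<ge>0. X x t \<omega> \<in> \<X>)) \<and>
        (\<exists>I. is_ito_integral M F W (\<lambda>s \<omega>. \<sigma> (X x s \<omega>)) I \<and>
             (AE \<omega> in M. \<forall>t\<ge>0. X x t \<omega> = x + (LBINT s:{0..t}. \<mu> (X x s \<omega>)) + I t \<omega>)))"

section \<open>Stopping and value functions\<close>

definition hitting_time :: "(real \<Rightarrow> real) \<Rightarrow> real set \<Rightarrow> ereal" where
  "hitting_time y A = (INF t\<in>{t. 0 < t \<and> y t \<in> A}. ereal t)"

definition hitting_time_from :: "real \<Rightarrow> (real \<Rightarrow> real) \<Rightarrow> real set \<Rightarrow> ereal" where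
  "hitting_time_from \<epsilon> y A = (INF t\<in>{t. \<epsilon> \<le> t \<and> y t \<in> A}. ereal t)"

definition discounted_payoff ::
  "(real \<Rightarrow> real) \<Rightarrow> (real \<Rightarrow> real) \<Rightarrow> real \<Rightarrow> (real \<Rightarrow> real) \<Rightarrow> ereal \<Rightarrow> real" where
  "discounted_payoff \<delta> f t y \<rho> =
     (if \<rho> = \<infinity> then 0 else \<delta> (t + real_of_ereal \<rho>) * f (y (real_of_ereal \<rho>)))"

definition V ::
  "'w measure \<Rightarrow> (real \<Rightarrow> real \<Rightarrow> 'w \<Rightarrow> real) \<Rightarrow> (real \<Rightarrow> real) \<Rightarrow> (real \<Rightarrow> real) \<Rightarrow>
   real \<Rightarrow> real \<Rightarrow> real set \<Rightarrow> real" where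
  "V M X \<delta> f t x A =
     (\<integral>\<omega>. discounted_payoff \<delta> f t (\<lambda>s. X x s \<omega>) (hitting_time (\<lambda>s. X x s \<omega>) A) \<partial>M)"

definition J ::
  "'w measure \<Rightarrow> (real \<Rightarrow> real \<Rightarrow> 'w \<Rightarrow> real) \<Rightarrow> (real \<Rightarrow> real) \<Rightarrow> (real \<Rightarrow> real) \<Rightarrow>
   real \<Rightarrow> real set \<Rightarrow> real" where
  "J M X \<delta> f x A = V M X \<delta> f 0 x A"

definition weak_equilibrium ::
  "'w measure \<Rightarrow> real set \<Rightarrow> (real \<Rightarrow> real \<Rightarrow> 'w \<Rightarrow> real) \<Rightarrow> (real \<Rightarrow> real) \<Rightarrow> (real \<Rightarrow> real) \<Rightarrow>
   real set \<Rightarrow> bool" where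
  "weak_equilibrium M \<X> X \<delta> f S \<longleftrightarrow>
     closedin (top_of_set \<X>) S \<and>
     (\<forall>x\<in>\<X> - S. f x \<le> J M X \<delta> f x S) \<and>
     (\<forall>x\<in>S. Liminf (at_right 0) (\<lambda>\<epsilon>. ereal ((f x -
        (\<integral>\<omega>. discounted_payoff \<delta> f 0 (\<lambda>s. X x s \<omega>)
               (hitting_time_from \<epsilon> (\<lambda>s. X x s \<omega>) S) \<partial>M)) / \<epsilon>)) \<ge> 0)"

definition admissible :: "real set \<Rightarrow> real set \<Rightarrow> bool" where
  "admissible \<X> S \<longleftrightarrow>
     S \<in> sets borel \<and> closedin (top_of_set \<X>) S \<and>
     (\<forall>x\<in>(top_of_set \<X>) frontier_of S.
        (\<exists>h>0. {x-h<..<x} \<subseteq> (top_of_set \<X>) interior_of S \<and> {x<..<x+h} \<subseteq> \<X> - S \<or>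
               {x<..<x+h} \<subseteq> (top_of_set \<X>) interior_of S \<and> {x-h<..<x} \<subseteq> \<X> - S) \<or>
        (\<exists>h>0. {x-h<..<x+h} \<inter> \<X> - {x} \<subseteq> \<X> - S))"

section \<open>Function classes\<close>

text \<open>One-sided derivatives are taken along \<open>\<X>\<close>.  At an endpoint of \<open>\<X>\<close> the outer filter is
  trivial, so there the outer derivative is a constant independent of the function.\<close>

definition right_derivative :: "real set \<Rightarrow> (real \<Rightarrow> real) \<Rightarrow> real \<Rightarrow> real" where
  "right_derivative \<X> g x = vector_derivative g (at x within \<X> \<inter> {x<..})"

definition left_derivative :: "real set \<Rightarrow> (real \<Rightarrow> real) \<Rightarrow> real \<Rightarrow> real" where
  "left_derivative \<X> g x = vector_derivative g (at x within \<X> \<inter> {..<x})"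

text \<open>\<open>D j\<close> is the derivative of order \<open>j\<close>, one-sided at endpoints of \<open>U\<close> that belong to \<open>U\<close>.\<close>

definition Ck_on :: "nat \<Rightarrow> real set \<Rightarrow> (real \<Rightarrow> real) \<Rightarrow> bool" where
  "Ck_on k U g \<longleftrightarrow>
     (\<exists>D :: nat \<Rightarrow> real \<Rightarrow> real.
        (\<forall>x\<in>U. D 0 x = g x) \<and>
        (\<forall>j<k. \<forall>x\<in>U. (D j has_real_derivative D (Suc j) x) (at x within U)) \<and>
        (\<forall>j\<le>k. continuous_on U (D j)))"

definition C1k_on :: "nat \<Rightarrow> real set \<Rightarrow> (real \<Rightarrow> real \<Rightarrow> real) \<Rightarrow> bool" where
  "C1k_on k U v \<longleftrightarrow>
     (\<exists>(Dt :: real \<Rightarrow> real \<Rightarrow> real) (D :: nat \<Rightarrow> real \<Rightarrow> real \<Rightarrow> real).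
        (\<forall>t\<ge>0. \<forall>x\<in>U. D 0 t x = v t x) \<and>
        (\<forall>t\<ge>0. \<forall>x\<in>U. ((\<lambda>s. v s x) has_real_derivative Dt t x) (at t within {0..})) \<and>
        (\<forall>j<k. \<forall>t\<ge>0. \<forall>x\<in>U. (D j t has_real_derivative D (Suc j) t x) (at x within U)) \<and>
        continuous_on ({0..} \<times> U) (\<lambda>(t, x). Dt t x) \<and>
        (\<forall>j\<le>k. continuous_on ({0..} \<times> U) (\<lambda>(t, x). D j t x)))"

text \<open>Regularity on a subset \<open>E\<close> that is relatively closed in \<open>\<X>\<close>: since \<open>E\<close> contains its boundary
  points, it means agreement on \<open>E\<close> with a function of that regularity on all of \<open>\<X>\<close>.\<close>

definition Ck :: "nat \<Rightarrow> real set \<Rightarrow> real set \<Rightarrow> (real \<Rightarrow> real) \<Rightarrow> bool" where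
  "Ck k \<X> E g \<longleftrightarrow> (\<exists>h. Ck_on k \<X> h \<and> (\<forall>x\<in>E. h x = g x))"

definition C1k :: "nat \<Rightarrow> real set \<Rightarrow> real set \<Rightarrow> (real \<Rightarrow> real \<Rightarrow> real) \<Rightarrow> bool" where
  "C1k k \<X> E v \<longleftrightarrow> (\<exists>u. C1k_on k \<X> u \<and> (\<forall>t\<ge>0. \<forall>x\<in>E. u t x = v t x))"

section \<open>Standing assumptions\<close>

definition discount_function :: "(real \<Rightarrow> real) \<Rightarrow> bool" where
  "discount_function \<delta> \<longleftrightarrow>
     (\<forall>t\<ge>0. 0 \<le> \<delta> t \<and> \<delta> t \<le> 1) \<and>
     (\<forall>s t. 0 \<le> s \<and> s \<le> t \<longrightarrow> \<delta> t \<le> \<delta> s) \<and>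
     Ck_on 1 {0..} \<delta> \<and>
     \<delta> 0 = 1 \<and> (\<forall>t>0. \<delta> t < 1)"

definition growth_condition ::
  "'w measure \<Rightarrow> real set \<Rightarrow> (real \<Rightarrow> real \<Rightarrow> 'w \<Rightarrow> real) \<Rightarrow> (real \<Rightarrow> real) \<Rightarrow> (real \<Rightarrow> real) \<Rightarrow> bool" where
  "growth_condition M \<X> X \<delta> f \<longleftrightarrow>
     (\<forall>x\<in>\<X>. AE \<omega> in M. ((\<lambda>t. \<delta> t * f (X x t \<omega>)) \<longlongrightarrow> 0) at_top) \<and>
     (\<exists>\<zeta>>0. \<forall>x\<in>\<X>.
        (\<integral>\<^sup>+\<omega>. (SUP t\<in>{0..}. ennreal ((\<delta> t * f (X x t \<omega>)) powr (1 + \<zeta>))) \<partial>M) < \<infinity>)"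

text \<open>\<open>N\<close> is a set of consecutive integers, possibly empty; the last three conjuncts deal with the
  outermost pieces of \<open>\<X>\<close>.  The infimum over the empty set is \<open>\<infinity>\<close>.\<close>

definition piecewise_C2 :: "real set \<Rightarrow> (real \<Rightarrow> real) \<Rightarrow> bool" where
  "piecewise_C2 \<X> f \<longleftrightarrow>
     (\<exists>(N :: int set) \<theta>.
        (\<forall>i\<in>N. \<forall>j\<in>N. {i..j} \<subseteq> N) \<and>
        \<theta> ` N \<subseteq> \<X> \<and>
        (\<forall>n. n \<in> N \<and> n + 1 \<in> N \<longrightarrow> \<theta> n < \<theta> (n + 1) \<and> Ck 2 \<X> {\<theta> n..\<theta> (n + 1)} f) \<and>
        (INF n\<in>{n. n \<in> N \<and> n + 1 \<in> N}. ereal (\<theta> (n + 1) - \<theta> n)) > 0 \<and>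
        (\<forall>n\<in>N. n + 1 \<notin> N \<longrightarrow> Ck 2 \<X> (\<X> \<inter> {\<theta> n..}) f) \<and>
        (\<forall>n\<in>N. n - 1 \<notin> N \<longrightarrow> Ck 2 \<X> (\<X> \<inter> {..\<theta> n}) f) \<and>
        (N = {} \<longrightarrow> Ck 2 \<X> \<X> f))"

definition value_function_regularity ::
  "'w measure \<Rightarrow> real set \<Rightarrow> (real \<Rightarrow> real \<Rightarrow> 'w \<Rightarrow> real) \<Rightarrow> (real \<Rightarrow> real) \<Rightarrow> (real \<Rightarrow> real) \<Rightarrow> bool" where
  "value_function_regularity M \<X> X \<delta> f \<longleftrightarrow>
     (\<forall>S. admissible \<X> S \<longrightarrow>
        (\<forall>a\<in>\<X>. \<forall>b\<in>\<X>. a < b \<and> {a<..<b} \<subseteq> \<X> - S \<longrightarrow>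
           C1k 2 \<X> {a..b} (\<lambda>t x. V M X \<delta> f t x S)) \<and>
        (\<forall>x\<in>\<X>.
           Limsup (at_right 0) (\<lambda>t. ereal (1 / sqrt t *
             \<bar>right_derivative \<X> (\<lambda>y. V M X \<delta> f t y S) x
              - right_derivative \<X> (\<lambda>y. V M X \<delta> f 0 y S) x\<bar>)) = 0 \<and>
           Limsup (at_right 0) (\<lambda>t. ereal (1 / sqrt t *
             \<bar>left_derivative \<X> (\<lambda>y. V M X \<delta> f t y S) x
              - left_derivative \<X> (\<lambda>y. V M X \<delta> f 0 y S) x\<bar>)) = 0))"

end

theory Submission
  imports Defs
begin

text \<open>Let \<open>v = V(0, \<cdot>, S)\<close> and let \<open>U\<close> be the same value with hits of \<open>S\<close> counted from time \<open>0\<close> on, so that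
  \<open>U = f\<close> on \<open>S\<close> and \<open>U = v\<close> off \<open>S\<close>; the equilibrium property then says \<open>f \<le> U\<close> everywhere.  At a boundary
  point \<open>x\<close> one has \<open>v x = f x\<close> (\<open>v_le_f_on_S\<close>, \<open>v_eq_f_at_boundary\<close>), and with \<open>q = f' x\<close> both one-sided
  slopes of \<open>v\<close> at \<open>x\<close> turn out to be \<open>q\<close>.  On a side that lies in the interior of \<open>S\<close> this holds because
  \<open>v = f\<close> there.  On a side \<open>s = 1\<close> or \<open>s = -1\<close> that lies in the continuation region, \<open>v\<close> has some slope
  \<open>r\<close>, and \<open>f \<le> U\<close> forces \<open>s * (r - q) \<ge> 0\<close>.  If this were positive, \<open>U\<close> would have a convex kink at \<open>x\<close>, that is,
  \<open>U y \<ge> f x + q * (y - x) + \<kappa> * max 0 (s * (y - x)) - o(\<bar>y - x\<bar>)\<close> with \<open>\<kappa> > 0\<close>.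

  A kink contradicts the equilibrium property at \<open>x\<close> (\<open>no_convex_kink\<close>).  Stopping at the first visit to \<open>S\<close>
  after time \<open>t\<close> yields at least \<open>\<delta> t * E (U (X t))\<close>, by the Markov property and the supermultiplicativity of
  the discount function.  Since \<open>X t - x\<close> is \<open>\<sigma> x * (W t - W 0)\<close> up to an error of second moment \<open>O(t\<^sup>2)\<close>, the
  kink raises \<open>E (U (X t))\<close> above \<open>f x\<close> by a multiple of \<open>sqrt t\<close>, while \<open>1 - \<delta> t = O(t)\<close>.  Hence waiting gains order
  \<open>sqrt t\<close>, whereas the equilibrium condition leaves room only for a gain of \<open>o(t)\<close>.  It is enough to look at the
  times \<open>t = 1 / 2 ^ r\<close>.

  The two probabilistic facts used here, the Markov property (\<open>markov_property\<close>) and the small-time expansion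
  (\<open>small_time_remainder\<close>), both come from the Euler scheme.  Its value after \<open>n\<close> steps is an explicit
  function of the starting point and of \<open>n\<close> Gaussian increments, so that expectations along it depend on the
  starting point only and its moments obey elementary recursions.  It converges in probability to the
  diffusion (\<open>euler_converges\<close>): the defining approximation of the Ito integral by simple processes is
  made uniform in time by a maximal inequality (\<open>increment_sum_maximal\<close>), which shows that the diffusion solves the
  Euler recursion up to a uniformly small defect, and a discrete Gronwall argument does the rest.\<close>

section \<open>Gaussian increments of Brownian motion\<close>

abbreviation gauss :: "real \<Rightarrow> real measure" where
  "gauss d \<equiv> density lborel (normal_density 0 (sqrt d))"

lemma gauss_moments:
  assumes "0 < d"
  shows "integrable (gauss d) (\<lambda>w. w)" "(\<integral>w. w \<partial>gauss d) = 0"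
    "integrable (gauss d) (\<lambda>w. w\<^sup>2)" "(\<integral>w. w\<^sup>2 \<partial>gauss d) = d"
    "integrable (gauss d) (\<lambda>w. \<bar>w\<bar>)" "(\<integral>w. \<bar>w\<bar> \<partial>gauss d) = sqrt d * sqrt (2 / pi)"
proof -
  have s: "0 < sqrt d" using assms by simp
  have pos: "AE w in lborel. 0 \<le> normal_density 0 (sqrt d) w" by (simp add: normal_density_nonneg)
  have one: "has_bochner_integral lborel (\<lambda>x. normal_density 0 (sqrt d) x * x) 0"
    using normal_moment_odd[OF s, of 0 0] by simp
  have two: "has_bochner_integral lborel (\<lambda>x. normal_density 0 (sqrt d) x * x\<^sup>2) d"
    using normal_moment_even[OF s, of 0 1] assms by (simp add: fact_numeral)
  have ab: "has_bochner_integral lborel (\<lambda>x. normal_density 0 (sqrt d) x * \<bar>x\<bar>) (sqrt d * sqrt (2 / pi))"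
    using normal_moment_abs_odd[OF s, of 0 0] by simp
  show "integrable (gauss d) (\<lambda>w. w)" "(\<integral>w. w \<partial>gauss d) = 0"
    "integrable (gauss d) (\<lambda>w. w\<^sup>2)" "(\<integral>w. w\<^sup>2 \<partial>gauss d) = d"
    "integrable (gauss d) (\<lambda>w. \<bar>w\<bar>)" "(\<integral>w. \<bar>w\<bar> \<partial>gauss d) = sqrt d * sqrt (2 / pi)"
    using one two ab pos
    by (simp_all add: integrable_density integral_density has_bochner_integral_iff)
qed

lemma nn_integral_gauss_affine_square:
  assumes "0 < d"
  shows "(\<integral>\<^sup>+w. ennreal ((a + b * w)\<^sup>2) \<partial>gauss d) = ennreal (a\<^sup>2 + b\<^sup>2 * d)"
proof -
  interpret G: prob_space "gauss d" using assms by (intro prob_space_normal_density) simp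
  note g = gauss_moments[OF assms]
  have eq: "(a + b * w)\<^sup>2 = a\<^sup>2 + (2 * a * b) * w + b\<^sup>2 * w\<^sup>2" for w
    by (simp add: power2_eq_square algebra_simps)
  have int: "integrable (gauss d) (\<lambda>w. (a + b * w)\<^sup>2)"
    unfolding eq using g by (intro Bochner_Integration.integrable_add integrable_mult_right) auto
  have "(\<integral>w. (a + b * w)\<^sup>2 \<partial>gauss d) = a\<^sup>2 + b\<^sup>2 * d"
    unfolding eq using g G.prob_space by simp
  then show ?thesis using nn_integral_eq_integral[OF int] by simp
qed

locale brownian_filtration =
  fixes M :: "'w measure" and F :: "real \<Rightarrow> 'w measure" and W :: "real \<Rightarrow> 'w \<Rightarrow> real"
  assumes filtered: "filtered_prob_space M F" and brownian: "brownian_motion M F W"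
begin

sublocale prob_space M using filtered by (simp add: filtered_prob_space_def)

lemma space_F: "0 \<le> t \<Longrightarrow> space (F t) = space M"
  using filtered by (simp add: filtered_prob_space_def subalgebra_def)

lemma measurable_F_mono:
  "Z \<in> measurable (F s) N \<Longrightarrow> 0 \<le> s \<Longrightarrow> s \<le> t \<Longrightarrow> Z \<in> measurable (F t) N"
  using filtered space_F[of s] space_F[of t]
  by (intro measurable_from_subalg[of "F t" "F s" Z N])
     (simp_all add: filtered_prob_space_def subalgebra_def)

lemma measurable_F_M: "Z \<in> measurable (F s) N \<Longrightarrow> 0 \<le> s \<Longrightarrow> Z \<in> measurable M N"
  using filtered by (auto simp: filtered_prob_space_def intro: measurable_from_subalg)

lemma W_measurable: "0 \<le> s \<Longrightarrow> s \<le> t \<Longrightarrow> W s \<in> borel_measurable (F t)"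
  using brownian measurable_F_mono[of "W s" s borel t] by (auto simp: brownian_motion_def adapted_def)

lemma W_measurable_M: "0 \<le> s \<Longrightarrow> W s \<in> borel_measurable M"
  using W_measurable[of s s] measurable_F_M by auto

lemma distr_increment:
  assumes "0 \<le> s" "s < t" shows "distr M borel (\<lambda>\<omega>. W t \<omega> - W s \<omega>) = gauss (t - s)"
proof -
  have "distributed M lborel (\<lambda>\<omega>. W t \<omega> - W s \<omega>) (normal_density 0 (sqrt (t - s)))"
    using brownian assms by (auto simp: brownian_motion_def)
  from distributed_distr_eq_density[OF this]
  show ?thesis by (simp cong: distr_cong)
qed

text \<open>The increment is independent of the past, so conditionally on \<open>F s\<close> it may be integrated out
  against its Gaussian law.\<close>

lemma nn_integral_increment:
  assumes st: "0 \<le> s" "s < t" and Z: "Z \<in> measurable (F s) N"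
    and \<psi>: "\<psi> \<in> borel_measurable (N \<Otimes>\<^sub>M borel)"
  shows "(\<integral>\<^sup>+\<omega>. \<psi> (Z \<omega>, W t \<omega> - W s \<omega>) \<partial>M) = (\<integral>\<^sup>+\<omega>. (\<integral>\<^sup>+w. \<psi> (Z \<omega>, w) \<partial>gauss (t - s)) \<partial>M)"
proof -
  let ?D = "\<lambda>\<omega>. W t \<omega> - W s \<omega>"
  have [measurable]: "Z \<in> measurable M N" using measurable_F_M[OF Z] st by auto
  have [measurable]: "?D \<in> borel_measurable M"
    using W_measurable_M[of s] W_measurable_M[of t] st by simp
  have ind: "indep_set (sets (F s)) {?D -` B \<inter> space M |B. B \<in> sets borel}"
    using brownian st by (auto simp: brownian_motion_def)
  interpret G: prob_space "gauss (t - s)" using st by (intro prob_space_normal_density) simp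
  interpret Z: prob_space "distr M N Z" by (rule prob_space_distr) simp
  have eq: "distr M N Z \<Otimes>\<^sub>M gauss (t - s) = distr M (N \<Otimes>\<^sub>M borel) (\<lambda>\<omega>. (Z \<omega>, ?D \<omega>))"
  proof (rule pair_measure_eqI)
    fix A B assume A: "A \<in> sets (distr M N Z)" and B: "B \<in> sets (gauss (t - s))"
    let ?a = "Z -` A \<inter> space M" and ?b = "?D -` B \<inter> space M"
    have "?a \<in> sets (F s)" using A measurable_sets[OF Z] space_F[of s] st by auto
    then have p: "prob (?a \<inter> ?b) = prob ?a * prob ?b" using B by (intro indep_setD[OF ind]) auto
    have "?a \<inter> ?b = (\<lambda>\<omega>. (Z \<omega>, ?D \<omega>)) -` (A \<times> B) \<inter> space M" by auto
    then show "emeasure (distr M N Z) A * emeasure (gauss (t - s)) B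
        = emeasure (distr M (N \<Otimes>\<^sub>M borel) (\<lambda>\<omega>. (Z \<omega>, ?D \<omega>))) (A \<times> B)"
      unfolding distr_increment[OF st, symmetric] using A B p
      by (simp add: emeasure_distr emeasure_eq_measure ennreal_mult[symmetric])
  qed (auto intro: Z.sigma_finite_measure_axioms G.sigma_finite_measure_axioms cong: sets_pair_measure_cong)
  have \<psi>': "\<psi> \<in> borel_measurable (distr M N Z \<Otimes>\<^sub>M gauss (t - s))"
    using \<psi> by (simp cong: measurable_cong_sets sets_pair_measure_cong)
  have \<psi>2: "\<psi> \<in> borel_measurable (N \<Otimes>\<^sub>M gauss (t - s))"
    using \<psi> by (simp cong: measurable_cong_sets sets_pair_measure_cong)
  have "(\<integral>\<^sup>+\<omega>. \<psi> (Z \<omega>, ?D \<omega>) \<partial>M) = (\<integral>\<^sup>+z. \<psi> z \<partial>distr M (N \<Otimes>\<^sub>M borel) (\<lambda>\<omega>. (Z \<omega>, ?D \<omega>)))"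
    using \<psi> by (subst nn_integral_distr) auto
  also have "\<dots> = (\<integral>\<^sup>+z. (\<integral>\<^sup>+w. \<psi> (z, w) \<partial>gauss (t - s)) \<partial>distr M N Z)"
    unfolding eq[symmetric] by (subst G.nn_integral_fst[OF \<psi>']) simp
  also have "\<dots> = (\<integral>\<^sup>+\<omega>. (\<integral>\<^sup>+w. \<psi> (Z \<omega>, w) \<partial>gauss (t - s)) \<partial>M)"
    using G.borel_measurable_nn_integral_fst[OF \<psi>2] by (subst nn_integral_distr) auto
  finally show ?thesis .
qed

lemma nn_integral_increment_square:
  assumes st: "0 \<le> s" "s < t" and Y: "A \<in> borel_measurable (F s)" "B \<in> borel_measurable (F s)"
  shows "(\<integral>\<^sup>+\<omega>. ennreal ((A \<omega> + B \<omega> * (W t \<omega> - W s \<omega>))\<^sup>2) \<partial>M)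
       = (\<integral>\<^sup>+\<omega>. ennreal ((A \<omega>)\<^sup>2 + (B \<omega>)\<^sup>2 * (t - s)) \<partial>M)"
  using nn_integral_increment[OF st, of "\<lambda>\<omega>. (A \<omega>, B \<omega>)" "borel \<Otimes>\<^sub>M borel"
      "\<lambda>z. ennreal ((fst (fst z) + snd (fst z) * snd z)\<^sup>2)"] Y st
  by (simp add: nn_integral_gauss_affine_square)

lemma second_moment_tail:
  assumes [measurable]: "Y \<in> borel_measurable M"
    and Y: "(\<integral>\<^sup>+\<omega>. ennreal ((Y \<omega>)\<^sup>2) \<partial>M) \<le> ennreal b" and ab: "0 < a" "0 \<le> b"
  shows "prob {\<omega>\<in>space M. a < \<bar>Y \<omega>\<bar>} \<le> b / a\<^sup>2"
proof -
  have "ennreal (a\<^sup>2) * emeasure M {\<omega>\<in>space M. a < \<bar>Y \<omega>\<bar>}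
      = (\<integral>\<^sup>+\<omega>. ennreal (a\<^sup>2) * indicator {\<omega>\<in>space M. a < \<bar>Y \<omega>\<bar>} \<omega> \<partial>M)"
    by (subst nn_integral_cmult_indicator) auto
  also have "\<dots> \<le> (\<integral>\<^sup>+\<omega>. ennreal ((Y \<omega>)\<^sup>2) \<partial>M)"
  proof (rule nn_integral_mono)
    fix \<omega>
    have "a\<^sup>2 \<le> (Y \<omega>)\<^sup>2" if "a < \<bar>Y \<omega>\<bar>"
      using ab that by (intro abs_le_square_iff[THEN iffD1]) auto
    then show "ennreal (a\<^sup>2) * indicator {\<omega>\<in>space M. a < \<bar>Y \<omega>\<bar>} \<omega> \<le> ennreal ((Y \<omega>)\<^sup>2)"
      by (auto simp: indicator_def intro: ennreal_leI)
  qed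
  also note Y
  finally show ?thesis using ab
    by (simp add: emeasure_eq_measure ennreal_mult[symmetric] field_simps)
qed

section \<open>A maximal inequality for discrete stochastic integrals\<close>

text \<open>The integrand is set to zero as soon as the sum leaves \<open>[-a, a]\<close> or its quadratic variation is
  about to exceed \<open>b\<close>.  The sum stopped in this way has second moment at most \<open>b\<close>, for an arbitrary integrand,
  and it stays outside \<open>[-a, a]\<close> on every path that has left this interval, unless \<open>Q K\<close> exceeds \<open>b\<close>.\<close>

lemma increment_sum_maximal:
  fixes g :: "nat \<Rightarrow> real" and \<eta> :: "nat \<Rightarrow> 'w \<Rightarrow> real"
  assumes g0: "0 \<le> g 0" and g: "\<And>i. i < K \<Longrightarrow> g i < g (Suc i)"
    and \<eta>: "\<And>i. i < K \<Longrightarrow> \<eta> i \<in> borel_measurable (F (g i))"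
    and ab: "0 < a" "0 \<le> b"
  defines "N \<equiv> \<lambda>k \<omega>. \<Sum>i<k. \<eta> i \<omega> * (W (g (Suc i)) \<omega> - W (g i) \<omega>)"
    and "Q \<equiv> \<lambda>k \<omega>. \<Sum>i<k. (\<eta> i \<omega>)\<^sup>2 * (g (Suc i) - g i)"
  shows "prob {\<omega>\<in>space M. \<exists>k\<le>K. a < \<bar>N k \<omega>\<bar>} \<le> b / a\<^sup>2 + prob {\<omega>\<in>space M. b < Q K \<omega>}"
proof -
  have gpos: "i \<le> K \<Longrightarrow> 0 \<le> g i" for i
  proof (induction i)
    case (Suc i) then show ?case using g[of i] by auto
  qed (use g0 in simp)
  have gmono: "i \<le> j \<Longrightarrow> j \<le> K \<Longrightarrow> g i \<le> g j" for i j
  proof (induction j)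
    case (Suc j) then show ?case using g[of j] by (cases "i = Suc j") auto
  qed simp
  have \<eta>m: "\<eta> i \<in> borel_measurable (F (g j))" if "i \<le> j" "i < K" "j \<le> K" for i j
    using measurable_F_mono[OF \<eta>[OF that(2)], of "g j"] gpos gmono that by auto
  have Wm: "W (g i) \<in> borel_measurable (F (g j))" if "i \<le> j" "j \<le> K" for i j
    using W_measurable gpos gmono that by auto
  have Jm: "N k \<in> borel_measurable (F (g j))" if "k \<le> j" "j \<le> K" for j k
    unfolding N_def using that
    by (intro borel_measurable_sum borel_measurable_times borel_measurable_diff \<eta>m Wm) auto
  have Qm: "Q k \<in> borel_measurable (F (g j))" if "k \<le> Suc j" "k \<le> K" "j \<le> K" for j k
    unfolding Q_def using that
    by (intro borel_measurable_sum borel_measurable_times borel_measurable_power \<eta>m) auto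
  have Qmono: "Q k \<omega> \<le> Q l \<omega>" if "k \<le> l" "l \<le> K" for k l \<omega>
    unfolding Q_def by (rule sum_mono2) (use that g in \<open>auto intro!: mult_nonneg_nonneg simp: less_imp_le\<close>)
  \<comment> \<open>\<open>A k\<close> is known at time \<open>g k\<close>, as \<open>Q (Suc k)\<close> involves the integrand only up to index \<open>k\<close>.\<close>
  define A where "A k = {\<omega>\<in>space M. (\<forall>j\<le>k. \<bar>N j \<omega>\<bar> \<le> a) \<and> Q (Suc k) \<omega> \<le> b}" for k
  have Am: "A k \<in> sets (F (g k))" if "k < K" for k
  proof -
    have [measurable]: "Q (Suc k) \<in> borel_measurable (F (g k))" using Qm[of "Suc k" k] that by auto
    have all: "(\<lambda>\<omega>. \<forall>j\<le>k. \<bar>N j \<omega>\<bar> \<le> a) \<in> measurable (F (g k)) (count_space UNIV)"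
    proof -
      have "(\<lambda>\<omega>. \<forall>j\<in>{..k}. \<bar>N j \<omega>\<bar> \<le> a) \<in> measurable (F (g k)) (count_space UNIV)"
      proof (rule pred_intros_finite(3))
        fix j assume "j \<in> {..k}"
        then have [measurable]: "N j \<in> borel_measurable (F (g k))" using Jm[of j k] that by simp
        show "Measurable.pred (F (g k)) (\<lambda>\<omega>. \<bar>N j \<omega>\<bar> \<le> a)" by measurable
      qed simp
      then show ?thesis by (simp only: Ball_def atMost_iff)
    qed
    have "{\<omega>\<in>space (F (g k)). (\<forall>j\<le>k. \<bar>N j \<omega>\<bar> \<le> a) \<and> Q (Suc k) \<omega> \<le> b} \<in> sets (F (g k))"
    proof (rule sets.sets_Collect_conj)
      show "{\<omega>\<in>space (F (g k)). \<forall>j\<le>k. \<bar>N j \<omega>\<bar> \<le> a} \<in> sets (F (g k))"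
        using all unfolding pred_def .
      show "{\<omega>\<in>space (F (g k)). Q (Suc k) \<omega> \<le> b} \<in> sets (F (g k))" by measurable
    qed
    moreover have "space (F (g k)) = space M" using space_F gpos that by simp
    ultimately show ?thesis unfolding A_def by (simp only:)
  qed
  define H where "H k \<omega> = (\<Sum>i<k. indicator (A i) \<omega> * \<eta> i \<omega> * (W (g (Suc i)) \<omega> - W (g i) \<omega>))" for k \<omega>
  define R where "R k \<omega> = (\<Sum>i<k. (indicator (A i) \<omega> * \<eta> i \<omega>)\<^sup>2 * (g (Suc i) - g i))" for k \<omega>
  have A\<eta>m: "(\<lambda>\<omega>. indicator (A i) \<omega> * \<eta> i \<omega>) \<in> borel_measurable (F (g j))" if "i \<le> j" "i < K" "j \<le> K" for i j
  proof -
    have "(\<lambda>\<omega>. indicator (A i) \<omega> * \<eta> i \<omega>) \<in> borel_measurable (F (g i))"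
      using Am[of i] \<eta>[of i] that by (intro borel_measurable_times borel_measurable_indicator) auto
    then show ?thesis by (rule measurable_F_mono) (use gpos[of i] gmono[of i j] that in auto)
  qed
  have Hm: "H k \<in> borel_measurable (F (g k))" if "k \<le> K" for k
    unfolding H_def using that
    by (intro borel_measurable_sum borel_measurable_times[OF A\<eta>m] borel_measurable_diff Wm) auto
  have Rm: "R k \<in> borel_measurable (F (g k))" if "k \<le> K" for k
    unfolding R_def using that
    by (intro borel_measurable_sum borel_measurable_times borel_measurable_power A\<eta>m) auto
  have Rpos: "0 \<le> R k \<omega>" if "k \<le> K" for k \<omega>
    unfolding R_def by (rule sum_nonneg) (use g that in \<open>auto simp: less_imp_le\<close>)
  have HR: "(\<integral>\<^sup>+\<omega>. ennreal ((H k \<omega>)\<^sup>2) \<partial>M) = (\<integral>\<^sup>+\<omega>. ennreal (R k \<omega>) \<partial>M)" if "k \<le> K" for k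
    using that
  proof (induction k)
    case 0 then show ?case by (simp add: H_def R_def)
  next
    case (Suc k)
    have gk: "0 \<le> g k" "g k < g (Suc k)" using gpos[of k] g[of k] Suc by auto
    have [measurable]: "H k \<in> borel_measurable M" "R k \<in> borel_measurable M"
      "(\<lambda>\<omega>. indicator (A k) \<omega> * \<eta> k \<omega>) \<in> borel_measurable M"
      using Suc by (auto intro!: measurable_F_M[OF _ gk(1)] Hm Rm A\<eta>m)
    have "(\<integral>\<^sup>+\<omega>. ennreal ((H (Suc k) \<omega>)\<^sup>2) \<partial>M)
        = (\<integral>\<^sup>+\<omega>. ennreal ((H k \<omega>)\<^sup>2 + (indicator (A k) \<omega> * \<eta> k \<omega>)\<^sup>2 * (g (Suc k) - g k)) \<partial>M)"
      using nn_integral_increment_square[OF gk Hm[of k] A\<eta>m[of k k]] Suc by (simp add: H_def)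
    also have "\<dots> = (\<integral>\<^sup>+\<omega>. ennreal ((H k \<omega>)\<^sup>2) \<partial>M)
        + (\<integral>\<^sup>+\<omega>. ennreal ((indicator (A k) \<omega> * \<eta> k \<omega>)\<^sup>2 * (g (Suc k) - g k)) \<partial>M)"
      using gk by (subst nn_integral_add[symmetric]) (auto simp: ennreal_plus)
    also have "\<dots> = (\<integral>\<^sup>+\<omega>. ennreal (R k \<omega>) \<partial>M)
        + (\<integral>\<^sup>+\<omega>. ennreal ((indicator (A k) \<omega> * \<eta> k \<omega>)\<^sup>2 * (g (Suc k) - g k)) \<partial>M)"
      using Suc by simp
    also have "\<dots> = (\<integral>\<^sup>+\<omega>. ennreal (R (Suc k) \<omega>) \<partial>M)"
    proof -
      have RS: "R (Suc k) \<omega> = R k \<omega> + (indicator (A k) \<omega> * \<eta> k \<omega>)\<^sup>2 * (g (Suc k) - g k)" for \<omega>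
        by (simp add: R_def)
      show ?thesis unfolding RS using gk Rpos[of k] Suc.prems
        by (subst nn_integral_add[symmetric]) (auto simp: ennreal_plus)
    qed
    finally show ?case .
  qed
  have AD: "\<omega> \<in> A i" if "\<omega> \<in> A k" "i \<le> k" "k < K" for \<omega> i k
    using that Qmono[of "Suc i" "Suc k" \<omega>] by (auto simp: A_def)
  have Rb: "R k \<omega> \<le> b" if "k \<le> K" for k \<omega>
    using that
  proof (induction k)
    case 0 then show ?case using ab by (simp add: R_def)
  next
    case (Suc k)
    show ?case
    proof (cases "\<omega> \<in> A k")
      case True
      have "R (Suc k) \<omega> = Q (Suc k) \<omega>" unfolding R_def Q_def
        by (rule sum.cong) (use AD[OF True] Suc.prems in auto)
      then show ?thesis using True by (auto simp: A_def)
    next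
      case False
      then show ?thesis using Suc by (simp add: R_def)
    qed
  qed
  have [measurable]: "H K \<in> borel_measurable M" "Q K \<in> borel_measurable M"
    "\<And>k. k \<le> K \<Longrightarrow> N k \<in> borel_measurable M"
    by (auto intro!: measurable_F_M[OF _ gpos[of K]] Hm Qm Jm)
  \<comment> \<open>With \<open>k\<close> the first exit index, the stopped sum equals the original one at \<open>k\<close> and never moves again.\<close>
  have stop: "a < \<bar>H K \<omega>\<bar>" if ex: "\<exists>k\<le>K. a < \<bar>N k \<omega>\<bar>" and q: "Q K \<omega> \<le> b" and sp: "\<omega> \<in> space M" for \<omega>
  proof -
    define k where "k = (LEAST k. a < \<bar>N k \<omega>\<bar>)"
    have k: "a < \<bar>N k \<omega>\<bar>" "k \<le> K"
      using ex unfolding k_def by (auto intro: LeastI Least_le order_trans)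
    have less: "\<bar>N j \<omega>\<bar> \<le> a" if "j < k" for j
      using not_less_Least[of j "\<lambda>k. a < \<bar>N k \<omega>\<bar>"] that unfolding k_def by auto
    have in1: "\<omega> \<in> A i" if "i < k" for i
      using less that q Qmono[of "Suc i" K \<omega>] k sp by (fastforce simp: A_def)
    have in2: "\<omega> \<notin> A i" if "k \<le> i" for i
      using k that by (auto simp: A_def not_le)
    have "H K \<omega> = (\<Sum>i<k. indicator (A i) \<omega> * \<eta> i \<omega> * (W (g (Suc i)) \<omega> - W (g i) \<omega>))"
      unfolding H_def by (rule sum.mono_neutral_right) (use in2 k in \<open>auto simp: not_less\<close>)
    also have "\<dots> = N k \<omega>" unfolding N_def by (rule sum.cong) (use in1 in auto)
    finally show ?thesis using k by simp
  qed
  have "(\<integral>\<^sup>+\<omega>. ennreal ((H K \<omega>)\<^sup>2) \<partial>M) \<le> (\<integral>\<^sup>+\<omega>. ennreal b \<partial>M)"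
    unfolding HR[OF order_refl] by (intro nn_integral_mono ennreal_leI Rb) simp
  then have "prob {\<omega>\<in>space M. a < \<bar>H K \<omega>\<bar>} \<le> b / a\<^sup>2"
    by (intro second_moment_tail ab) (simp_all add: emeasure_space_1)
  moreover have "prob {\<omega>\<in>space M. \<exists>k\<le>K. a < \<bar>N k \<omega>\<bar>}
      \<le> prob ({\<omega>\<in>space M. a < \<bar>H K \<omega>\<bar>} \<union> {\<omega>\<in>space M. b < Q K \<omega>})"
    by (rule finite_measure_mono) (use stop in \<open>auto simp: not_less[symmetric]\<close>)
  moreover have "\<dots> \<le> prob {\<omega>\<in>space M. a < \<bar>H K \<omega>\<bar>} + prob {\<omega>\<in>space M. b < Q K \<omega>}"
    by (rule measure_Un_le) auto
  ultimately show ?thesis by linarith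
qed

end

section \<open>Riemann sums of Ito integrals\<close>

lemma tendsto_zero_le_eventuallyI:
  fixes f :: "'a \<Rightarrow> real"
  assumes "\<And>e. 0 < e \<Longrightarrow> \<forall>\<^sub>F x in A. f x \<le> e" "\<And>x. 0 \<le> f x"
  shows "(f \<longlongrightarrow> 0) A"
proof (rule order_tendstoI)
  fix e :: real assume "0 < e"
  then have "\<forall>\<^sub>F x in A. f x \<le> e / 2" by (intro assms(1)) simp
  then show "\<forall>\<^sub>F x in A. f x < e" by eventually_elim (use \<open>0 < e\<close> in linarith)
next
  fix e :: real assume "e < 0"
  then show "\<forall>\<^sub>F x in A. e < f x" using assms(2) by (intro always_eventually allI) (rule less_le_trans)
qed

lemma dyadic_floor:
  fixes s :: real assumes "0 \<le> s"
  shows "real (nat \<lfloor>2 ^ m * s\<rfloor>) / 2 ^ m \<le> s" "(\<lambda>m. real (nat \<lfloor>2 ^ m * s\<rfloor>) / 2 ^ m) \<longlonglongrightarrow> s"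
proof -
  have p: "0 \<le> 2 ^ m * s" for m using assms by simp
  show le: "real (nat \<lfloor>2 ^ m * s\<rfloor>) / 2 ^ m \<le> s" for m
  proof -
    have "real (nat \<lfloor>2 ^ m * s\<rfloor>) \<le> 2 ^ m * s" using p[of m] by linarith
    then show ?thesis by (simp add: field_simps)
  qed
  have ge: "s - (1/2) ^ m \<le> real (nat \<lfloor>2 ^ m * s\<rfloor>) / 2 ^ m" for m
  proof -
    have "2 ^ m * s - 1 \<le> real (nat \<lfloor>2 ^ m * s\<rfloor>)" using p[of m] by linarith
    then have "(2 ^ m * s - 1) / 2 ^ m \<le> real (nat \<lfloor>2 ^ m * s\<rfloor>) / 2 ^ m" by (rule divide_right_mono) simp
    then show ?thesis by (simp add: diff_divide_distrib power_one_over)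
  qed
  have "(\<lambda>m. s - (1/2) ^ m) \<longlonglongrightarrow> s - 0" by (intro tendsto_diff tendsto_const LIMSEQ_realpow_zero) auto
  then have lim: "(\<lambda>m. s - (1/2) ^ m) \<longlonglongrightarrow> s" by simp
  show "(\<lambda>m. real (nat \<lfloor>2 ^ m * s\<rfloor>) / 2 ^ m) \<longlonglongrightarrow> s"
    by (rule tendsto_sandwich[OF _ _ lim tendsto_const]) (use ge le in auto)
qed

lemma dyadic_ceiling:
  fixes s :: real assumes "0 \<le> s"
  shows "s \<le> real (nat \<lceil>2 ^ m * s\<rceil>) / 2 ^ m" "(\<lambda>m. real (nat \<lceil>2 ^ m * s\<rceil>) / 2 ^ m) \<longlonglongrightarrow> s"
proof -
  have p: "0 \<le> 2 ^ m * s" for m using assms by simp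
  show ge: "s \<le> real (nat \<lceil>2 ^ m * s\<rceil>) / 2 ^ m" for m
  proof -
    have "2 ^ m * s \<le> real (nat \<lceil>2 ^ m * s\<rceil>)" using p[of m] by linarith
    then show ?thesis by (simp add: field_simps)
  qed
  have le: "real (nat \<lceil>2 ^ m * s\<rceil>) / 2 ^ m \<le> s + (1/2) ^ m" for m
  proof -
    have "real (nat \<lceil>2 ^ m * s\<rceil>) \<le> 2 ^ m * s + 1" using p[of m] by linarith
    then have "real (nat \<lceil>2 ^ m * s\<rceil>) / 2 ^ m \<le> (2 ^ m * s + 1) / 2 ^ m" by (rule divide_right_mono) simp
    then show ?thesis by (simp add: add_divide_distrib power_one_over)
  qed
  have "(\<lambda>m. s + (1/2) ^ m) \<longlonglongrightarrow> s + 0" by (intro tendsto_add tendsto_const LIMSEQ_realpow_zero) auto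
  then have lim: "(\<lambda>m. s + (1/2) ^ m) \<longlonglongrightarrow> s" by simp
  show "(\<lambda>m. real (nat \<lceil>2 ^ m * s\<rceil>) / 2 ^ m) \<longlonglongrightarrow> s"
    by (rule tendsto_sandwich[OF _ _ tendsto_const lim]) (use ge le in auto)
qed

context brownian_filtration
begin

text \<open>In contrast to \<^const>\<open>simple_process\<close>, values may be unbounded, so that an adapted process sampled along
  a grid qualifies.\<close>

definition step_process :: "nat \<Rightarrow> (nat \<Rightarrow> real) \<Rightarrow> (nat \<Rightarrow> 'w \<Rightarrow> real) \<Rightarrow> bool" where
  "step_process n \<tau> \<xi> \<longleftrightarrow> 0 \<le> \<tau> 0 \<and> (\<forall>i<n. \<tau> i < \<tau> (Suc i) \<and> \<xi> i \<in> borel_measurable (F (\<tau> i)))"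

lemma step_process_knots: "step_process n \<tau> \<xi> \<Longrightarrow> i \<le> n \<Longrightarrow> 0 \<le> \<tau> i"
proof (induction i)
  case (Suc i)
  then have "\<tau> i < \<tau> (Suc i)" by (simp add: step_process_def)
  then show ?case using Suc by simp
qed (simp add: step_process_def)

text \<open>Between neighbouring knots a simple process is constant and its integral is a single increment
  of \<open>W\<close>; this lets two processes with different knots be compared on a common refinement.\<close>

lemma simple_integral_gap:
  assumes "step_process n \<tau> \<xi>" "u < v" "\<And>i. i \<le> n \<Longrightarrow> \<tau> i \<le> u \<or> v \<le> \<tau> i"
  shows "simple_integral W n \<tau> \<xi> v \<omega> - simple_integral W n \<tau> \<xi> u \<omega>
       = simple_value n \<tau> \<xi> v \<omega> * (W v \<omega> - W u \<omega>)"
  unfolding simple_integral_def simple_value_def sum_subtractf[symmetric] sum_distrib_right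
proof (rule sum.cong[OF refl])
  fix i assume i: "i \<in> {..<n}"
  have a: "\<tau> i < \<tau> (Suc i)" using assms(1) i by (simp add: step_process_def)
  have b: "\<tau> i \<le> u \<or> v \<le> \<tau> i" "\<tau> (Suc i) \<le> u \<or> v \<le> \<tau> (Suc i)" using assms(3)[of i] assms(3)[of "Suc i"] i by auto
  consider "\<tau> (Suc i) \<le> u" | "\<tau> i \<le> u" "v \<le> \<tau> (Suc i)" | "v \<le> \<tau> i" using a b by linarith
  then show "\<xi> i \<omega> * (W (min v (\<tau> (Suc i))) \<omega> - W (min v (\<tau> i)) \<omega>) -
      \<xi> i \<omega> * (W (min u (\<tau> (Suc i))) \<omega> - W (min u (\<tau> i)) \<omega>)
      = \<xi> i \<omega> * indicator {\<tau> i<..\<tau> (Suc i)} v * (W v \<omega> - W u \<omega>)"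
    by cases (use a \<open>u < v\<close> in \<open>simp_all add: min_def indicator_def algebra_simps\<close>)
qed

lemma simple_value_gap:
  assumes "step_process n \<tau> \<xi>" "u < s" "s \<le> v" "\<And>i. i \<le> n \<Longrightarrow> \<tau> i \<le> u \<or> v \<le> \<tau> i"
  shows "simple_value n \<tau> \<xi> s \<omega> = simple_value n \<tau> \<xi> v \<omega>"
  unfolding simple_value_def
proof (rule sum.cong[OF refl])
  fix i assume i: "i \<in> {..<n}"
  have b: "\<tau> i \<le> u \<or> v \<le> \<tau> i" "\<tau> (Suc i) \<le> u \<or> v \<le> \<tau> (Suc i)"
    using assms(4)[of i] assms(4)[of "Suc i"] i by auto
  have "s \<in> {\<tau> i<..\<tau> (Suc i)} \<longleftrightarrow> v \<in> {\<tau> i<..\<tau> (Suc i)}" using b assms(2,3) by auto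
  then show "\<xi> i \<omega> * indicator {\<tau> i<..\<tau> (Suc i)} s = \<xi> i \<omega> * indicator {\<tau> i<..\<tau> (Suc i)} v"
    by (simp add: indicator_def)
qed

lemma simple_value_gap_measurable:
  assumes "step_process n \<tau> \<xi>" "0 \<le> u" "\<And>i. i \<le> n \<Longrightarrow> \<tau> i \<le> u \<or> v \<le> \<tau> i"
  shows "simple_value n \<tau> \<xi> v \<in> borel_measurable (F u)"
  unfolding simple_value_def
proof (rule borel_measurable_sum)
  fix i assume i: "i \<in> {..<n}"
  show "(\<lambda>\<omega>. \<xi> i \<omega> * indicator {\<tau> i<..\<tau> (Suc i)} v) \<in> borel_measurable (F u)"
  proof (cases "v \<in> {\<tau> i<..\<tau> (Suc i)}")
    case True
    then have le: "\<tau> i \<le> u" using assms(3)[of i] i by auto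
    have "\<xi> i \<in> borel_measurable (F (\<tau> i))" using assms(1) i by (simp add: step_process_def)
    then have "\<xi> i \<in> borel_measurable (F u)"
      by (rule measurable_F_mono) (use le step_process_knots[OF assms(1), of i] i in auto)
    then show ?thesis by simp
  next
    case False
    then show ?thesis by simp
  qed
qed

lemma simple_value_path_measurable [measurable]: "(\<lambda>s. simple_value n \<tau> \<xi> s \<omega>) \<in> borel_measurable borel"
  unfolding simple_value_def by measurable

lemma step_process_measurable_M:
  "step_process n \<tau> \<xi> \<Longrightarrow> i < n \<Longrightarrow> \<xi> i \<in> borel_measurable M"
  using step_process_knots[of n \<tau> \<xi> i] measurable_F_M[of "\<xi> i" "\<tau> i" borel]
  by (auto simp: step_process_def)

lemma simple_integral_measurable:
  assumes "step_process n \<tau> \<xi>" "0 \<le> t"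
  shows "simple_integral W n \<tau> \<xi> t \<in> borel_measurable M"
  unfolding simple_integral_def using assms
  by (intro borel_measurable_sum borel_measurable_times borel_measurable_diff W_measurable_M)
     (auto intro: step_process_measurable_M step_process_knots)

lemma simple_value_measurable:
  assumes "step_process n \<tau> \<xi>"
  shows "(\<lambda>(\<omega>, s). simple_value n \<tau> \<xi> s \<omega>) \<in> borel_measurable (M \<Otimes>\<^sub>M borel)"
proof -
  have [measurable]: "i < n \<Longrightarrow> \<xi> i \<in> borel_measurable M" for i
    using assms by (rule step_process_measurable_M)
  show ?thesis unfolding simple_value_def by measurable
qed

text \<open>The knots of both processes and the observation times are merged into one grid, on which the
  difference of the two integrals is a discrete stochastic integral whose quadratic variation is the
  \<open>L\<^sup>2\<close> distance of the integrands.\<close>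

lemma step_integrals_close:
  assumes P1: "step_process n1 \<tau>1 \<xi>1" and P2: "step_process n2 \<tau>2 \<xi>2"
    and G: "finite G" "G \<subseteq> {0..T}" and T: "0 \<le> T" and ab: "0 < a" "0 \<le> b"
  shows "prob {\<omega>\<in>space M. \<exists>t\<in>G. a < \<bar>simple_integral W n1 \<tau>1 \<xi>1 t \<omega> - simple_integral W n2 \<tau>2 \<xi>2 t \<omega>\<bar>}
    \<le> b / a\<^sup>2 + prob {\<omega>\<in>space M. ennreal b <
        (\<integral>\<^sup>+s\<in>{0..T}. ennreal ((simple_value n1 \<tau>1 \<xi>1 s \<omega> - simple_value n2 \<tau>2 \<xi>2 s \<omega>)\<^sup>2) \<partial>lborel)}"
proof -
  define U where "U = {0, T} \<union> G \<union> ((\<tau>1 ` {..n1} \<union> \<tau>2 ` {..n2}) \<inter> {0..T})"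
  define L where "L = sorted_list_of_set U"
  define K where "K = length L - 1"
  define g where "g i = L ! i" for i
  have fin: "finite U" and UT: "U \<subseteq> {0..T}" using G T by (auto simp: U_def)
  have setL: "set L = U" and sL: "sorted L" "distinct L" using fin by (auto simp: L_def)
  have lenL: "length L = Suc K"
  proof -
    have "L \<noteq> []" using setL by (auto simp: U_def)
    then show ?thesis by (simp add: K_def)
  qed
  have gU: "g i \<in> U" if "i \<le> K" for i using that lenL setL by (auto simp: g_def)
  have Ug: "\<exists>i\<le>K. t = g i" if "t \<in> U" for t
    using that lenL setL unfolding g_def by (auto simp: in_set_conv_nth less_Suc_eq_le)
  have gmono: "g i \<le> g j" if "i \<le> j" "j \<le> K" for i j
    using sorted_nth_mono[OF sL(1), of i j] that lenL by (simp add: g_def)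
  have ginj: "g i < g (Suc i)" if "i < K" for i
    using gmono[of i "Suc i"] that sL(2) lenL nth_eq_iff_index_eq[of L i "Suc i"] by (auto simp: g_def less_le)
  have g0: "g 0 = 0"
  proof -
    obtain i where "i \<le> K" "0 = g i" using Ug[of 0] by (auto simp: U_def)
    then have "g 0 \<le> 0" using gmono[of 0 i] by simp
    then show ?thesis using gU[of 0] UT by auto
  qed
  have gap: "t \<le> g i \<or> g (Suc i) \<le> t" if "i < K" and t: "t \<in> \<tau>1 ` {..n1} \<union> \<tau>2 ` {..n2}" for i t
  proof (cases "t \<in> {0..T}")
    case True
    then obtain j where j: "j \<le> K" "t = g j" using Ug[of t] t by (auto simp: U_def)
    show ?thesis using gmono[of j i] gmono[of "Suc i" j] j that by (cases "j \<le> i") auto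
  next
    case False
    have "0 \<le> t" using t step_process_knots[OF P1] step_process_knots[OF P2] by auto
    then have "T < t" using False by auto
    then show ?thesis using gU[of "Suc i"] UT that by auto
  qed
  have gap1: "\<tau>1 j \<le> g i \<or> g (Suc i) \<le> \<tau>1 j" if "i < K" "j \<le> n1" for i j using gap[of i "\<tau>1 j"] that by auto
  have gap2: "\<tau>2 j \<le> g i \<or> g (Suc i) \<le> \<tau>2 j" if "i < K" "j \<le> n2" for i j using gap[of i "\<tau>2 j"] that by auto
  have gpos: "0 \<le> g i" if "i \<le> K" for i using gU[OF that] UT by auto
  let ?v = "\<lambda>s \<omega>. simple_value n1 \<tau>1 \<xi>1 s \<omega> - simple_value n2 \<tau>2 \<xi>2 s \<omega>"
  let ?I = "\<lambda>s \<omega>. simple_integral W n1 \<tau>1 \<xi>1 s \<omega> - simple_integral W n2 \<tau>2 \<xi>2 s \<omega>"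
  define \<eta> where "\<eta> i \<omega> = ?v (g (Suc i)) \<omega>" for i \<omega>
  have \<eta>m: "\<eta> i \<in> borel_measurable (F (g i))" if "i < K" for i
    unfolding \<eta>_def using that gpos
    by (intro borel_measurable_diff simple_value_gap_measurable[OF P1] simple_value_gap_measurable[OF P2]
        gap1 gap2) auto
  have I0: "?I 0 \<omega> = 0" for \<omega>
  proof -
    have "simple_integral W n1 \<tau>1 \<xi>1 0 \<omega> = 0"
      unfolding simple_integral_def by (rule sum.neutral) (auto simp: min_absorb1 step_process_knots[OF P1])
    moreover have "simple_integral W n2 \<tau>2 \<xi>2 0 \<omega> = 0"
      unfolding simple_integral_def by (rule sum.neutral) (auto simp: min_absorb1 step_process_knots[OF P2])
    ultimately show ?thesis by simp
  qed
  have sumI: "(\<Sum>i<k. \<eta> i \<omega> * (W (g (Suc i)) \<omega> - W (g i) \<omega>)) = ?I (g k) \<omega>" if "k \<le> K" for k \<omega>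
    using that
  proof (induction k)
    case 0 then show ?case using I0 g0 by simp
  next
    case (Suc k)
    have "\<eta> k \<omega> * (W (g (Suc k)) \<omega> - W (g k) \<omega>) = ?I (g (Suc k)) \<omega> - ?I (g k) \<omega>"
      using simple_integral_gap[OF P1 ginj[of k] gap1, of \<omega>] simple_integral_gap[OF P2 ginj[of k] gap2, of \<omega>] Suc.prems
      by (simp add: \<eta>_def algebra_simps)
    then show ?case using Suc by simp
  qed
  have sumQ: "ennreal (\<Sum>i<k. (\<eta> i \<omega>)\<^sup>2 * (g (Suc i) - g i)) \<le> (\<integral>\<^sup>+s\<in>{0..g k}. ennreal ((?v s \<omega>)\<^sup>2) \<partial>lborel)"
    if "k \<le> K" for k \<omega>
    using that
  proof (induction k)
    case (Suc k)
    have le: "g k < g (Suc k)" "0 \<le> g k" using ginj[of k] gpos[of k] Suc.prems by auto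
    have "ennreal (\<Sum>i<Suc k. (\<eta> i \<omega>)\<^sup>2 * (g (Suc i) - g i))
        = ennreal (\<Sum>i<k. (\<eta> i \<omega>)\<^sup>2 * (g (Suc i) - g i)) + ennreal ((\<eta> k \<omega>)\<^sup>2 * (g (Suc k) - g k))"
      using Suc.prems ginj by (simp, intro ennreal_plus sum_nonneg) (auto simp: less_imp_le)
    also have "ennreal ((\<eta> k \<omega>)\<^sup>2 * (g (Suc k) - g k)) = (\<integral>\<^sup>+s\<in>{g k<..g (Suc k)}. ennreal ((\<eta> k \<omega>)\<^sup>2) \<partial>lborel)"
      using le by (subst nn_integral_cmult_indicator) (auto simp: ennreal_mult)
    also have "\<dots> = (\<integral>\<^sup>+s\<in>{g k<..g (Suc k)}. ennreal ((?v s \<omega>)\<^sup>2) \<partial>lborel)"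
    proof (rule nn_integral_cong)
      fix s
      show "ennreal ((\<eta> k \<omega>)\<^sup>2) * indicator {g k<..g (Suc k)} s = ennreal ((?v s \<omega>)\<^sup>2) * indicator {g k<..g (Suc k)} s"
        using simple_value_gap[OF P1 _ _ gap1, of k s \<omega>] simple_value_gap[OF P2 _ _ gap2, of k s \<omega>] Suc.prems
        by (auto simp: \<eta>_def indicator_def)
    qed
    also have "ennreal (\<Sum>i<k. (\<eta> i \<omega>)\<^sup>2 * (g (Suc i) - g i)) + \<dots>
       \<le> (\<integral>\<^sup>+s\<in>{0..g k}. ennreal ((?v s \<omega>)\<^sup>2) \<partial>lborel) + (\<integral>\<^sup>+s\<in>{g k<..g (Suc k)}. ennreal ((?v s \<omega>)\<^sup>2) \<partial>lborel)"
      using Suc by (intro add_mono) auto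
    also have "\<dots> = (\<integral>\<^sup>+s. ennreal ((?v s \<omega>)\<^sup>2) * indicator {0..g k} s
        + ennreal ((?v s \<omega>)\<^sup>2) * indicator {g k<..g (Suc k)} s \<partial>lborel)"
      by (rule nn_integral_add[symmetric]) measurable
    also have "\<dots> = (\<integral>\<^sup>+s\<in>{0..g (Suc k)}. ennreal ((?v s \<omega>)\<^sup>2) \<partial>lborel)"
      using le by (intro nn_integral_cong) (auto simp: indicator_def)
    finally show ?case .
  qed simp
  have sub: "(\<integral>\<^sup>+s\<in>{0..g K}. ennreal ((?v s \<omega>)\<^sup>2) \<partial>lborel) \<le> (\<integral>\<^sup>+s\<in>{0..T}. ennreal ((?v s \<omega>)\<^sup>2) \<partial>lborel)" for \<omega>
    using gU[of K] UT by (intro nn_integral_mono) (auto simp: indicator_def)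
  have "prob {\<omega>\<in>space M. \<exists>t\<in>G. a < \<bar>?I t \<omega>\<bar>}
      \<le> prob {\<omega>\<in>space M. \<exists>k\<le>K. a < \<bar>\<Sum>i<k. \<eta> i \<omega> * (W (g (Suc i)) \<omega> - W (g i) \<omega>)\<bar>}"
  proof (rule finite_measure_mono)
    show "{\<omega>\<in>space M. \<exists>t\<in>G. a < \<bar>?I t \<omega>\<bar>}
        \<subseteq> {\<omega>\<in>space M. \<exists>k\<le>K. a < \<bar>\<Sum>i<k. \<eta> i \<omega> * (W (g (Suc i)) \<omega> - W (g i) \<omega>)\<bar>}"
    proof safe
      fix \<omega> t assume "t \<in> G" and t: "a < \<bar>?I t \<omega>\<bar>"
      then obtain k where "k \<le> K" "t = g k" using Ug[of t] by (auto simp: U_def)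
      then show "\<exists>k\<le>K. a < \<bar>\<Sum>i<k. \<eta> i \<omega> * (W (g (Suc i)) \<omega> - W (g i) \<omega>)\<bar>"
        using t sumI by auto
    qed
    have [measurable]: "(\<lambda>\<omega>. \<Sum>i<k. \<eta> i \<omega> * (W (g (Suc i)) \<omega> - W (g i) \<omega>)) \<in> borel_measurable M" if "k \<le> K" for k
      using that gpos
      by (intro borel_measurable_sum borel_measurable_times borel_measurable_diff measurable_F_M[OF \<eta>m]
          W_measurable_M) auto
    have "{\<omega>\<in>space M. \<exists>k\<in>{..K}. a < \<bar>\<Sum>i<k. \<eta> i \<omega> * (W (g (Suc i)) \<omega> - W (g i) \<omega>)\<bar>} \<in> events"
      by (rule sets.sets_Collect_finite_Ex) auto
    then show "{\<omega>\<in>space M. \<exists>k\<le>K. a < \<bar>\<Sum>i<k. \<eta> i \<omega> * (W (g (Suc i)) \<omega> - W (g i) \<omega>)\<bar>} \<in> events"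
      by (simp only: Bex_def atMost_iff)
  qed
  also have "\<dots> \<le> b / a\<^sup>2 + prob {\<omega>\<in>space M. b < (\<Sum>i<K. (\<eta> i \<omega>)\<^sup>2 * (g (Suc i) - g i))}"
    by (rule increment_sum_maximal) (use g0 ginj \<eta>m ab in auto)
  also have "prob {\<omega>\<in>space M. b < (\<Sum>i<K. (\<eta> i \<omega>)\<^sup>2 * (g (Suc i) - g i))}
      \<le> prob {\<omega>\<in>space M. ennreal b < (\<integral>\<^sup>+s\<in>{0..T}. ennreal ((?v s \<omega>)\<^sup>2) \<partial>lborel)}"
  proof (rule finite_measure_mono)
    show "{\<omega>\<in>space M. b < (\<Sum>i<K. (\<eta> i \<omega>)\<^sup>2 * (g (Suc i) - g i))}
      \<subseteq> {\<omega>\<in>space M. ennreal b < (\<integral>\<^sup>+s\<in>{0..T}. ennreal ((?v s \<omega>)\<^sup>2) \<partial>lborel)}"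
    proof safe
      fix \<omega> assume "b < (\<Sum>i<K. (\<eta> i \<omega>)\<^sup>2 * (g (Suc i) - g i))"
      then have "ennreal b < ennreal (\<Sum>i<K. (\<eta> i \<omega>)\<^sup>2 * (g (Suc i) - g i))"
        using ab by (subst ennreal_less_iff) auto
      then show "ennreal b < (\<integral>\<^sup>+s\<in>{0..T}. ennreal ((?v s \<omega>)\<^sup>2) \<partial>lborel)"
        using sumQ[OF order_refl, of \<omega>] sub[of \<omega>] by (meson less_le_trans order_trans)
    qed
    have [measurable]: "(\<lambda>(\<omega>, s). simple_value n1 \<tau>1 \<xi>1 s \<omega>) \<in> borel_measurable (M \<Otimes>\<^sub>M borel)"
      "(\<lambda>(\<omega>, s). simple_value n2 \<tau>2 \<xi>2 s \<omega>) \<in> borel_measurable (M \<Otimes>\<^sub>M borel)"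
      by (rule simple_value_measurable[OF P1], rule simple_value_measurable[OF P2])
    show "{\<omega>\<in>space M. ennreal b < (\<integral>\<^sup>+s\<in>{0..T}. ennreal ((?v s \<omega>)\<^sup>2) \<partial>lborel)} \<in> events"
      by measurable
  qed
  finally show ?thesis by simp
qed

text \<open>Joint measurability makes the \<open>L\<^sup>2\<close> distances that occur in the definition of the Ito integral
  random variables.\<close>

lemma continuous_process_measurable:
  fixes H :: "real \<Rightarrow> 'w \<Rightarrow> real"
  assumes H: "\<And>t. 0 \<le> t \<Longrightarrow> H t \<in> borel_measurable M"
    and cont: "\<And>\<omega>. \<omega> \<in> space M \<Longrightarrow> continuous_on {0..} (\<lambda>t. H t \<omega>)"
  shows "(\<lambda>(\<omega>, s). indicator {0..} s * H s \<omega>) \<in> borel_measurable (M \<Otimes>\<^sub>M (borel :: real measure))"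
proof (rule borel_measurable_LIMSEQ_real)
  let ?d = "\<lambda>m s::real. real (nat \<lfloor>2 ^ m * s\<rfloor>) / 2 ^ m"
  show "(\<lambda>(\<omega>, s). indicator {0..} s * H (?d m s) \<omega>) \<in> borel_measurable (M \<Otimes>\<^sub>M borel)" for m
  proof -
    have [measurable]: "H (real k / 2 ^ m) \<in> borel_measurable M" for k :: nat using H by simp
    have "(\<lambda>z. H (real (nat \<lfloor>2 ^ m * (snd z :: real)\<rfloor>) / 2 ^ m) (fst z)) \<in> borel_measurable (M \<Otimes>\<^sub>M borel)"
      by (rule measurable_compose_countable[where f="\<lambda>k z. H (real k / 2 ^ m) (fst z)"]) measurable
    then show ?thesis unfolding case_prod_beta by measurable
  qed
  fix z :: "'w \<times> real" assume "z \<in> space (M \<Otimes>\<^sub>M borel)"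
  then obtain \<omega> s where z: "z = (\<omega>, s)" "\<omega> \<in> space M" by (auto simp: space_pair_measure)
  show "(\<lambda>m. (\<lambda>(\<omega>, s). indicator {0..} s * H (?d m s) \<omega>) z)
      \<longlonglongrightarrow> (\<lambda>(\<omega>, s). indicator {0..} s * H s \<omega>) z"
  proof (cases "0 \<le> s")
    case True
    have "(\<lambda>m. ?d m s) \<longlonglongrightarrow> s" by (rule dyadic_floor(2)[OF True])
    moreover have "\<forall>\<^sub>F m in sequentially. ?d m s \<in> {0..}" by simp
    ultimately have "(\<lambda>m. H (?d m s) \<omega>) \<longlonglongrightarrow> H s \<omega>"
      using continuous_on_tendsto_compose[OF cont[OF z(2)]] True by force
    then show ?thesis using True z by simp
  qed (simp add: z)
qed

lemma prob_tendsto_0: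
  assumes E: "\<And>m. E m \<in> events" and ev: "AE \<omega> in M. \<forall>\<^sub>F m in sequentially. \<omega> \<notin> E m"
  shows "(\<lambda>m::nat. prob (E m)) \<longlonglongrightarrow> 0"
proof -
  note E[measurable]
  have "(\<lambda>m. integral\<^sup>L M (indicator (E m) :: _ \<Rightarrow> real)) \<longlonglongrightarrow> integral\<^sup>L M (\<lambda>_. 0::real)"
  proof (rule integral_dominated_convergence[where w="\<lambda>_. 1"])
    show "AE \<omega> in M. (\<lambda>m. indicator (E m) \<omega> :: real) \<longlonglongrightarrow> 0"
      using ev
    proof eventually_elim
      case (elim \<omega>)
      then have "\<forall>\<^sub>F m in sequentially. indicator (E m) \<omega> = (0::real)"
        by eventually_elim simp
      then show ?case by (rule tendsto_eventually)
    qed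
  qed auto
  then show ?thesis by simp
qed

lemma dyadic_step_value:
  assumes "k < n" "real k / 2 ^ m < s" "s \<le> real (Suc k) / 2 ^ m"
  shows "simple_value n (\<lambda>i. real i / 2 ^ m) \<xi> s \<omega> = \<xi> k \<omega>"
proof -
  have "indicator {real i / 2 ^ m<..real (Suc i) / 2 ^ m} s = (if i = k then 1 else 0 :: real)" for i
  proof (cases "s \<in> {real i / 2 ^ m<..real (Suc i) / 2 ^ m}")
    case True
    then have "real i < s * 2 ^ m" "s * 2 ^ m \<le> real (Suc i)" by (auto simp: field_simps)
    moreover have "real k < s * 2 ^ m" "s * 2 ^ m \<le> real (Suc k)" using assms by (auto simp: field_simps)
    ultimately have "real i < real (Suc k)" "real k < real (Suc i)" by linarith+
    then have "i = k" by linarith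
    then show ?thesis using True by simp
  next
    case False
    then show ?thesis using assms by (auto simp: indicator_def)
  qed
  then have "simple_value n (\<lambda>i. real i / 2 ^ m) \<xi> s \<omega> = (\<Sum>i<n. if i = k then \<xi> i \<omega> else 0)"
    unfolding simple_value_def by (intro sum.cong) auto
  then show ?thesis using assms(1) by simp
qed

lemma dyadic_step_integral:
  assumes "j \<le> n"
  shows "simple_integral W n (\<lambda>i. real i / 2 ^ m) \<xi> (real j / 2 ^ m) \<omega>
    = (\<Sum>i<j. \<xi> i \<omega> * (W (real (Suc i) / 2 ^ m) \<omega> - W (real i / 2 ^ m) \<omega>))"
proof -
  have "simple_integral W n (\<lambda>i. real i / 2 ^ m) \<xi> (real j / 2 ^ m) \<omega>
     = (\<Sum>i<j. \<xi> i \<omega> * (W (min (real j / 2 ^ m) (real (Suc i) / 2 ^ m)) \<omega> - W (min (real j / 2 ^ m) (real i / 2 ^ m)) \<omega>))"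
    unfolding simple_integral_def
    by (rule sum.mono_neutral_right) (use assms in \<open>auto simp: min_def field_simps\<close>)
  also have "\<dots> = (\<Sum>i<j. \<xi> i \<omega> * (W (real (Suc i) / 2 ^ m) \<omega> - W (real i / 2 ^ m) \<omega>))"
  proof (rule sum.cong[OF refl])
    fix i assume "i \<in> {..<j}"
    then have "real i \<le> real j" "real (Suc i) \<le> real j" by auto
    then have "min (real j / 2 ^ m) (real (Suc i) / 2 ^ m) = real (Suc i) / 2 ^ m"
      "min (real j / 2 ^ m) (real i / 2 ^ m) = real i / 2 ^ m"
      by (auto simp: min_def divide_right_mono field_simps)
    then show "\<xi> i \<omega> * (W (min (real j / 2 ^ m) (real (Suc i) / 2 ^ m)) \<omega> - W (min (real j / 2 ^ m) (real i / 2 ^ m)) \<omega>)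
      = \<xi> i \<omega> * (W (real (Suc i) / 2 ^ m) \<omega> - W (real i / 2 ^ m) \<omega>)" by simp
  qed
  finally show ?thesis .
qed

lemma dyadic_step_approximates:
  fixes T :: nat
  assumes cont: "continuous_on {0..} (\<lambda>t. H t \<omega>)"
  shows "(\<lambda>m. \<integral>\<^sup>+s\<in>{0..real T}. ennreal ((simple_value (T * 2 ^ m) (\<lambda>i. real i / 2 ^ m)
     (\<lambda>i. H (real i / 2 ^ m)) s \<omega> - H s \<omega>)\<^sup>2) \<partial>lborel) \<longlonglongrightarrow> 0"
proof (rule order_tendstoI)
  fix c :: ennreal assume c: "0 < c"
  obtain r where r: "0 < r" "ennreal r < c"
  proof -
    obtain y where y: "0 < y" "y < c" using dense[OF c] by auto
    then show ?thesis using that[of "enn2real y"] by (cases y) auto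
  qed
  define e where "e = sqrt (r / (real T + 1))"
  have e: "0 < e" "e\<^sup>2 * real T < r" using r by (auto simp: e_def field_simps)
  have "uniformly_continuous_on {0..real T} (\<lambda>t. H t \<omega>)"
    by (intro compact_uniformly_continuous continuous_on_subset[OF cont]) auto
  then obtain d where d: "0 < d" and
    dd: "\<And>s t. s \<in> {0..real T} \<Longrightarrow> t \<in> {0..real T} \<Longrightarrow> dist t s < d \<Longrightarrow> dist (H t \<omega>) (H s \<omega>) < e"
    unfolding uniformly_continuous_on_def using e(1) by metis
  have "(\<lambda>m. (1/2::real) ^ m) \<longlonglongrightarrow> 0" by (rule LIMSEQ_realpow_zero) auto
  then have "\<forall>\<^sub>F m in sequentially. (1/2) ^ m < d" using d by (rule order_tendstoD)
  then show "\<forall>\<^sub>F m in sequentially. (\<integral>\<^sup>+s\<in>{0..real T}. ennreal ((simple_value (T * 2 ^ m)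
     (\<lambda>i. real i / 2 ^ m) (\<lambda>i. H (real i / 2 ^ m)) s \<omega> - H s \<omega>)\<^sup>2) \<partial>lborel) < c"
  proof eventually_elim
    case (elim m)
    have close: "(simple_value (T * 2 ^ m) (\<lambda>i. real i / 2 ^ m) (\<lambda>i. H (real i / 2 ^ m)) s \<omega> - H s \<omega>)\<^sup>2 \<le> e\<^sup>2"
      if s: "0 < s" "s \<le> real T" for s
    proof -
      define k where "k = nat (\<lceil>s * 2 ^ m\<rceil> - 1)"
      have p: "0 < s * 2 ^ m" using s by simp
      then have "1 \<le> \<lceil>s * 2 ^ m\<rceil>" by linarith
      then have k: "real k = of_int \<lceil>s * 2 ^ m\<rceil> - 1" by (simp add: k_def)
      have k1: "real k < s * 2 ^ m" "s * 2 ^ m \<le> real k + 1" using k by linarith+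
      have "s * 2 ^ m \<le> real T * 2 ^ m" using s by simp
      then have "real k < real T * 2 ^ m" using k1 by linarith
      also have "\<dots> = real (T * 2 ^ m)" by simp
      finally have "real k < real (T * 2 ^ m)" .
      then have kn: "k < T * 2 ^ m" by (simp only: of_nat_less_iff)
      have ks: "real k / 2 ^ m < s" "s \<le> real (Suc k) / 2 ^ m" using k1 by (auto simp: field_simps)
      have "s - real k / 2 ^ m \<le> (1/2) ^ m" using ks(2) by (simp add: add_divide_distrib power_one_over)
      then have "dist (real k / 2 ^ m) s < d" using ks elim by (simp add: dist_real_def)
      then have "dist (H (real k / 2 ^ m) \<omega>) (H s \<omega>) < e" by (intro dd) (use s ks in auto)
      then have "\<bar>H (real k / 2 ^ m) \<omega> - H s \<omega>\<bar> \<le> \<bar>e\<bar>" using e by (simp add: dist_real_def)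
      then show ?thesis unfolding dyadic_step_value[OF kn ks] by (rule abs_le_square_iff[THEN iffD1])
    qed
    have "(\<integral>\<^sup>+s\<in>{0..real T}. ennreal ((simple_value (T * 2 ^ m)
        (\<lambda>i. real i / 2 ^ m) (\<lambda>i. H (real i / 2 ^ m)) s \<omega> - H s \<omega>)\<^sup>2) \<partial>lborel)
      \<le> (\<integral>\<^sup>+s\<in>{0..real T}. ennreal (e\<^sup>2) \<partial>lborel)"
    proof (rule nn_integral_mono_AE)
      have "AE s in lborel. s \<noteq> (0::real)" by (rule AE_lborel_singleton)
      then show "AE s in lborel. ennreal ((simple_value (T * 2 ^ m) (\<lambda>i. real i / 2 ^ m)
          (\<lambda>i. H (real i / 2 ^ m)) s \<omega> - H s \<omega>)\<^sup>2) * indicator {0..real T} s \<le> ennreal (e\<^sup>2) * indicator {0..real T} s"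
        by eventually_elim (use close in \<open>auto simp: indicator_def intro!: ennreal_leI\<close>)
    qed
    also have "\<dots> = ennreal (e\<^sup>2 * real T)"
      by (subst nn_integral_cmult_indicator) (auto simp: ennreal_mult)
    also have "\<dots> < c" using e(2) r(2) r(1) by (meson ennreal_lessI order_less_trans)
    finally show ?case .
  qed
qed simp

text \<open>The approximation in the definition of the Ito integral holds at each fixed time.  On the finitely
  many points of a dyadic grid it holds simultaneously, and there the maximal inequality exchanges the
  approximating processes for the integrand sampled along the grid.\<close>

lemma ito_integral_riemann_sums:
  fixes T :: nat
  assumes I: "is_ito_integral M F W H I" and H: "\<And>t. 0 \<le> t \<Longrightarrow> H t \<in> borel_measurable (F t)"
    and cont: "\<And>\<omega>. \<omega> \<in> space M \<Longrightarrow> continuous_on {0..} (\<lambda>t. H t \<omega>)" and a: "0 < a"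
  shows "(\<lambda>m. prob {\<omega>\<in>space M. \<exists>j\<le>T * 2 ^ m. a < \<bar>I (real j / 2 ^ m) \<omega>
      - (\<Sum>i<j. H (real i / 2 ^ m) \<omega> * (W (real (Suc i) / 2 ^ m) \<omega> - W (real i / 2 ^ m) \<omega>))\<bar>}) \<longlonglongrightarrow> 0"
    (is "(\<lambda>m. prob (?E m)) \<longlonglongrightarrow> 0")
proof (rule tendsto_zero_le_eventuallyI)
  fix e :: real assume e: "0 < e"
  obtain n \<tau> \<xi> where simple: "\<And>k. simple_process M F (n k) (\<tau> k) (\<xi> k)"
    and conv: "\<And>T e. 0 \<le> T \<Longrightarrow> 0 < e \<Longrightarrow>
           (\<lambda>k. measure M {\<omega> \<in> space M. ennreal e <
              (\<integral>\<^sup>+s\<in>{0..T}. ennreal ((simple_value (n k) (\<tau> k) (\<xi> k) s \<omega> - H s \<omega>)\<^sup>2) \<partial>lborel)}) \<longlonglongrightarrow> 0"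
    and convI: "\<And>T e. 0 \<le> T \<Longrightarrow> 0 < e \<Longrightarrow> (\<lambda>k. measure M {\<omega> \<in> space M.
              e < \<bar>simple_integral W (n k) (\<tau> k) (\<xi> k) T \<omega> - I T \<omega>\<bar>}) \<longlonglongrightarrow> 0"
    using I unfolding is_ito_integral_def by blast
  have step: "step_process (n k) (\<tau> k) (\<xi> k)" for k
    using simple[of k] by (auto simp: simple_process_def step_process_def)
  have Im: "I t \<in> borel_measurable M" if "0 \<le> t" for t
    using I that measurable_F_M by (auto simp: is_ito_integral_def adapted_def)
  have Hm: "H t \<in> borel_measurable M" if "0 \<le> t" for t using measurable_F_M[OF H] that by auto
  have stepm: "step_process (T * 2 ^ m) (\<lambda>i. real i / 2 ^ m) (\<lambda>i. H (real i / 2 ^ m))" for m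
    using H by (auto simp: step_process_def field_simps)
  have Hj: "(\<lambda>(\<omega>, s). indicator {0..} s * H s \<omega>) \<in> borel_measurable (M \<Otimes>\<^sub>M (borel :: real measure))"
    by (rule continuous_process_measurable[OF Hm cont])
  let ?sv = "\<lambda>k s \<omega>. simple_value (n k) (\<tau> k) (\<xi> k) s \<omega>"
  let ?sm = "\<lambda>m s \<omega>. simple_value (T * 2 ^ m) (\<lambda>i. real i / 2 ^ m) (\<lambda>i. H (real i / 2 ^ m)) s \<omega>"
  have meas: "(\<lambda>\<omega>. \<integral>\<^sup>+s\<in>{0..real T}. ennreal ((simple_value n' \<tau>' \<xi>' s \<omega> - H s \<omega>)\<^sup>2) \<partial>lborel) \<in> borel_measurable M"
    if "step_process n' \<tau>' \<xi>'" for n' \<tau>' \<xi>'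
  proof -
    note [measurable] = simple_value_measurable[OF that] Hj
    have "(\<lambda>\<omega>. \<integral>\<^sup>+s\<in>{0..real T}. ennreal ((simple_value n' \<tau>' \<xi>' s \<omega> - indicator {0..} s * H s \<omega>)\<^sup>2) \<partial>lborel) \<in> borel_measurable M"
      by measurable
    also have "(\<lambda>\<omega>. \<integral>\<^sup>+s\<in>{0..real T}. ennreal ((simple_value n' \<tau>' \<xi>' s \<omega> - indicator {0..} s * H s \<omega>)\<^sup>2) \<partial>lborel)
        = (\<lambda>\<omega>. \<integral>\<^sup>+s\<in>{0..real T}. ennreal ((simple_value n' \<tau>' \<xi>' s \<omega> - H s \<omega>)\<^sup>2) \<partial>lborel)"
      by (intro ext nn_integral_cong) (auto simp: indicator_def)
    finally show ?thesis .
  qed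
  \<comment> \<open>With this \<open>b\<close>, the maximal inequality at level \<open>a / 2\<close> costs \<open>e / 4\<close>.\<close>
  define b where "b = e / 4 * (a / 2)\<^sup>2"
  have b: "0 < b" "b / (a / 2)\<^sup>2 = e / 4" using a e by (auto simp: b_def)
  have "(\<lambda>m. prob {\<omega>\<in>space M. ennreal (b / 4) < (\<integral>\<^sup>+s\<in>{0..real T}. ennreal ((?sm m s \<omega> - H s \<omega>)\<^sup>2) \<partial>lborel)}) \<longlonglongrightarrow> 0"
  proof (rule prob_tendsto_0)
    show "AE \<omega> in M. \<forall>\<^sub>F m in sequentially. \<omega> \<notin> {\<omega>\<in>space M. ennreal (b / 4) <
        (\<integral>\<^sup>+s\<in>{0..real T}. ennreal ((?sm m s \<omega> - H s \<omega>)\<^sup>2) \<partial>lborel)}"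
    proof (rule AE_I2)
      fix \<omega> assume "\<omega> \<in> space M"
      from order_tendstoD(2)[OF dyadic_step_approximates[where H=H and \<omega>=\<omega> and T=T, OF cont[OF this]],
          of "ennreal (b / 4)"]
      show "\<forall>\<^sub>F m in sequentially. \<omega> \<notin> {\<omega>\<in>space M. ennreal (b / 4) <
        (\<integral>\<^sup>+s\<in>{0..real T}. ennreal ((?sm m s \<omega> - H s \<omega>)\<^sup>2) \<partial>lborel)}"
        using b by (auto elim!: eventually_mono simp: not_less less_imp_le)
    qed
  qed (use meas[OF stepm] in measurable)
  then have "\<forall>\<^sub>F m in sequentially. prob {\<omega>\<in>space M. ennreal (b / 4) <
      (\<integral>\<^sup>+s\<in>{0..real T}. ennreal ((?sm m s \<omega> - H s \<omega>)\<^sup>2) \<partial>lborel)} < e / 4"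
    using e by (intro order_tendstoD) auto
  then show "\<forall>\<^sub>F m in sequentially. prob (?E m) \<le> e"
  proof eventually_elim
    case (elim m)
    define G where "G = (\<lambda>j. real j / 2 ^ m) ` {..T * 2 ^ m}"
    have G: "finite G" "G \<subseteq> {0..real T}"
    proof -
      have "real j / 2 ^ m \<le> real T" if "j \<le> T * 2 ^ m" for j
      proof -
        have "real j \<le> real (T * 2 ^ m)" using that by (simp only: of_nat_le_iff)
        then show ?thesis by (simp add: field_simps)
      qed
      then show "finite G" "G \<subseteq> {0..real T}" by (auto simp: G_def)
    qed
    have "(\<lambda>k. \<Sum>t\<in>G. prob {\<omega>\<in>space M. a / 2 < \<bar>simple_integral W (n k) (\<tau> k) (\<xi> k) t \<omega> - I t \<omega>\<bar>}) \<longlonglongrightarrow> (\<Sum>t\<in>G. 0)"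
      by (intro tendsto_sum convI) (use G a in auto)
    then have ev1: "\<forall>\<^sub>F k in sequentially. (\<Sum>t\<in>G. prob {\<omega>\<in>space M. a / 2 <
        \<bar>simple_integral W (n k) (\<tau> k) (\<xi> k) t \<omega> - I t \<omega>\<bar>}) < e / 4"
      using e by (intro order_tendstoD) auto
    have ev2: "\<forall>\<^sub>F k in sequentially. prob {\<omega>\<in>space M. ennreal (b / 4) <
        (\<integral>\<^sup>+s\<in>{0..real T}. ennreal ((?sv k s \<omega> - H s \<omega>)\<^sup>2) \<partial>lborel)} < e / 4"
      using conv[of "real T" "b / 4"] e b by (intro order_tendstoD[of _ 0]) auto
    obtain k where k1: "(\<Sum>t\<in>G. prob {\<omega>\<in>space M. a / 2 < \<bar>simple_integral W (n k) (\<tau> k) (\<xi> k) t \<omega> - I t \<omega>\<bar>}) < e / 4"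
      and k2: "prob {\<omega>\<in>space M. ennreal (b / 4) <
        (\<integral>\<^sup>+s\<in>{0..real T}. ennreal ((?sv k s \<omega> - H s \<omega>)\<^sup>2) \<partial>lborel)} < e / 4"
      using eventually_happens[OF eventually_conj[OF ev1 ev2]] by auto
    let ?SI = "simple_integral W (n k) (\<tau> k) (\<xi> k)"
    let ?SM = "simple_integral W (T * 2 ^ m) (\<lambda>i. real i / 2 ^ m) (\<lambda>i. H (real i / 2 ^ m))"
    define E1 where "E1 = {\<omega>\<in>space M. \<exists>t\<in>G. a / 2 < \<bar>?SI t \<omega> - I t \<omega>\<bar>}"
    define E2 where "E2 = {\<omega>\<in>space M. \<exists>t\<in>G. a / 2 < \<bar>?SI t \<omega> - ?SM t \<omega>\<bar>}"
    define R1 where "R1 = {\<omega>\<in>space M. ennreal (b / 4) < (\<integral>\<^sup>+s\<in>{0..real T}. ennreal ((?sv k s \<omega> - H s \<omega>)\<^sup>2) \<partial>lborel)}"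
    define R2 where "R2 = {\<omega>\<in>space M. ennreal (b / 4) < (\<integral>\<^sup>+s\<in>{0..real T}. ennreal ((?sm m s \<omega> - H s \<omega>)\<^sup>2) \<partial>lborel)}"
    have m1: "{\<omega>\<in>space M. a / 2 < \<bar>?SI t \<omega> - I t \<omega>\<bar>} \<in> events" if "t \<in> G" for t
    proof -
      have [measurable]: "?SI t \<in> borel_measurable M" "I t \<in> borel_measurable M"
        using simple_integral_measurable[OF step] Im G that by auto
      show ?thesis by measurable
    qed
    have m2: "{\<omega>\<in>space M. a / 2 < \<bar>?SI t \<omega> - ?SM t \<omega>\<bar>} \<in> events" if "t \<in> G" for t
    proof -
      have [measurable]: "?SI t \<in> borel_measurable M" "?SM t \<in> borel_measurable M"
        using simple_integral_measurable[OF step] simple_integral_measurable[OF stepm] G that by auto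
      show ?thesis by measurable
    qed
    have E1m: "E1 \<in> events" unfolding E1_def by (rule sets.sets_Collect_finite_Ex) (use m1 G in auto)
    have E2m: "E2 \<in> events" unfolding E2_def by (rule sets.sets_Collect_finite_Ex) (use m2 G in auto)
    have R1m: "R1 \<in> events" unfolding R1_def using meas[OF step] by measurable
    have R2m: "R2 \<in> events" unfolding R2_def using meas[OF stepm] by measurable
    have P1: "prob E1 \<le> e / 4"
    proof -
      have "E1 = (\<Union>t\<in>G. {\<omega>\<in>space M. a / 2 < \<bar>?SI t \<omega> - I t \<omega>\<bar>})" by (auto simp: E1_def)
      then have "prob E1 \<le> (\<Sum>t\<in>G. prob {\<omega>\<in>space M. a / 2 < \<bar>?SI t \<omega> - I t \<omega>\<bar>})"
        using measure_UNION_le[of G "\<lambda>t. {\<omega>\<in>space M. a / 2 < \<bar>?SI t \<omega> - I t \<omega>\<bar>}" M] m1 G by simp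
      then show ?thesis using k1 by linarith
    qed
    have P2: "prob E2 \<le> e / 4 + (prob R1 + prob R2)"
    proof -
      have "prob E2 \<le> b / (a / 2)\<^sup>2 + prob {\<omega>\<in>space M. ennreal b <
          (\<integral>\<^sup>+s\<in>{0..real T}. ennreal ((?sv k s \<omega> - ?sm m s \<omega>)\<^sup>2) \<partial>lborel)}"
        unfolding E2_def by (rule step_integrals_close[OF step stepm]) (use G a b in auto)
      also have "prob {\<omega>\<in>space M. ennreal b < (\<integral>\<^sup>+s\<in>{0..real T}. ennreal ((?sv k s \<omega> - ?sm m s \<omega>)\<^sup>2) \<partial>lborel)}
          \<le> prob (R1 \<union> R2)"
      proof (rule finite_measure_mono)
        show "{\<omega>\<in>space M. ennreal b < (\<integral>\<^sup>+s\<in>{0..real T}. ennreal ((?sv k s \<omega> - ?sm m s \<omega>)\<^sup>2) \<partial>lborel)} \<subseteq> R1 \<union> R2"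
        proof (rule subsetI, rule ccontr)
          fix \<omega> assume \<omega>: "\<omega> \<in> {\<omega>\<in>space M. ennreal b < (\<integral>\<^sup>+s\<in>{0..real T}. ennreal ((?sv k s \<omega> - ?sm m s \<omega>)\<^sup>2) \<partial>lborel)}"
            and "\<omega> \<notin> R1 \<union> R2"
          then have le: "(\<integral>\<^sup>+s\<in>{0..real T}. ennreal ((?sv k s \<omega> - H s \<omega>)\<^sup>2) \<partial>lborel) \<le> ennreal (b / 4)"
            "(\<integral>\<^sup>+s\<in>{0..real T}. ennreal ((?sm m s \<omega> - H s \<omega>)\<^sup>2) \<partial>lborel) \<le> ennreal (b / 4)"
            by (auto simp: R1_def R2_def not_less)
          have [measurable]: "(\<lambda>s. indicator {0..} s * H s \<omega>) \<in> borel_measurable borel"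
            using measurable_compose_Pair1[OF _ Hj, of \<omega>] \<omega> by auto
          \<comment> \<open>Two distances of squared size at most \<open>b / 4\<close> add up to one of squared size at most \<open>b\<close>.\<close>
          have sq: "(x - z)\<^sup>2 \<le> 2 * (x - y)\<^sup>2 + 2 * (z - y)\<^sup>2" for x y z :: real
            using zero_le_power2[of "(x - y) + (z - y)"] by (simp add: power2_eq_square algebra_simps)
          have "(\<integral>\<^sup>+s\<in>{0..real T}. ennreal ((?sv k s \<omega> - ?sm m s \<omega>)\<^sup>2) \<partial>lborel)
             \<le> (\<integral>\<^sup>+s. 2 * (ennreal ((?sv k s \<omega> - indicator {0..} s * H s \<omega>)\<^sup>2) * indicator {0..real T} s)
               + 2 * (ennreal ((?sm m s \<omega> - indicator {0..} s * H s \<omega>)\<^sup>2) * indicator {0..real T} s) \<partial>lborel)"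
          proof (rule nn_integral_mono)
            fix s
            have "ennreal ((?sv k s \<omega> - ?sm m s \<omega>)\<^sup>2) \<le> ennreal (2 * (?sv k s \<omega> - H s \<omega>)\<^sup>2 + 2 * (?sm m s \<omega> - H s \<omega>)\<^sup>2)"
              by (rule ennreal_leI[OF sq])
            also have "\<dots> = 2 * ennreal ((?sv k s \<omega> - H s \<omega>)\<^sup>2) + 2 * ennreal ((?sm m s \<omega> - H s \<omega>)\<^sup>2)"
              by (simp add: ennreal_plus ennreal_mult)
            finally show "ennreal ((?sv k s \<omega> - ?sm m s \<omega>)\<^sup>2) * indicator {0..real T} s
              \<le> 2 * (ennreal ((?sv k s \<omega> - indicator {0..} s * H s \<omega>)\<^sup>2) * indicator {0..real T} s)
               + 2 * (ennreal ((?sm m s \<omega> - indicator {0..} s * H s \<omega>)\<^sup>2) * indicator {0..real T} s)"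
              by (auto simp: indicator_def)
          qed
          also have "\<dots> = 2 * (\<integral>\<^sup>+s\<in>{0..real T}. ennreal ((?sv k s \<omega> - indicator {0..} s * H s \<omega>)\<^sup>2) \<partial>lborel)
               + 2 * (\<integral>\<^sup>+s\<in>{0..real T}. ennreal ((?sm m s \<omega> - indicator {0..} s * H s \<omega>)\<^sup>2) \<partial>lborel)"
            by (simp add: nn_integral_add nn_integral_cmult)
          also have "\<dots> = 2 * (\<integral>\<^sup>+s\<in>{0..real T}. ennreal ((?sv k s \<omega> - H s \<omega>)\<^sup>2) \<partial>lborel)
               + 2 * (\<integral>\<^sup>+s\<in>{0..real T}. ennreal ((?sm m s \<omega> - H s \<omega>)\<^sup>2) \<partial>lborel)"
            by (rule arg_cong2[where f="\<lambda>x y. 2 * x + 2 * y"]; rule nn_integral_cong)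
               (auto simp: indicator_def)
          also have "\<dots> \<le> 2 * ennreal (b / 4) + 2 * ennreal (b / 4)"
            using le by (auto intro!: add_mono mult_left_mono)
          also have "\<dots> = ennreal b"
          proof -
            have half: "ennreal 2 * ennreal (b / 4) = ennreal (b / 2)"
              using b by (subst ennreal_mult[symmetric]) auto
            have "2 * ennreal (b / 4) + 2 * ennreal (b / 4) = ennreal (b / 2) + ennreal (b / 2)"
              using half by simp
            also have "\<dots> = ennreal b" using b by (subst ennreal_plus[symmetric]) auto
            finally show ?thesis by simp
          qed
          finally show False using \<omega> by (simp add: not_le[symmetric])
        qed
      qed (use R1m R2m in auto)
      also have "prob (R1 \<union> R2) \<le> prob R1 + prob R2" by (rule measure_Un_le[OF R1m R2m])
      finally show ?thesis using b by simp
    qed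
    have "prob (?E m) \<le> prob (E1 \<union> E2)"
    proof (rule finite_measure_mono)
      show "?E m \<subseteq> E1 \<union> E2"
      proof
        fix \<omega> assume "\<omega> \<in> ?E m"
        then obtain j where \<omega>: "\<omega> \<in> space M" and j: "j \<le> T * 2 ^ m" and less: "a < \<bar>I (real j / 2 ^ m) \<omega> - ?SM (real j / 2 ^ m) \<omega>\<bar>"
          using dyadic_step_integral[of _ "T * 2 ^ m" m "\<lambda>i. H (real i / 2 ^ m)"] by auto
        have "real j / 2 ^ m \<in> G" using j by (auto simp: G_def)
        moreover have "a / 2 < \<bar>?SI (real j / 2 ^ m) \<omega> - I (real j / 2 ^ m) \<omega>\<bar> \<or> a / 2 < \<bar>?SI (real j / 2 ^ m) \<omega> - ?SM (real j / 2 ^ m) \<omega>\<bar>"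
          using less by linarith
        ultimately show "\<omega> \<in> E1 \<union> E2" using \<omega> unfolding E1_def E2_def by blast
      qed
    qed (use E1m E2m in auto)
    also have "\<dots> \<le> prob E1 + prob E2" by (rule measure_Un_le[OF E1m E2m])
    finally show ?case using P1 P2 k2 elim unfolding R1_def R2_def by linarith
  qed
qed simp

end

section \<open>Euler approximation of the diffusion\<close>

lemma left_riemann_sum_close:
  fixes h :: "real \<Rightarrow> real"
  assumes h: "continuous_on {0..} h" and T: "real n / 2 ^ m \<le> T"
    and osc: "\<And>u v. 0 \<le> u \<Longrightarrow> u \<le> v \<Longrightarrow> v \<le> T \<Longrightarrow> v - u \<le> 1 / 2 ^ m \<Longrightarrow> \<bar>h v - h u\<bar> \<le> \<eta>"
  shows "\<bar>(LBINT s:{0..real n / 2 ^ m}. h s) - (\<Sum>j<n. h (real j / 2 ^ m) / 2 ^ m)\<bar> \<le> real n / 2 ^ m * \<eta>"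
proof -
  have hc: "continuous_on {u..v} h" if "0 \<le> u" for u v
    by (rule continuous_on_subset[OF h]) (use that in auto)
  have hk: "(LBINT s:{0..t}. h s) = integral {0..t} h" if "0 \<le> t" for t
    by (rule set_borel_integral_eq_integral(2)) (intro borel_integrable_atLeastAtMost' hc order_refl)
  have "\<bar>integral {0..real n / 2 ^ m} h - (\<Sum>j<n. h (real j / 2 ^ m) / 2 ^ m)\<bar> \<le> real n / 2 ^ m * \<eta>"
    using T
  proof (induction n)
    case 0 then show ?case by simp
  next
    case (Suc n)
    let ?u = "real n / 2 ^ m" and ?v = "real (Suc n) / 2 ^ m"
    have uv: "0 \<le> ?u" "?u \<le> ?v" "?v - ?u = 1 / 2 ^ m" by (auto simp: field_simps)
    have IH: "\<bar>integral {0..?u} h - (\<Sum>j<n. h (real j / 2 ^ m) / 2 ^ m)\<bar> \<le> ?u * \<eta>"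
      using Suc uv by auto
    have int: "h integrable_on {u..v}" if "0 \<le> u" for u v
      by (intro integrable_continuous_real hc that)
    have comb: "integral {0..?v} h = integral {0..?u} h + integral {?u..?v} h"
      using uv int by (intro Henstock_Kurzweil_Integration.integral_combine[symmetric]) auto
    have "integral {?u..?v} h - h ?u / 2 ^ m = integral {?u..?v} (\<lambda>s. h s - h ?u)"
      using uv int[of ?u ?v] by (subst Henstock_Kurzweil_Integration.integral_diff) auto
    moreover have "norm (integral (cbox ?u ?v) (\<lambda>s. h s - h ?u)) \<le> \<eta> * measure lborel (cbox ?u ?v)"
    proof (rule integrable_bound)
      show "0 \<le> \<eta>" using osc[of ?u ?u] uv Suc.prems by auto
      show "(\<lambda>s. h s - h ?u) integrable_on cbox ?u ?v"
        using int[of ?u ?v] uv by (intro Henstock_Kurzweil_Integration.integrable_diff) auto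
      fix s assume "s \<in> cbox ?u ?v"
      then have "?u \<le> s" "s \<le> ?v" by auto
      then show "norm (h s - h ?u) \<le> \<eta>" using uv Suc.prems by (auto intro!: osc)
    qed
    ultimately have "\<bar>integral {?u..?v} h - h ?u / 2 ^ m\<bar> \<le> \<eta> * (1 / 2 ^ m)"
      using uv by simp
    moreover have "?v * \<eta> = ?u * \<eta> + \<eta> * (1 / 2 ^ m)" by (simp add: field_simps)
    ultimately show ?case using IH comb by simp
  qed
  then show ?thesis by (subst hk) auto
qed

text \<open>One step of the Gronwall argument in \<open>euler_stability\<close>: \<open>D\<close> is the current difference, \<open>d\<close> the distance
  at which the coefficients are compared, and \<open>p\<close>, \<open>q\<close> are the differences of drift and volatility.\<close>

lemma stability_step:
  fixes D p q d \<eta> L :: real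
  assumes "0 \<le> \<Delta>" "\<Delta> \<le> 1" "\<bar>p\<bar> \<le> L * d" "\<bar>q\<bar> \<le> L * d" "0 \<le> d" "d \<le> \<bar>D\<bar> + 2 * \<eta>" "0 \<le> \<eta>" "0 \<le> L"
  shows "(D + p * \<Delta>)\<^sup>2 + q\<^sup>2 * \<Delta> \<le> (1 + (1 + 24 * L\<^sup>2) * \<Delta>) * D\<^sup>2 + (1 + 24 * L\<^sup>2) * \<Delta> * \<eta>\<^sup>2"
proof -
  have d2: "d\<^sup>2 \<le> 2 * D\<^sup>2 + 8 * \<eta>\<^sup>2"
  proof -
    have "d\<^sup>2 \<le> (\<bar>D\<bar> + 2 * \<eta>)\<^sup>2" using assms by (intro power_mono) auto
    also have "\<dots> \<le> 2 * D\<^sup>2 + 8 * \<eta>\<^sup>2"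
      using zero_le_power2[of "\<bar>D\<bar> - 2 * \<eta>"] by (simp add: power2_eq_square algebra_simps)
    finally show ?thesis .
  qed
  have p2: "p\<^sup>2 \<le> L\<^sup>2 * d\<^sup>2" and q2: "q\<^sup>2 \<le> L\<^sup>2 * d\<^sup>2"
    using power_mono[OF assms(3), of 2] power_mono[OF assms(4), of 2] by (auto simp: power_mult_distrib)
  have "(D + p * \<Delta>)\<^sup>2 \<le> (1 + \<Delta>) * D\<^sup>2 + (\<Delta> + \<Delta>\<^sup>2) * p\<^sup>2"
  proof -
    have "0 \<le> \<Delta> * (D - p)\<^sup>2" using assms by simp
    then show ?thesis by (simp add: power2_eq_square algebra_simps)
  qed
  also have "\<dots> \<le> (1 + \<Delta>) * D\<^sup>2 + (2 * \<Delta>) * p\<^sup>2"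
  proof -
    have "\<Delta>\<^sup>2 \<le> \<Delta>" using assms by (simp add: power2_eq_square mult_left_le)
    then show ?thesis by (intro add_left_mono mult_right_mono) auto
  qed
  also have "\<dots> \<le> (1 + \<Delta>) * D\<^sup>2 + (2 * \<Delta>) * (L\<^sup>2 * d\<^sup>2)"
    using p2 assms by (intro add_left_mono mult_left_mono) auto
  finally have "(D + p * \<Delta>)\<^sup>2 + q\<^sup>2 * \<Delta> \<le> (1 + \<Delta>) * D\<^sup>2 + (2 * \<Delta>) * (L\<^sup>2 * d\<^sup>2) + (L\<^sup>2 * d\<^sup>2) * \<Delta>"
    using mult_right_mono[OF q2, of \<Delta>] assms by linarith
  also have "\<dots> = (1 + \<Delta>) * D\<^sup>2 + (3 * \<Delta> * L\<^sup>2) * d\<^sup>2" by (simp add: algebra_simps)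
  also have "\<dots> \<le> (1 + \<Delta>) * D\<^sup>2 + (3 * \<Delta> * L\<^sup>2) * (2 * D\<^sup>2 + 8 * \<eta>\<^sup>2)"
    using d2 assms by (intro add_left_mono mult_left_mono) auto
  also have "\<dots> \<le> (1 + (1 + 24 * L\<^sup>2) * \<Delta>) * D\<^sup>2 + (1 + 24 * L\<^sup>2) * \<Delta> * \<eta>\<^sup>2"
  proof -
    have "0 \<le> 18 * (L\<^sup>2 * \<Delta> * D\<^sup>2)" "0 \<le> \<Delta> * \<eta>\<^sup>2" using assms by auto
    then show ?thesis by (simp add: algebra_simps)
  qed
  finally show ?thesis .
qed

text \<open>The coefficients are Lipschitz on the whole line because the Euler scheme may leave the state space;
  \<open>lipschitz_extension\<close> and \<open>diffusion_cong\<close> provide such coefficients.\<close>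

locale lipschitz_diffusion = brownian_filtration M F W
  for M :: "'w measure" and F W +
  fixes \<X> :: "real set" and \<mu> \<sigma> :: "real \<Rightarrow> real" and X :: "real \<Rightarrow> real \<Rightarrow> 'w \<Rightarrow> real" and L :: real
  assumes diff: "diffusion M F W \<X> \<mu> \<sigma> X"
    and lip_\<mu>: "L-lipschitz_on UNIV \<mu>" and lip_\<sigma>: "L-lipschitz_on UNIV \<sigma>"
begin

lemma L_nonneg: "0 \<le> L" using lip_\<mu> by (rule lipschitz_on_nonneg)

lemma \<mu>_lip: "\<bar>\<mu> y - \<mu> z\<bar> \<le> L * \<bar>y - z\<bar>" and \<sigma>_lip: "\<bar>\<sigma> y - \<sigma> z\<bar> \<le> L * \<bar>y - z\<bar>"
  using lipschitz_onD[OF lip_\<mu>, of y z] lipschitz_onD[OF lip_\<sigma>, of y z] by (auto simp: dist_real_def)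

lemma coefficients_measurable [measurable]: "\<mu> \<in> borel_measurable borel" "\<sigma> \<in> borel_measurable borel"
  using lipschitz_on_continuous_on[OF lip_\<mu>] lipschitz_on_continuous_on[OF lip_\<sigma>]
  by (auto intro: borel_measurable_continuous_onI)

lemma X_measurable: "x \<in> \<X> \<Longrightarrow> 0 \<le> s \<Longrightarrow> s \<le> t \<Longrightarrow> X x s \<in> borel_measurable (F t)"
  using diff measurable_F_mono[of "X x s" s borel t] by (auto simp: diffusion_def adapted_def)

lemma X_measurable_M: "x \<in> \<X> \<Longrightarrow> 0 \<le> s \<Longrightarrow> X x s \<in> borel_measurable M"
  using X_measurable[of x s s] measurable_F_M by auto

lemma X_paths:
  assumes "x \<in> \<X>" "\<omega> \<in> space M"
  shows "X x 0 \<omega> = x" "continuous_on {0..} (\<lambda>t. X x t \<omega>)" "0 \<le> t \<Longrightarrow> X x t \<omega> \<in> \<X>"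
  using diff assms by (auto simp: diffusion_def)

text \<open>The error committed when the diffusion itself is inserted into the Euler recursion, accumulated
  over the first \<open>i\<close> steps of mesh \<open>1 / 2 ^ m\<close>.\<close>

definition defect :: "real \<Rightarrow> nat \<Rightarrow> nat \<Rightarrow> 'w \<Rightarrow> real" where
  "defect x m i \<omega> = X x (real i / 2 ^ m) \<omega> - x - (\<Sum>j<i. \<mu> (X x (real j / 2 ^ m) \<omega>) / 2 ^ m
     + \<sigma> (X x (real j / 2 ^ m) \<omega>) * (W (real (Suc j) / 2 ^ m) \<omega> - W (real j / 2 ^ m) \<omega>))"

lemma defect_measurable:
  assumes "x \<in> \<X>" "i \<le> k"
  shows "defect x m i \<in> borel_measurable (F (real k / 2 ^ m))"
  unfolding defect_def using assms
  by (intro borel_measurable_diff borel_measurable_sum borel_measurable_add borel_measurable_times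
      borel_measurable_divide measurable_compose[OF X_measurable] coefficients_measurable
      X_measurable W_measurable borel_measurable_const) (auto intro!: divide_right_mono)

lemma defect_small:
  fixes T :: nat
  assumes x: "x \<in> \<X>" and a: "0 < a"
  shows "(\<lambda>m. prob {\<omega>\<in>space M. \<exists>i\<le>T * 2 ^ m. a < \<bar>defect x m i \<omega>\<bar>}) \<longlonglongrightarrow> 0"
proof -
  obtain I where I: "is_ito_integral M F W (\<lambda>s \<omega>. \<sigma> (X x s \<omega>)) I"
    and sde: "AE \<omega> in M. \<forall>t\<ge>0. X x t \<omega> = x + (LBINT s:{0..t}. \<mu> (X x s \<omega>)) + I t \<omega>"
    using diff x by (auto simp: diffusion_def)
  have Im: "I t \<in> borel_measurable M" if "0 \<le> t" for t
    using I that measurable_F_M by (auto simp: is_ito_integral_def adapted_def)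
  define S where "S m i \<omega> = (\<Sum>j<i. \<sigma> (X x (real j / 2 ^ m) \<omega>) * (W (real (Suc j) / 2 ^ m) \<omega> - W (real j / 2 ^ m) \<omega>))" for m i \<omega>
  have Sm: "(\<lambda>\<omega>. I (real i / 2 ^ m) \<omega> - S m i \<omega>) \<in> borel_measurable M" for m i
    unfolding S_def
    by (intro borel_measurable_diff borel_measurable_sum borel_measurable_times Im
        measurable_compose[OF X_measurable_M] coefficients_measurable W_measurable_M x) auto
  have dm: "defect x m i \<in> borel_measurable M" for m i
    using measurable_F_M[OF defect_measurable[OF x order_refl]] by simp
  define E1 where "E1 m = {\<omega>\<in>space M. \<exists>i\<in>{..T * 2 ^ m}. a / 2 < \<bar>I (real i / 2 ^ m) \<omega> - S m i \<omega>\<bar>}" for m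
  define E2 where "E2 m = {\<omega>\<in>space M. \<exists>i\<in>{..T * 2 ^ m}. a / 2 < \<bar>defect x m i \<omega> - (I (real i / 2 ^ m) \<omega> - S m i \<omega>)\<bar>}" for m
  have E1m: "E1 m \<in> events" for m
  proof -
    note Sm[measurable]
    show ?thesis unfolding E1_def by (rule sets.sets_Collect_finite_Ex) auto
  qed
  have E2m: "E2 m \<in> events" for m
  proof -
    note Sm[measurable] dm[measurable]
    show ?thesis unfolding E2_def by (rule sets.sets_Collect_finite_Ex) auto
  qed
  have "(\<lambda>m. prob (E1 m)) \<longlonglongrightarrow> 0"
    unfolding E1_def S_def Bex_def atMost_iff
  proof (rule ito_integral_riemann_sums[OF I])
    show "(\<lambda>\<omega>. \<sigma> (X x t \<omega>)) \<in> borel_measurable (F t)" if "0 \<le> t" for t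
      by (intro measurable_compose[OF X_measurable] coefficients_measurable x that order_refl)
    show "continuous_on {0..} (\<lambda>t. \<sigma> (X x t \<omega>))" if "\<omega> \<in> space M" for \<omega>
      by (rule continuous_on_compose2[OF lipschitz_on_continuous_on[OF lip_\<sigma>] X_paths(2)[OF x that]]) simp
  qed (use a in simp)
  moreover have "(\<lambda>m. prob (E2 m)) \<longlonglongrightarrow> 0"
  proof (rule prob_tendsto_0[OF E2m])
    show "AE \<omega> in M. \<forall>\<^sub>F m in sequentially. \<omega> \<notin> E2 m"
      using sde AE_space
    proof eventually_elim
      case (elim \<omega>)
      let ?h = "\<lambda>s. \<mu> (X x s \<omega>)"
      have h: "continuous_on {0..} ?h"
        by (rule continuous_on_compose2[OF lipschitz_on_continuous_on[OF lip_\<mu>] X_paths(2)[OF x elim(2)]]) simp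
      define \<eta> where "\<eta> = a / (2 * (real T + 1))"
      have \<eta>: "0 < \<eta>" "real T * \<eta> \<le> a / 2" using a by (auto simp: \<eta>_def field_simps)
      have "uniformly_continuous_on {0..real T} ?h"
        by (intro compact_uniformly_continuous continuous_on_subset[OF h]) auto
      then obtain d where d: "0 < d" and
        dd: "\<And>s t. s \<in> {0..real T} \<Longrightarrow> t \<in> {0..real T} \<Longrightarrow> dist t s < d \<Longrightarrow> dist (?h t) (?h s) < \<eta>"
        unfolding uniformly_continuous_on_def using \<eta>(1) by metis
      have "(\<lambda>m. (1/2::real) ^ m) \<longlonglongrightarrow> 0" by (rule LIMSEQ_realpow_zero) auto
      then have "\<forall>\<^sub>F m in sequentially. (1/2) ^ m < d" using d by (rule order_tendstoD)
      then show ?case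
      proof eventually_elim
        case m: (elim m)
        have "\<bar>defect x m i \<omega> - (I (real i / 2 ^ m) \<omega> - S m i \<omega>)\<bar> \<le> a / 2" if i: "i \<le> T * 2 ^ m" for i
        proof -
          have "real i \<le> real (T * 2 ^ m)" using i by (simp only: of_nat_le_iff)
          then have iT: "real i / 2 ^ m \<le> real T" by (simp add: field_simps)
          have "defect x m i \<omega> - (I (real i / 2 ^ m) \<omega> - S m i \<omega>)
              = (LBINT s:{0..real i / 2 ^ m}. ?h s) - (\<Sum>j<i. ?h (real j / 2 ^ m) / 2 ^ m)"
            using elim(1) by (simp add: defect_def S_def sum.distrib)
          also have "\<bar>\<dots>\<bar> \<le> real i / 2 ^ m * \<eta>"
          proof (rule left_riemann_sum_close[OF h iT])
            fix u v assume "0 \<le> u" "u \<le> v" "v \<le> real T" "v - u \<le> 1 / 2 ^ m"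
            then have "dist (?h v) (?h u) < \<eta>" using m by (intro dd) (auto simp: dist_real_def power_one_over)
            then show "\<bar>?h v - ?h u\<bar> \<le> \<eta>" by (simp add: dist_real_def)
          qed
          also have "\<dots> \<le> real T * \<eta>" using iT \<eta> by (intro mult_right_mono) auto
          finally show ?thesis using \<eta> by simp
        qed
        then show ?case by (auto simp: E2_def not_less)
      qed
    qed
  qed
  ultimately have lim: "(\<lambda>m. prob (E1 m) + prob (E2 m)) \<longlonglongrightarrow> 0 + 0" by (rule tendsto_add)
  show ?thesis
  proof (rule tendsto_sandwich[OF _ _ tendsto_const lim[simplified]])
    show "\<forall>\<^sub>F m in sequentially. prob {\<omega>\<in>space M. \<exists>i\<le>T * 2 ^ m. a < \<bar>defect x m i \<omega>\<bar>} \<le> prob (E1 m) + prob (E2 m)"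
    proof (rule always_eventually, rule allI)
      fix m
      have "prob {\<omega>\<in>space M. \<exists>i\<le>T * 2 ^ m. a < \<bar>defect x m i \<omega>\<bar>} \<le> prob (E1 m \<union> E2 m)"
      proof (rule finite_measure_mono)
        show "{\<omega>\<in>space M. \<exists>i\<le>T * 2 ^ m. a < \<bar>defect x m i \<omega>\<bar>} \<subseteq> E1 m \<union> E2 m"
        proof
          fix \<omega> assume "\<omega> \<in> {\<omega>\<in>space M. \<exists>i\<le>T * 2 ^ m. a < \<bar>defect x m i \<omega>\<bar>}"
          then obtain i where \<omega>: "\<omega> \<in> space M" and i: "i \<in> {..T * 2 ^ m}" and l: "a < \<bar>defect x m i \<omega>\<bar>" by auto
          have "a / 2 < \<bar>I (real i / 2 ^ m) \<omega> - S m i \<omega>\<bar> \<or>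
             a / 2 < \<bar>defect x m i \<omega> - (I (real i / 2 ^ m) \<omega> - S m i \<omega>)\<bar>" using l by linarith
          then show "\<omega> \<in> E1 m \<union> E2 m" using \<omega> i unfolding E1_def E2_def by blast
        qed
      qed (use E1m E2m in auto)
      also have "\<dots> \<le> prob (E1 m) + prob (E2 m)" by (rule measure_Un_le[OF E1m E2m])
      finally show "prob {\<omega>\<in>space M. \<exists>i\<le>T * 2 ^ m. a < \<bar>defect x m i \<omega>\<bar>} \<le> prob (E1 m) + prob (E2 m)" .
    qed
  qed simp
qed

text \<open>\<open>n\<close> steps of mesh \<open>1 / 2 ^ m\<close>, started in \<open>Z\<close> at time \<open>k / 2 ^ m\<close>.\<close>

primrec euler :: "nat \<Rightarrow> nat \<Rightarrow> ('w \<Rightarrow> real) \<Rightarrow> nat \<Rightarrow> 'w \<Rightarrow> real" where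
  "euler m k Z 0 = Z"
| "euler m k Z (Suc n) = (\<lambda>\<omega>. euler m k Z n \<omega> + \<mu> (euler m k Z n \<omega>) / 2 ^ m
     + \<sigma> (euler m k Z n \<omega>) * (W (real (Suc (k + n)) / 2 ^ m) \<omega> - W (real (k + n) / 2 ^ m) \<omega>))"

lemma euler_measurable:
  assumes "Z \<in> borel_measurable (F (real k / 2 ^ m))" "n \<le> l"
  shows "euler m k Z n \<in> borel_measurable (F (real (k + l) / 2 ^ m))"
  using assms(2)
proof (induction n)
  case 0
  show ?case using assms(1) by (auto intro!: measurable_F_mono[OF assms(1)] divide_right_mono)
next
  case (Suc n)
  then have [measurable]: "euler m k Z n \<in> borel_measurable (F (real (k + l) / 2 ^ m))" by simp
  have [measurable]: "W (real (Suc (k + n)) / 2 ^ m) \<in> borel_measurable (F (real (k + l) / 2 ^ m))"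
    "W (real (k + n) / 2 ^ m) \<in> borel_measurable (F (real (k + l) / 2 ^ m))"
    using Suc.prems by (auto intro!: W_measurable divide_right_mono)
  show ?case unfolding euler.simps by measurable
qed

lemma euler_measurable_M:
  "Z \<in> borel_measurable (F (real k / 2 ^ m)) \<Longrightarrow> euler m k Z n \<in> borel_measurable M"
  using measurable_F_M[OF euler_measurable[OF _ order_refl]] by simp

text \<open>The Euler scheme and the diffusion solve the same recursion up to the defect.  Their difference is
  frozen once the defect exceeds \<open>\<eta>\<close>.  The frozen difference starts at \<open>0\<close> and satisfies a discrete Gronwall
  inequality in mean square.\<close>

lemma euler_stability:
  assumes x: "x \<in> \<X>" and a: "0 < a" and \<eta>: "0 \<le> \<eta>"
  shows "prob {\<omega>\<in>space M. a + 2 * \<eta> < \<bar>euler m k (X x (real k / 2 ^ m)) n \<omega> - X x (real (k + n) / 2 ^ m) \<omega>\<bar>}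
    \<le> \<eta>\<^sup>2 * exp ((1 + 24 * L\<^sup>2) * (real n / 2 ^ m)) / a\<^sup>2
      + prob {\<omega>\<in>space M. \<exists>i\<le>k + n. \<eta> < \<bar>defect x m i \<omega>\<bar>}"
proof -
  define \<Delta> where "\<Delta> = 1 / (2::real) ^ m"
  define C where "C = 1 + 24 * L\<^sup>2"
  have C: "0 \<le> C" by (simp add: C_def)
  have \<Delta>: "0 < \<Delta>" "\<Delta> \<le> 1" by (auto simp: \<Delta>_def)
  let ?E = "euler m k (X x (real k / 2 ^ m))"
  let ?X = "\<lambda>i. X x (real i / 2 ^ m)"
  let ?w = "\<lambda>i \<omega>. W (real (Suc i) / 2 ^ m) \<omega> - W (real i / 2 ^ m) \<omega>"
  let ?e = "defect x m"
  define A where "A i = {\<omega>\<in>space M. \<forall>j\<in>{..k + i}. \<bar>?e j \<omega>\<bar> \<le> \<eta>}" for i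
  define p where "p i \<omega> = indicator (A i) \<omega> * (\<mu> (?E i \<omega>) - \<mu> (?X (k + i) \<omega>))" for i \<omega>
  define q where "q i \<omega> = indicator (A i) \<omega> * (\<sigma> (?E i \<omega>) - \<sigma> (?X (k + i) \<omega>))" for i \<omega>
  define D where "D i \<omega> = (\<Sum>j<i. p j \<omega> * \<Delta> + q j \<omega> * ?w (k + j) \<omega>)" for i \<omega>
  have Am: "A i \<in> sets (F (real (k + l) / 2 ^ m))" if "i \<le> l" for i l
  proof -
    have "{\<omega>\<in>space (F (real (k + l) / 2 ^ m)). \<forall>j\<in>{..k + i}. \<bar>?e j \<omega>\<bar> \<le> \<eta>} \<in> sets (F (real (k + l) / 2 ^ m))"
    proof (rule sets.sets_Collect_finite_All)
      fix j assume "j \<in> {..k + i}"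
      then have [measurable]: "?e j \<in> borel_measurable (F (real (k + l) / 2 ^ m))"
        using defect_measurable[OF x, of j "k + l" m] that by auto
      show "{\<omega>\<in>space (F (real (k + l) / 2 ^ m)). \<bar>?e j \<omega>\<bar> \<le> \<eta>} \<in> sets (F (real (k + l) / 2 ^ m))" by measurable
    qed simp
    then show ?thesis unfolding A_def using space_F[of "real (k + l) / 2 ^ m"] by simp
  qed
  have Zm: "X x (real k / 2 ^ m) \<in> borel_measurable (F (real k / 2 ^ m))"
    by (rule X_measurable[OF x]) auto
  have Em: "?E i \<in> borel_measurable (F (real (k + l) / 2 ^ m))" if "i \<le> l" for i l
    using euler_measurable[OF Zm that] .
  have Xm: "?X (k + i) \<in> borel_measurable (F (real (k + l) / 2 ^ m))" if "i \<le> l" for i l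
    using that by (intro X_measurable[OF x]) (auto intro!: divide_right_mono)
  have pm: "p i \<in> borel_measurable (F (real (k + l) / 2 ^ m))" if "i \<le> l" for i l
    unfolding p_def by (intro borel_measurable_times borel_measurable_indicator Am borel_measurable_diff
        measurable_compose[OF Em] measurable_compose[OF Xm] coefficients_measurable that)
  have qm: "q i \<in> borel_measurable (F (real (k + l) / 2 ^ m))" if "i \<le> l" for i l
    unfolding q_def by (intro borel_measurable_times borel_measurable_indicator Am borel_measurable_diff
        measurable_compose[OF Em] measurable_compose[OF Xm] coefficients_measurable that)
  have Dm: "D i \<in> borel_measurable (F (real (k + i) / 2 ^ m))" for i
    unfolding D_def
    by (intro borel_measurable_sum borel_measurable_add borel_measurable_times borel_measurable_diff
        W_measurable pm qm borel_measurable_const) (auto intro!: divide_right_mono)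
  have AD: "\<omega> \<in> A j" if "\<omega> \<in> A i" "j \<le> i" for i j \<omega> using that by (auto simp: A_def)
  \<comment> \<open>Nothing is frozen on \<open>A i\<close>: there \<open>D i\<close> is the difference between scheme and diffusion, up to the defect.\<close>
  have track: "?E i \<omega> = ?X (k + i) \<omega> - (?e (k + i) \<omega> - ?e k \<omega>) + D i \<omega>" if "\<omega> \<in> A i" for i \<omega>
    using that
  proof (induction i)
    case 0 then show ?case by (simp add: D_def)
  next
    case (Suc i)
    have Ai: "\<omega> \<in> A i" using AD[OF Suc.prems] by simp
    have "?e (Suc (k + i)) \<omega> = ?e (k + i) \<omega> + ?X (Suc (k + i)) \<omega> - ?X (k + i) \<omega>
        - \<mu> (?X (k + i) \<omega>) / 2 ^ m - \<sigma> (?X (k + i) \<omega>) * ?w (k + i) \<omega>"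
      by (simp add: defect_def)
    moreover have "D (Suc i) \<omega> = D i \<omega> + (\<mu> (?E i \<omega>) - \<mu> (?X (k + i) \<omega>)) / 2 ^ m
        + (\<sigma> (?E i \<omega>) - \<sigma> (?X (k + i) \<omega>)) * ?w (k + i) \<omega>"
      using Ai by (simp add: D_def p_def q_def \<Delta>_def)
    moreover have "?E (Suc i) \<omega> = ?E i \<omega> + \<mu> (?E i \<omega>) / 2 ^ m + \<sigma> (?E i \<omega>) * ?w (k + i) \<omega>"
      by simp
    ultimately show ?case
      using Suc.IH[OF Ai] unfolding left_diff_distrib diff_divide_distrib add_Suc_right by linarith
  qed
  have close: "\<bar>?E i \<omega> - ?X (k + i) \<omega>\<bar> \<le> \<bar>D i \<omega>\<bar> + 2 * \<eta>" if "\<omega> \<in> A i" for i \<omega>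
  proof -
    have "\<bar>?e (k + i) \<omega>\<bar> \<le> \<eta>" "\<bar>?e k \<omega>\<bar> \<le> \<eta>" using that by (auto simp: A_def)
    then show ?thesis using track[OF that] by linarith
  qed
  have step: "(D i \<omega> + p i \<omega> * \<Delta>)\<^sup>2 + (q i \<omega>)\<^sup>2 * \<Delta> \<le> (1 + C * \<Delta>) * (D i \<omega>)\<^sup>2 + C * \<Delta> * \<eta>\<^sup>2" for i \<omega>
  proof (cases "\<omega> \<in> A i")
    case True
    then show ?thesis unfolding C_def using \<Delta> \<eta> L_nonneg close[OF True] \<mu>_lip \<sigma>_lip
      by (intro stability_step[where d="\<bar>?E i \<omega> - ?X (k + i) \<omega>\<bar>"]) (auto simp: p_def q_def)
  next
    case False
    have "0 \<le> C * \<Delta> * (D i \<omega>)\<^sup>2 + C * \<Delta> * \<eta>\<^sup>2" using C \<Delta> by simp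
    then show ?thesis using False by (simp add: p_def q_def algebra_simps)
  qed
  have moment: "(\<integral>\<^sup>+\<omega>. ennreal ((D i \<omega>)\<^sup>2) \<partial>M) \<le> ennreal (\<eta>\<^sup>2 * ((1 + C * \<Delta>) ^ i - 1))" for i
  proof (induction i)
    case 0 then show ?case by (simp add: D_def)
  next
    case (Suc i)
    have t: "0 \<le> real (k + i) / 2 ^ m" "real (k + i) / 2 ^ m < real (Suc (k + i)) / 2 ^ m"
      "real (Suc (k + i)) / 2 ^ m - real (k + i) / 2 ^ m = \<Delta>" by (auto simp: \<Delta>_def field_simps)
    have [measurable]: "D i \<in> borel_measurable M" using measurable_F_M[OF Dm] by simp
    have Y: "(\<lambda>\<omega>. D i \<omega> + p i \<omega> * \<Delta>) \<in> borel_measurable (F (real (k + i) / 2 ^ m))"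
      using Dm[of i] pm[of i i] by simp
    have pow: "1 \<le> (1 + C * \<Delta>) ^ i" using C \<Delta> by (intro one_le_power) simp
    have "(\<integral>\<^sup>+\<omega>. ennreal ((D (Suc i) \<omega>)\<^sup>2) \<partial>M) = (\<integral>\<^sup>+\<omega>. ennreal ((D i \<omega> + p i \<omega> * \<Delta>)\<^sup>2 + (q i \<omega>)\<^sup>2 * \<Delta>) \<partial>M)"
      using nn_integral_increment_square[OF t(1,2) Y qm[OF order_refl]] t(3) by (simp add: D_def add.assoc)
    also have "\<dots> \<le> (\<integral>\<^sup>+\<omega>. ennreal (1 + C * \<Delta>) * ennreal ((D i \<omega>)\<^sup>2) + ennreal (C * \<Delta> * \<eta>\<^sup>2) \<partial>M)"
    proof (rule nn_integral_mono)
      fix \<omega>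
      have "ennreal ((D i \<omega> + p i \<omega> * \<Delta>)\<^sup>2 + (q i \<omega>)\<^sup>2 * \<Delta>) \<le> ennreal ((1 + C * \<Delta>) * (D i \<omega>)\<^sup>2 + C * \<Delta> * \<eta>\<^sup>2)"
        by (rule ennreal_leI[OF step])
      also have "\<dots> = ennreal (1 + C * \<Delta>) * ennreal ((D i \<omega>)\<^sup>2) + ennreal (C * \<Delta> * \<eta>\<^sup>2)"
        using C \<Delta> by (subst ennreal_plus) (auto simp: ennreal_mult)
      finally show "ennreal ((D i \<omega> + p i \<omega> * \<Delta>)\<^sup>2 + (q i \<omega>)\<^sup>2 * \<Delta>) \<le> \<dots>" .
    qed
    also have "\<dots> = ennreal (1 + C * \<Delta>) * (\<integral>\<^sup>+\<omega>. ennreal ((D i \<omega>)\<^sup>2) \<partial>M) + ennreal (C * \<Delta> * \<eta>\<^sup>2)"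
      by (simp add: nn_integral_add nn_integral_cmult emeasure_space_1)
    also have "\<dots> \<le> ennreal (1 + C * \<Delta>) * ennreal (\<eta>\<^sup>2 * ((1 + C * \<Delta>) ^ i - 1)) + ennreal (C * \<Delta> * \<eta>\<^sup>2)"
      by (intro add_right_mono mult_left_mono Suc) simp
    also have "\<dots> = ennreal ((1 + C * \<Delta>) * (\<eta>\<^sup>2 * ((1 + C * \<Delta>) ^ i - 1)) + C * \<Delta> * \<eta>\<^sup>2)"
      using C \<Delta> pow by (subst ennreal_plus) (auto simp: ennreal_mult)
    also have "(1 + C * \<Delta>) * (\<eta>\<^sup>2 * ((1 + C * \<Delta>) ^ i - 1)) + C * \<Delta> * \<eta>\<^sup>2 = \<eta>\<^sup>2 * ((1 + C * \<Delta>) ^ Suc i - 1)"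
      by (simp add: algebra_simps)
    finally show ?case .
  qed
  have "(1 + C * \<Delta>) ^ n \<le> exp (C * \<Delta>) ^ n"
    using C \<Delta> by (intro power_mono exp_ge_add_one_self) simp
  also have "\<dots> = exp (C * (real n / 2 ^ m))"
    by (simp add: exp_of_nat_mult[symmetric] \<Delta>_def mult.commute)
  finally have m2: "(\<integral>\<^sup>+\<omega>. ennreal ((D n \<omega>)\<^sup>2) \<partial>M) \<le> ennreal (\<eta>\<^sup>2 * exp (C * (real n / 2 ^ m)))"
    by (intro order_trans[OF moment] ennreal_leI mult_left_mono) auto
  have [measurable]: "D n \<in> borel_measurable M" using measurable_F_M[OF Dm] by simp
  have "prob {\<omega>\<in>space M. a < \<bar>D n \<omega>\<bar>} \<le> \<eta>\<^sup>2 * exp (C * (real n / 2 ^ m)) / a\<^sup>2"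
    by (rule second_moment_tail[OF _ m2 a]) auto
  moreover have bad: "{\<omega>\<in>space M. \<exists>i\<le>k + n. \<eta> < \<bar>?e i \<omega>\<bar>} = space M - A n"
    by (auto simp: A_def not_le[symmetric])
  have AM: "A n \<in> events"
  proof -
    have "0 \<le> real (k + n) / 2 ^ m" by simp
    then show ?thesis
      using Am[of n n] filtered unfolding filtered_prob_space_def subalgebra_def by blast
  qed
  moreover have "prob {\<omega>\<in>space M. a + 2 * \<eta> < \<bar>?E n \<omega> - ?X (k + n) \<omega>\<bar>}
      \<le> prob ({\<omega>\<in>space M. a < \<bar>D n \<omega>\<bar>} \<union> (space M - A n))"
  proof (rule finite_measure_mono)
    show "{\<omega>\<in>space M. a + 2 * \<eta> < \<bar>?E n \<omega> - ?X (k + n) \<omega>\<bar>} \<subseteq> {\<omega>\<in>space M. a < \<bar>D n \<omega>\<bar>} \<union> (space M - A n)"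
      using close by fastforce
  qed (use AM in auto)
  moreover have "\<dots> \<le> prob {\<omega>\<in>space M. a < \<bar>D n \<omega>\<bar>} + prob (space M - A n)"
    using AM by (intro measure_Un_le) auto
  ultimately show ?thesis unfolding C_def[symmetric] bad by linarith
qed

text \<open>At a fixed dyadic time, as the mesh \<open>1 / 2 ^ (r + l)\<close> is refined: the defect is eventually
  below any \<open>\<eta>\<close> with high probability, and \<open>\<eta>\<close> is chosen small against \<open>b\<close> and \<open>e\<close>.\<close>

lemma euler_converges:
  assumes x: "x \<in> \<X>" and b: "0 < b"
  shows "(\<lambda>l. prob {\<omega>\<in>space M. b < \<bar>euler (r + l) (k * 2 ^ l) (X x (real k / 2 ^ r)) (n * 2 ^ l) \<omega>
      - X x (real (k + n) / 2 ^ r) \<omega>\<bar>}) \<longlonglongrightarrow> 0"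
proof (rule tendsto_zero_le_eventuallyI)
  fix e :: real assume e: "0 < e"
  define c where "c = exp ((1 + 24 * L\<^sup>2) * (real n / 2 ^ r))"
  have c: "0 < c" by (simp add: c_def)
  define \<eta> where "\<eta> = min (b / 4) (sqrt (e / 2 * (b / 2)\<^sup>2 / c))"
  have \<eta>: "0 < \<eta>" "b / 2 + 2 * \<eta> \<le> b" using e b c by (auto simp: \<eta>_def)
  have "\<eta>\<^sup>2 \<le> (sqrt (e / 2 * (b / 2)\<^sup>2 / c))\<^sup>2" using \<eta> by (intro power_mono) (auto simp: \<eta>_def)
  then have \<eta>2: "\<eta>\<^sup>2 * c / (b / 2)\<^sup>2 \<le> e / 2" using e b c by (simp add: field_simps)
  have "(\<lambda>m. prob {\<omega>\<in>space M. \<exists>i\<le>(k + n) * 2 ^ m. \<eta> < \<bar>defect x m i \<omega>\<bar>}) \<longlonglongrightarrow> 0"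
    by (rule defect_small[OF x \<eta>(1)])
  then have "(\<lambda>l. prob {\<omega>\<in>space M. \<exists>i\<le>(k + n) * 2 ^ (l + r). \<eta> < \<bar>defect x (l + r) i \<omega>\<bar>}) \<longlonglongrightarrow> 0"
    by (rule LIMSEQ_ignore_initial_segment)
  then have "\<forall>\<^sub>F l in sequentially. prob {\<omega>\<in>space M. \<exists>i\<le>(k + n) * 2 ^ (l + r). \<eta> < \<bar>defect x (l + r) i \<omega>\<bar>} < e / 2"
    using e by (intro order_tendstoD) auto
  then show "\<forall>\<^sub>F l in sequentially. prob {\<omega>\<in>space M. b < \<bar>euler (r + l) (k * 2 ^ l) (X x (real k / 2 ^ r)) (n * 2 ^ l) \<omega>
      - X x (real (k + n) / 2 ^ r) \<omega>\<bar>} \<le> e"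
  proof eventually_elim
    case (elim l)
    have sc: "real (j * 2 ^ l) / 2 ^ (r + l) = real j / 2 ^ r" for j by (simp add: power_add)
    have sc2: "real (k * 2 ^ l + n * 2 ^ l) / 2 ^ (r + l) = real (k + n) / 2 ^ r"
      using sc[of "k + n"] by (simp add: add_mult_distrib)
    let ?E = "euler (r + l) (k * 2 ^ l) (X x (real k / 2 ^ r)) (n * 2 ^ l)"
    have dm: "defect x (r + l) i \<in> borel_measurable M" for i
      using measurable_F_M[OF defect_measurable[OF x order_refl]] by simp
    have bm: "{\<omega>\<in>space M. \<exists>i\<in>{..K}. \<eta> < \<bar>defect x (r + l) i \<omega>\<bar>} \<in> events" for K
    proof -
      note dm[measurable]
      show ?thesis by (rule sets.sets_Collect_finite_Ex) auto
    qed
    have [measurable]: "?E \<in> borel_measurable M"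
      by (rule euler_measurable_M) (use X_measurable[OF x, of "real k / 2 ^ r" "real k / 2 ^ r"] sc[of k] in auto)
    have [measurable]: "X x (real (k + n) / 2 ^ r) \<in> borel_measurable M" by (rule X_measurable_M[OF x]) simp
    have "prob {\<omega>\<in>space M. b < \<bar>?E \<omega> - X x (real (k + n) / 2 ^ r) \<omega>\<bar>}
        \<le> prob {\<omega>\<in>space M. b / 2 + 2 * \<eta> < \<bar>?E \<omega> - X x (real (k + n) / 2 ^ r) \<omega>\<bar>}"
    proof (rule finite_measure_mono)
      show "{\<omega>\<in>space M. b / 2 + 2 * \<eta> < \<bar>?E \<omega> - X x (real (k + n) / 2 ^ r) \<omega>\<bar>} \<in> events" by measurable
    qed (use \<eta> in auto)
    also have "\<dots> \<le> \<eta>\<^sup>2 * c / (b / 2)\<^sup>2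
      + prob {\<omega>\<in>space M. \<exists>i\<le>k * 2 ^ l + n * 2 ^ l. \<eta> < \<bar>defect x (r + l) i \<omega>\<bar>}"
      using euler_stability[OF x, of "b / 2" \<eta> "r + l" "k * 2 ^ l" "n * 2 ^ l"] b \<eta>
      unfolding sc sc2 c_def by simp
    also have "prob {\<omega>\<in>space M. \<exists>i\<le>k * 2 ^ l + n * 2 ^ l. \<eta> < \<bar>defect x (r + l) i \<omega>\<bar>}
       \<le> prob {\<omega>\<in>space M. \<exists>i\<in>{..(k + n) * 2 ^ (l + r)}. \<eta> < \<bar>defect x (r + l) i \<omega>\<bar>}"
    proof (rule finite_measure_mono[OF _ bm])
      have "k * 2 ^ l + n * 2 ^ l \<le> (k + n) * 2 ^ (l + r)"
        by (simp add: add_mult_distrib[symmetric] power_add)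
      then show "{\<omega>\<in>space M. \<exists>i\<le>k * 2 ^ l + n * 2 ^ l. \<eta> < \<bar>defect x (r + l) i \<omega>\<bar>}
        \<subseteq> {\<omega>\<in>space M. \<exists>i\<in>{..(k + n) * 2 ^ (l + r)}. \<eta> < \<bar>defect x (r + l) i \<omega>\<bar>}"
        by (auto intro: order_trans)
    qed
    also have "\<dots> = prob {\<omega>\<in>space M. \<exists>i\<le>(k + n) * 2 ^ (l + r). \<eta> < \<bar>defect x (l + r) i \<omega>\<bar>}"
      by (simp only: Bex_def atMost_iff add.commute[of l r])
    finally show ?case using \<eta>2 elim by linarith
  qed
qed simp

end

section \<open>The Markov property\<close>

abbreviation dyadic :: "nat \<times> nat \<Rightarrow> real" where
  "dyadic p \<equiv> real (snd p) / 2 ^ fst p"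

context lipschitz_diffusion
begin

text \<open>The expectation of \<open>G\<^sub>0(E\<^sub>0) \<cdots> G\<^sub>n(E\<^sub>n)\<close> along the Euler scheme as a function of its starting point, computed
  backwards from the last step.  The starting time does not occur.\<close>

primrec euler_expectation :: "nat \<Rightarrow> (real \<Rightarrow> ennreal) list \<Rightarrow> real \<Rightarrow> ennreal" where
  "euler_expectation m [] y = 1"
| "euler_expectation m (G # Gs) y =
     G y * (\<integral>\<^sup>+w. euler_expectation m Gs (y + \<mu> y / 2 ^ m + \<sigma> y * w) \<partial>gauss (1 / 2 ^ m))"

lemma euler_expectation_measurable:
  "set Gs \<subseteq> borel_measurable borel \<Longrightarrow> euler_expectation m Gs \<in> borel_measurable borel"
proof (induction Gs)
  case (Cons G Gs)
  then have [measurable]: "G \<in> borel_measurable borel" "euler_expectation m Gs \<in> borel_measurable borel" by auto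
  interpret G: prob_space "gauss (1 / 2 ^ m)" by (intro prob_space_normal_density) simp
  have [measurable_cong]: "sets (gauss (1 / 2 ^ m)) = sets borel" by simp
  show ?case unfolding euler_expectation.simps by measurable
next
  case Nil
  have "euler_expectation m [] = (\<lambda>_. 1)" by (simp add: fun_eq_iff)
  then show ?case by simp
qed

lemma euler_shift: "euler m k Z (Suc i) = euler m (Suc k) (euler m k Z 1) i"
  by (induction i) (auto simp: fun_eq_iff)

text \<open>The factor \<open>Y\<close> carries the part of the product that belongs to the past; it makes the induction
  over the remaining steps go through.\<close>

lemma nn_integral_euler_expectation:
  assumes "set Gs \<subseteq> borel_measurable borel"
    and "Z \<in> borel_measurable (F (real k / 2 ^ m))" "Y \<in> borel_measurable (F (real k / 2 ^ m))"
  shows "(\<integral>\<^sup>+\<omega>. Y \<omega> * euler_expectation m Gs (Z \<omega>) \<partial>M)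
    = (\<integral>\<^sup>+\<omega>. Y \<omega> * (\<Prod>i<length Gs. (Gs ! i) (euler m k Z i \<omega>)) \<partial>M)"
  using assms
proof (induction Gs arbitrary: k Z Y)
  case (Cons G Gs)
  let ?s = "real k / 2 ^ m" and ?t = "real (Suc k) / 2 ^ m"
  have st: "0 \<le> ?s" "?s < ?t" "?t - ?s = 1 / 2 ^ m" by (auto simp: field_simps)
  have [measurable]: "G \<in> borel_measurable borel" "euler_expectation m Gs \<in> borel_measurable borel"
    using Cons.prems(1) euler_expectation_measurable by auto
  have Zm [measurable]: "Z \<in> borel_measurable (F ?s)" and Ym [measurable]: "Y \<in> borel_measurable (F ?s)"
    using Cons.prems by auto
  have YG: "(\<lambda>\<omega>. Y \<omega> * G (Z \<omega>)) \<in> borel_measurable (F ?s)" by measurable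
  have Y': "(\<lambda>\<omega>. Y \<omega> * G (Z \<omega>)) \<in> borel_measurable (F ?t)"
    by (rule measurable_F_mono[OF YG]) (use st in auto)
  have Z': "euler m k Z 1 \<in> borel_measurable (F ?t)"
    using euler_measurable[OF Zm, of 1 1] by simp
  have eq: "(\<integral>\<^sup>+w. Y \<omega> * G (Z \<omega>) * euler_expectation m Gs (Z \<omega> + \<mu> (Z \<omega>) / 2 ^ m + \<sigma> (Z \<omega>) * w) \<partial>gauss (1 / 2 ^ m))
      = Y \<omega> * euler_expectation m (G # Gs) (Z \<omega>)" for \<omega>
    by (subst nn_integral_cmult) (auto simp: mult.assoc)
  have "(\<integral>\<^sup>+\<omega>. Y \<omega> * euler_expectation m (G # Gs) (Z \<omega>) \<partial>M)
      = (\<integral>\<^sup>+\<omega>. Y \<omega> * G (Z \<omega>) * euler_expectation m Gs (euler m k Z 1 \<omega>) \<partial>M)"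
    using nn_integral_increment[OF st(1,2), of "\<lambda>\<omega>. (Y \<omega> * G (Z \<omega>), Z \<omega>)" "borel \<Otimes>\<^sub>M borel"
      "\<lambda>z. fst (fst z) * euler_expectation m Gs (snd (fst z) + \<mu> (snd (fst z)) / 2 ^ m + \<sigma> (snd (fst z)) * snd z)"]
    using eq st(3) by simp
  also have "\<dots> = (\<integral>\<^sup>+\<omega>. Y \<omega> * G (Z \<omega>) * (\<Prod>i<length Gs. (Gs ! i) (euler m (Suc k) (euler m k Z 1) i \<omega>)) \<partial>M)"
    by (rule Cons.IH) (use Cons.prems(1) Z' Y' in auto)
  also have "\<dots> = (\<integral>\<^sup>+\<omega>. Y \<omega> * (\<Prod>i<length (G # Gs). ((G # Gs) ! i) (euler m k Z i \<omega>)) \<partial>M)"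
    by (simp only: length_Cons prod.lessThan_Suc_shift nth_Cons_0 nth_Cons_Suc euler.simps(1) euler_shift mult.assoc)
  finally show ?case .
qed simp

text \<open>The main point is the order of quantifiers: one function \<open>u\<close> serves all starting times and all
  starting variables.\<close>

lemma euler_cylinder_expectation:
  assumes "finite P" and g: "\<And>p. p \<in> P \<Longrightarrow> g p \<in> borel_measurable borel"
  shows "\<exists>u\<in>borel_measurable borel. \<forall>k Z. Z \<in> borel_measurable (F (real k / 2 ^ m)) \<longrightarrow>
    (\<integral>\<^sup>+\<omega>. u (Z \<omega>) \<partial>M) = (\<integral>\<^sup>+\<omega>. (\<Prod>p\<in>P. g p (euler m k Z (n p) \<omega>)) \<partial>M)"
proof -
  define N where "N = Suc (Max (insert 0 (n ` P)))"
  define Gs where "Gs = map (\<lambda>i y. \<Prod>p\<in>{p \<in> P. n p = i}. g p y) [0..<N]"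
  have nN: "n p < N" if "p \<in> P" for p using assms(1) that by (auto simp: N_def less_Suc_eq_le intro!: Max_ge)
  have G: "set Gs \<subseteq> borel_measurable borel"
    unfolding Gs_def using g by (auto intro!: borel_measurable_prod)
  have prod: "(\<Prod>i<length Gs. (Gs ! i) (euler m k Z i \<omega>)) = (\<Prod>p\<in>P. g p (euler m k Z (n p) \<omega>))" for k Z \<omega>
  proof -
    have "(\<Prod>i<length Gs. (Gs ! i) (euler m k Z i \<omega>)) = (\<Prod>i<N. \<Prod>p\<in>{p \<in> P. n p = i}. g p (euler m k Z (n p) \<omega>))"
      by (rule prod.cong) (auto simp: Gs_def intro!: prod.cong)
    also have "\<dots> = (\<Prod>p\<in>P. g p (euler m k Z (n p) \<omega>))"
      by (rule prod.group) (use assms(1) nN in auto)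
    finally show ?thesis .
  qed
  show ?thesis
  proof (intro bexI allI impI)
    show "euler_expectation m Gs \<in> borel_measurable borel" by (rule euler_expectation_measurable[OF G])
    fix k :: nat and Z :: "'w \<Rightarrow> real" assume "Z \<in> borel_measurable (F (real k / 2 ^ m))"
    from nn_integral_euler_expectation[OF G this, of "\<lambda>_. 1"]
    show "(\<integral>\<^sup>+\<omega>. euler_expectation m Gs (Z \<omega>) \<partial>M) = (\<integral>\<^sup>+\<omega>. (\<Prod>p\<in>P. g p (euler m k Z (n p) \<omega>)) \<partial>M)"
      by (simp add: prod)
  qed
qed

lemma lipschitz_prod_expectation_tendsto:
  fixes g :: "'i \<Rightarrow> real \<Rightarrow> real"
  assumes P: "finite P" and g: "\<And>p y. p \<in> P \<Longrightarrow> 0 \<le> g p y \<and> g p y \<le> 1"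
    and lip: "\<And>p y z. p \<in> P \<Longrightarrow> \<bar>g p y - g p z\<bar> \<le> \<kappa> * \<bar>y - z\<bar>" and \<kappa>: "0 \<le> \<kappa>"
    and gm: "\<And>p. p \<in> P \<Longrightarrow> g p \<in> borel_measurable borel"
    and A: "\<And>p l. p \<in> P \<Longrightarrow> A l p \<in> borel_measurable M" and B: "\<And>p. p \<in> P \<Longrightarrow> B p \<in> borel_measurable M"
    and conv: "\<And>p b. p \<in> P \<Longrightarrow> 0 < b \<Longrightarrow> (\<lambda>l. prob {\<omega>\<in>space M. b < \<bar>A l p \<omega> - B p \<omega>\<bar>}) \<longlonglongrightarrow> 0"
  shows "(\<lambda>l. \<integral>\<^sup>+\<omega>. (\<Prod>p\<in>P. ennreal (g p (A l p \<omega>))) \<partial>M) \<longlonglongrightarrow> (\<integral>\<^sup>+\<omega>. (\<Prod>p\<in>P. ennreal (g p (B p \<omega>))) \<partial>M)"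
proof -
  note [measurable] = A B gm
  have bnd: "norm (\<Prod>p\<in>P. g p (Y p)) \<le> 1" and nn: "0 \<le> (\<Prod>p\<in>P. g p (Y p))" for Y
    using g by (auto simp: abs_prod intro!: prod_le_1 prod_nonneg)
  have ia: "integrable M (\<lambda>\<omega>. \<Prod>p\<in>P. g p (A l p \<omega>))" for l
    by (rule integrable_const_bound[where B=1]) (use bnd in auto)
  have ib: "integrable M (\<lambda>\<omega>. \<Prod>p\<in>P. g p (B p \<omega>))"
    by (rule integrable_const_bound[where B=1]) (use bnd in auto)
  have "(\<lambda>l. \<bar>expectation (\<lambda>\<omega>. \<Prod>p\<in>P. g p (A l p \<omega>)) - expectation (\<lambda>\<omega>. \<Prod>p\<in>P. g p (B p \<omega>))\<bar>) \<longlonglongrightarrow> 0"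
  proof (rule tendsto_zero_le_eventuallyI)
    fix e :: real assume e: "0 < e"
    \<comment> \<open>The arguments may differ by \<open>b\<close> at the cost of \<open>e / 2\<close>; the rest of the error is the probability of a larger difference.\<close>
    define b where "b = e / (2 * (real (card P) + 1) * (\<kappa> + 1))"
    have b: "0 < b" using e \<kappa> by (auto simp: b_def intro!: divide_pos_pos mult_pos_pos)
    have bl: "real (card P) * (\<kappa> * b) \<le> e / 2"
    proof -
      have "real (card P) * (\<kappa> * b) \<le> (real (card P) + 1) * ((\<kappa> + 1) * b)"
        using b \<kappa> by (intro mult_mono) auto
      also have "\<dots> = b * (2 * (real (card P) + 1) * (\<kappa> + 1)) / 2" by (simp add: algebra_simps)
      also have "b * (2 * (real (card P) + 1) * (\<kappa> + 1)) = e"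
      proof -
        have "2 * (real (card P) + 1) * (\<kappa> + 1) \<noteq> 0"
          using \<kappa> by (simp add: add_nonneg_eq_0_iff)
        then show ?thesis unfolding b_def by (rule nonzero_divide_eq_eq[THEN iffD1, symmetric, OF _ refl])
      qed
      finally show ?thesis .
    qed
    have "(\<lambda>l. \<Sum>p\<in>P. prob {\<omega>\<in>space M. b < \<bar>A l p \<omega> - B p \<omega>\<bar>}) \<longlonglongrightarrow> (\<Sum>p\<in>P. 0)"
      by (intro tendsto_sum conv b)
    then have "\<forall>\<^sub>F l in sequentially. (\<Sum>p\<in>P. prob {\<omega>\<in>space M. b < \<bar>A l p \<omega> - B p \<omega>\<bar>}) < e / 2"
      using e by (intro order_tendstoD) auto
    then show "\<forall>\<^sub>F l in sequentially. \<bar>expectation (\<lambda>\<omega>. \<Prod>p\<in>P. g p (A l p \<omega>)) - expectation (\<lambda>\<omega>. \<Prod>p\<in>P. g p (B p \<omega>))\<bar> \<le> e"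
    proof eventually_elim
      case (elim l)
      let ?S = "\<lambda>p. {\<omega>\<in>space M. b < \<bar>A l p \<omega> - B p \<omega>\<bar>}"
      have Sm: "?S p \<in> events" if "p \<in> P" for p
      proof -
        have [measurable]: "A l p \<in> borel_measurable M" "B p \<in> borel_measurable M" using A B that by auto
        show ?thesis by measurable
      qed
      have isum: "integrable M (\<lambda>\<omega>. \<Sum>p\<in>P. \<kappa> * b + indicator (?S p) \<omega>)"
        using Sm by (intro Bochner_Integration.integrable_sum Bochner_Integration.integrable_add) (auto simp: less_top[symmetric])
      have "expectation (\<lambda>\<omega>. \<Prod>p\<in>P. g p (A l p \<omega>)) - expectation (\<lambda>\<omega>. \<Prod>p\<in>P. g p (B p \<omega>))
          = expectation (\<lambda>\<omega>. (\<Prod>p\<in>P. g p (A l p \<omega>)) - (\<Prod>p\<in>P. g p (B p \<omega>)))"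
        using ia ib by simp
      also have "\<bar>\<dots>\<bar> \<le> expectation (\<lambda>\<omega>. \<bar>(\<Prod>p\<in>P. g p (A l p \<omega>)) - (\<Prod>p\<in>P. g p (B p \<omega>))\<bar>)"
        by (rule integral_abs_bound)
      also have "\<dots> \<le> expectation (\<lambda>\<omega>. \<Sum>p\<in>P. \<kappa> * b + indicator (?S p) \<omega>)"
      proof (rule integral_mono)
        show "integrable M (\<lambda>\<omega>. \<bar>(\<Prod>p\<in>P. g p (A l p \<omega>)) - (\<Prod>p\<in>P. g p (B p \<omega>))\<bar>)" using ia ib by simp
        fix \<omega> assume \<omega>: "\<omega> \<in> space M"
        have "\<bar>(\<Prod>p\<in>P. g p (A l p \<omega>)) - (\<Prod>p\<in>P. g p (B p \<omega>))\<bar> \<le> (\<Sum>p\<in>P. \<bar>g p (A l p \<omega>) - g p (B p \<omega>)\<bar>)"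
          using norm_prod_diff[of P "\<lambda>p. g p (A l p \<omega>)" "\<lambda>p. g p (B p \<omega>)"] g by auto
        also have "\<dots> \<le> (\<Sum>p\<in>P. \<kappa> * b + indicator (?S p) \<omega>)"
        proof (rule sum_mono)
          fix p assume p: "p \<in> P"
          show "\<bar>g p (A l p \<omega>) - g p (B p \<omega>)\<bar> \<le> \<kappa> * b + indicator (?S p) \<omega>"
          proof (cases "\<omega> \<in> ?S p")
            case True
            have "0 \<le> \<kappa> * b" using \<kappa> b by simp
            then show ?thesis using True g[OF p, of "A l p \<omega>"] g[OF p, of "B p \<omega>"]
              unfolding indicator_simps(1)[OF True] by linarith
          next
            case False
            then have "\<kappa> * \<bar>A l p \<omega> - B p \<omega>\<bar> \<le> \<kappa> * b" using \<omega> \<kappa> by (intro mult_left_mono) auto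
            then show ?thesis using False lip[OF p, of "A l p \<omega>" "B p \<omega>"]
              unfolding indicator_simps(2)[OF False] by linarith
          qed
        qed
        finally show "\<bar>(\<Prod>p\<in>P. g p (A l p \<omega>)) - (\<Prod>p\<in>P. g p (B p \<omega>))\<bar> \<le> (\<Sum>p\<in>P. \<kappa> * b + indicator (?S p) \<omega>)" .
      qed (rule isum)
      also have "\<dots> = (\<Sum>p\<in>P. \<kappa> * b + prob (?S p))"
        using Sm by (subst Bochner_Integration.integral_sum) (auto simp: less_top[symmetric] prob_space intro!: sum.cong)
      also have "\<dots> = real (card P) * (\<kappa> * b) + (\<Sum>p\<in>P. prob (?S p))" by (simp add: sum.distrib)
      finally show ?case using bl elim by linarith
    qed
  qed simp
  then have "(\<lambda>l. expectation (\<lambda>\<omega>. \<Prod>p\<in>P. g p (A l p \<omega>))) \<longlonglongrightarrow> expectation (\<lambda>\<omega>. \<Prod>p\<in>P. g p (B p \<omega>))"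
    by (subst (asm) tendsto_rabs_zero_iff) (rule LIM_zero_cancel)
  then have "(\<lambda>l. ennreal (expectation (\<lambda>\<omega>. \<Prod>p\<in>P. g p (A l p \<omega>)))) \<longlonglongrightarrow> ennreal (expectation (\<lambda>\<omega>. \<Prod>p\<in>P. g p (B p \<omega>)))"
    by (rule tendsto_ennrealI)
  moreover have "(\<integral>\<^sup>+\<omega>. (\<Prod>p\<in>P. ennreal (g p (A l p \<omega>))) \<partial>M) = ennreal (expectation (\<lambda>\<omega>. \<Prod>p\<in>P. g p (A l p \<omega>)))" for l
    using nn_integral_eq_integral[OF ia[of l]] nn g by (simp add: prod_ennreal)
  moreover have "(\<integral>\<^sup>+\<omega>. (\<Prod>p\<in>P. ennreal (g p (B p \<omega>))) \<partial>M) = ennreal (expectation (\<lambda>\<omega>. \<Prod>p\<in>P. g p (B p \<omega>)))"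
    using nn_integral_eq_integral[OF ib] nn g by (simp add: prod_ennreal)
  ultimately show ?thesis by simp
qed

lemma X_restrict_measurable:
  "x \<in> \<X> \<Longrightarrow> 0 \<le> t \<Longrightarrow> X x t \<in> measurable M (restrict_space borel \<X>)"
  using X_measurable_M X_paths(3) by (auto intro!: measurable_restrict_space2)

text \<open>In the limit of vanishing mesh, the function \<open>u\<close> of \<open>euler_cylinder_expectation\<close> becomes \<open>U\<close> when the scheme starts
  at a point \<open>y\<close>; started from \<open>X x s\<close> at time \<open>s\<close>, the scheme converges to the diffusion after time \<open>s\<close>.
  Comparing the two limits gives the Markov property.\<close>

lemma markov_lipschitz_cylinder:
  fixes g :: "'i \<Rightarrow> real \<Rightarrow> real" and n :: "'i \<Rightarrow> nat" and r :: nat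
  assumes P: "finite P" and g: "\<And>p y. p \<in> P \<Longrightarrow> 0 \<le> g p y \<and> g p y \<le> 1"
    and lip: "\<And>p y z. p \<in> P \<Longrightarrow> \<bar>g p y - g p z\<bar> \<le> \<kappa> * \<bar>y - z\<bar>" and \<kappa>: "0 \<le> \<kappa>"
    and gm: "\<And>p. p \<in> P \<Longrightarrow> g p \<in> borel_measurable borel"
  defines "U \<equiv> \<lambda>y. \<integral>\<^sup>+\<omega>. (\<Prod>p\<in>P. ennreal (g p (X y (real (n p) / 2 ^ r) \<omega>))) \<partial>M"
  shows "U \<in> borel_measurable (restrict_space borel \<X>)"
    and "x \<in> \<X> \<Longrightarrow> (\<integral>\<^sup>+\<omega>. (\<Prod>p\<in>P. ennreal (g p (X x (real (k + n p) / 2 ^ r) \<omega>))) \<partial>M)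
      = (\<integral>\<^sup>+\<omega>. U (X x (real k / 2 ^ r) \<omega>) \<partial>M)"
proof -
  have "\<exists>u\<in>borel_measurable borel. \<forall>k Z. Z \<in> borel_measurable (F (real k / 2 ^ (r + l))) \<longrightarrow>
    (\<integral>\<^sup>+\<omega>. u (Z \<omega>) \<partial>M) = (\<integral>\<^sup>+\<omega>. (\<Prod>p\<in>P. ennreal (g p (euler (r + l) k Z (n p * 2 ^ l) \<omega>))) \<partial>M)" for l
    by (rule euler_cylinder_expectation[OF P]) (use gm in simp)
  then obtain u where um: "\<And>l. u l \<in> borel_measurable borel" and
    u: "\<And>l k Z. Z \<in> borel_measurable (F (real k / 2 ^ (r + l))) \<Longrightarrow>
    (\<integral>\<^sup>+\<omega>. u l (Z \<omega>) \<partial>M) = (\<integral>\<^sup>+\<omega>. (\<Prod>p\<in>P. ennreal (g p (euler (r + l) k Z (n p * 2 ^ l) \<omega>))) \<partial>M)"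
    unfolding Bex_def by atomize_elim (use choice[of "\<lambda>l u. u \<in> borel_measurable borel \<and> (\<forall>k Z. Z \<in> borel_measurable (F (real k / 2 ^ (r + l))) \<longrightarrow>
    (\<integral>\<^sup>+\<omega>. u (Z \<omega>) \<partial>M) = (\<integral>\<^sup>+\<omega>. (\<Prod>p\<in>P. ennreal (g p (euler (r + l) k Z (n p * 2 ^ l) \<omega>))) \<partial>M))"] in blast)
  have sc: "real (k * 2 ^ l) / 2 ^ (r + l) = real k / 2 ^ r" for k l by (simp add: power_add)
  have Zm: "X x (real k / 2 ^ r) \<in> borel_measurable (F (real (k * 2 ^ l) / 2 ^ (r + l)))" if "x \<in> \<X>" for x k l
    unfolding sc using that by (intro X_measurable) auto
  have conv: "(\<lambda>l. \<integral>\<^sup>+\<omega>. u l (X x (real k / 2 ^ r) \<omega>) \<partial>M)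
      \<longlonglongrightarrow> (\<integral>\<^sup>+\<omega>. (\<Prod>p\<in>P. ennreal (g p (X x (real (k + n p) / 2 ^ r) \<omega>))) \<partial>M)" if x: "x \<in> \<X>" for x k
    unfolding u[OF Zm[OF x]]
  proof (rule lipschitz_prod_expectation_tendsto[OF P g lip \<kappa> gm])
    show "euler (r + l) (k * 2 ^ l) (X x (real k / 2 ^ r)) (n p * 2 ^ l) \<in> borel_measurable M" for l p
      by (rule euler_measurable_M[OF Zm[OF x]])
    show "X x (real (k + n p) / 2 ^ r) \<in> borel_measurable M" for p by (rule X_measurable_M[OF x]) simp
  qed (use euler_converges[OF x] in auto)
  \<comment> \<open>From a deterministic starting point the expectation is \<open>u l y\<close> itself.\<close>
  have const: "(\<integral>\<^sup>+\<omega>. u l (X y (real 0 / 2 ^ r) \<omega>) \<partial>M) = u l y" if "y \<in> \<X>" for y l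
  proof -
    have "(\<integral>\<^sup>+\<omega>. u l (X y (real 0 / 2 ^ r) \<omega>) \<partial>M) = (\<integral>\<^sup>+\<omega>. u l y \<partial>M)"
      by (intro nn_integral_cong) (simp add: X_paths(1)[OF that])
    then show ?thesis by (simp add: emeasure_space_1)
  qed
  have ulim: "(\<lambda>l. u l y) \<longlonglongrightarrow> U y" if "y \<in> \<X>" for y
    using conv[OF that, of 0] unfolding const[OF that] U_def by simp
  have ule: "u l y \<le> 1" if "y \<in> \<X>" for l y
  proof -
    have "u l y = (\<integral>\<^sup>+\<omega>. (\<Prod>p\<in>P. ennreal (g p (euler (r + l) (0 * 2 ^ l) (X y (real 0 / 2 ^ r)) (n p * 2 ^ l) \<omega>))) \<partial>M)"
      unfolding const[OF that, symmetric] by (rule u[OF Zm[OF that]])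
    also have "\<dots> \<le> (\<integral>\<^sup>+\<omega>. 1 \<partial>M)" using g by (intro nn_integral_mono prod_le_1) (auto simp: ennreal_le_1)
    finally show ?thesis by (simp add: emeasure_space_1)
  qed
  show Um: "U \<in> borel_measurable (restrict_space borel \<X>)"
  proof (rule borel_measurable_LIMSEQ_order)
    show "u l \<in> borel_measurable (restrict_space borel \<X>)" for l by (rule measurable_restrict_space1[OF um])
    show "(\<lambda>l. u l y) \<longlonglongrightarrow> U y" if "y \<in> space (restrict_space borel \<X>)" for y
      using ulim that by (simp add: space_restrict_space)
  qed
  assume x: "x \<in> \<X>"
  have "(\<lambda>l. \<integral>\<^sup>+\<omega>. u l (X x (real k / 2 ^ r) \<omega>) \<partial>M) \<longlonglongrightarrow> (\<integral>\<^sup>+\<omega>. U (X x (real k / 2 ^ r) \<omega>) \<partial>M)"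
  proof (rule nn_integral_dominated_convergence[where w="\<lambda>_. 1"])
    show "(\<lambda>\<omega>. u l (X x (real k / 2 ^ r) \<omega>)) \<in> borel_measurable M" for l
      by (rule measurable_compose[OF X_measurable_M[OF x] um]) simp
    show "(\<lambda>\<omega>. U (X x (real k / 2 ^ r) \<omega>)) \<in> borel_measurable M"
      by (rule measurable_compose[OF X_restrict_measurable[OF x] Um]) simp
  qed (use ulim ule X_paths(3)[OF x] in \<open>auto simp: emeasure_space_1\<close>)
  with conv[OF x, of k] show "(\<integral>\<^sup>+\<omega>. (\<Prod>p\<in>P. ennreal (g p (X x (real (k + n p) / 2 ^ r) \<omega>))) \<partial>M)
      = (\<integral>\<^sup>+\<omega>. U (X x (real k / 2 ^ r) \<omega>) \<partial>M)"
    by (rule LIMSEQ_unique)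
qed

lemma open_approximation:
  fixes A :: "real set" assumes "open A" "A \<noteq> UNIV"
  shows "(\<lambda>N. min 1 (real N * infdist y (- A))) \<longlonglongrightarrow> indicator A y"
proof (cases "y \<in> A")
  case True
  have pos: "0 < infdist y (- A)" by (rule infdist_pos_not_in_closed) (use assms True in auto)
  have "\<forall>\<^sub>F N in sequentially. 1 / infdist y (- A) \<le> real N"
    by (rule eventually_at_top_linorderI[of "nat \<lceil>1 / infdist y (- A)\<rceil>"]) linarith
  then have "\<forall>\<^sub>F N in sequentially. min 1 (real N * infdist y (- A)) = indicator A y"
    by eventually_elim (use True pos in \<open>simp add: field_simps\<close>)
  then show ?thesis by (rule tendsto_eventually)
next
  case False
  then show ?thesis using assms by simp
qed

text \<open>Indicators of open sets are limits of Lipschitz functions.\<close>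

lemma markov_open_cylinder:
  fixes A :: "'i \<Rightarrow> real set" and n :: "'i \<Rightarrow> nat" and r :: nat
  assumes P: "finite P" and A: "\<And>p. p \<in> P \<Longrightarrow> open (A p)" "\<And>p. p \<in> P \<Longrightarrow> A p \<noteq> UNIV"
  defines "U \<equiv> \<lambda>y. \<integral>\<^sup>+\<omega>. (\<Prod>p\<in>P. indicator (A p) (X y (real (n p) / 2 ^ r) \<omega>)) \<partial>M"
  shows "U \<in> borel_measurable (restrict_space borel \<X>)"
    and "x \<in> \<X> \<Longrightarrow> (\<integral>\<^sup>+\<omega>. (\<Prod>p\<in>P. indicator (A p) (X x (real (k + n p) / 2 ^ r) \<omega>)) \<partial>M)
      = (\<integral>\<^sup>+\<omega>. U (X x (real k / 2 ^ r) \<omega>) \<partial>M)"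
proof -
  define g where "g N p y = min 1 (real N * infdist y (- A p))" for N p y
  have g: "0 \<le> g N p y \<and> g N p y \<le> 1" for N p y by (auto simp: g_def infdist_nonneg)
  have glip: "\<bar>g N p y - g N p z\<bar> \<le> real N * \<bar>y - z\<bar>" for N p y z
  proof -
    have "\<bar>g N p y - g N p z\<bar> \<le> \<bar>real N * infdist y (- A p) - real N * infdist z (- A p)\<bar>"
      by (auto simp: g_def min_def)
    also have "\<dots> = real N * \<bar>infdist y (- A p) - infdist z (- A p)\<bar>"
      by (simp add: abs_mult right_diff_distrib[symmetric])
    also have "\<dots> \<le> real N * \<bar>y - z\<bar>"
      using infdist_triangle_abs[of y "- A p" z] by (intro mult_left_mono) (auto simp: dist_real_def)
    finally show ?thesis .
  qed
  have gm: "g N p \<in> borel_measurable borel" for N p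
    unfolding g_def by (intro borel_measurable_continuous_onI continuous_intros)
  have glim: "(\<lambda>N. \<Prod>p\<in>P. ennreal (g N p (Y p))) \<longlonglongrightarrow> (\<Prod>p\<in>P. indicator (A p) (Y p))" for Y
  proof -
    have "(\<lambda>N. \<Prod>p\<in>P. g N p (Y p)) \<longlonglongrightarrow> (\<Prod>p\<in>P. indicator (A p) (Y p))"
      unfolding g_def by (intro tendsto_prod open_approximation A)
    then have "(\<lambda>N. ennreal (\<Prod>p\<in>P. g N p (Y p))) \<longlonglongrightarrow> ennreal (\<Prod>p\<in>P. indicator (A p) (Y p))"
      by (rule tendsto_ennrealI)
    then show ?thesis using g by (simp add: prod_ennreal[symmetric] ennreal_indicator)
  qed
  have conv: "(\<lambda>N. \<integral>\<^sup>+\<omega>. (\<Prod>p\<in>P. ennreal (g N p (Y p \<omega>))) \<partial>M) \<longlonglongrightarrow> (\<integral>\<^sup>+\<omega>. (\<Prod>p\<in>P. indicator (A p) (Y p \<omega>)) \<partial>M)"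
    if Y: "\<And>p. p \<in> P \<Longrightarrow> Y p \<in> borel_measurable M" for Y
  proof (rule nn_integral_dominated_convergence[where w="\<lambda>_. 1"])
    show "(\<lambda>\<omega>. \<Prod>p\<in>P. ennreal (g N p (Y p \<omega>))) \<in> borel_measurable M" for N
    proof (rule borel_measurable_prod_ennreal)
      show "(\<lambda>\<omega>. ennreal (g N p (Y p \<omega>))) \<in> borel_measurable M" if "p \<in> P" for p
        by (rule measurable_compose[OF measurable_compose[OF Y[OF that] gm] measurable_ennreal])
    qed
    show "(\<lambda>\<omega>. \<Prod>p\<in>P. indicator (A p) (Y p \<omega>) :: ennreal) \<in> borel_measurable M"
    proof (rule borel_measurable_prod_ennreal)
      show "(\<lambda>\<omega>. indicator (A p) (Y p \<omega>) :: ennreal) \<in> borel_measurable M" if "p \<in> P" for p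
        by (rule measurable_compose[OF Y[OF that] borel_measurable_indicator]) (use A that in simp)
    qed
    show "AE \<omega> in M. (\<Prod>p\<in>P. ennreal (g N p (Y p \<omega>))) \<le> 1" for N
      using g by (intro AE_I2 prod_le_1) (auto simp: ennreal_le_1)
  qed (use glim in \<open>auto simp: emeasure_space_1\<close>)
  define VN where "VN N y = (\<integral>\<^sup>+\<omega>. (\<Prod>p\<in>P. ennreal (g N p (X y (real (n p) / 2 ^ r) \<omega>))) \<partial>M)" for N y
  have VNm: "VN N \<in> borel_measurable (restrict_space borel \<X>)" for N
    unfolding VN_def by (rule markov_lipschitz_cylinder(1)[OF P g glip _ gm]) simp
  have VNlim: "(\<lambda>N. VN N y) \<longlonglongrightarrow> U y" if "y \<in> \<X>" for y
    unfolding VN_def U_def by (rule conv) (rule X_measurable_M[OF that], simp)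
  have VNle: "VN N y \<le> 1" for N y
  proof -
    have "VN N y \<le> (\<integral>\<^sup>+\<omega>. 1 \<partial>M)" unfolding VN_def using g by (intro nn_integral_mono prod_le_1) (auto simp: ennreal_le_1)
    then show ?thesis by (simp add: emeasure_space_1)
  qed
  show Um: "U \<in> borel_measurable (restrict_space borel \<X>)"
    by (rule borel_measurable_LIMSEQ_order[OF VNlim VNm]) (simp add: space_restrict_space)
  assume x: "x \<in> \<X>"
  have "(\<lambda>N. \<integral>\<^sup>+\<omega>. VN N (X x (real k / 2 ^ r) \<omega>) \<partial>M) \<longlonglongrightarrow> (\<integral>\<^sup>+\<omega>. U (X x (real k / 2 ^ r) \<omega>) \<partial>M)"
  proof (rule nn_integral_dominated_convergence[where w="\<lambda>_. 1"])
    show "(\<lambda>\<omega>. VN N (X x (real k / 2 ^ r) \<omega>)) \<in> borel_measurable M" for N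
      by (rule measurable_compose[OF X_restrict_measurable[OF x] VNm]) simp
    show "(\<lambda>\<omega>. U (X x (real k / 2 ^ r) \<omega>)) \<in> borel_measurable M"
      by (rule measurable_compose[OF X_restrict_measurable[OF x] Um]) simp
  qed (use VNlim VNle X_paths(3)[OF x] in \<open>auto simp: emeasure_space_1\<close>)
  moreover have "(\<integral>\<^sup>+\<omega>. VN N (X x (real k / 2 ^ r) \<omega>) \<partial>M)
      = (\<integral>\<^sup>+\<omega>. (\<Prod>p\<in>P. ennreal (g N p (X x (real (k + n p) / 2 ^ r) \<omega>))) \<partial>M)" for N
    unfolding VN_def by (rule markov_lipschitz_cylinder(2)[OF P g glip _ gm x, symmetric]) simp
  moreover have "(\<lambda>N. \<integral>\<^sup>+\<omega>. (\<Prod>p\<in>P. ennreal (g N p (X x (real (k + n p) / 2 ^ r) \<omega>))) \<partial>M)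
      \<longlonglongrightarrow> (\<integral>\<^sup>+\<omega>. (\<Prod>p\<in>P. indicator (A p) (X x (real (k + n p) / 2 ^ r) \<omega>)) \<partial>M)"
    by (rule conv) (rule X_measurable_M[OF x], simp)
  ultimately show "(\<integral>\<^sup>+\<omega>. (\<Prod>p\<in>P. indicator (A p) (X x (real (k + n p) / 2 ^ r) \<omega>)) \<partial>M)
      = (\<integral>\<^sup>+\<omega>. U (X x (real k / 2 ^ r) \<omega>) \<partial>M)"
    by (simp add: LIMSEQ_unique)
qed

end

text \<open>Paths are indexed by pairs \<open>(m, k)\<close> standing for the time \<open>k / 2 ^ m\<close>; the index type is countable, so
  the open cylinders generate the Borel sets of the product topology.\<close>

definition open_cylinders :: "(nat \<times> nat \<Rightarrow> real) set set" where
  "open_cylinders = {Pi\<^sub>E UNIV A |A. (\<forall>p. open (A p)) \<and> finite {p. A p \<noteq> UNIV}}"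

lemma open_cylinders:
  "Int_stable open_cylinders" "open_cylinders \<subseteq> Pow UNIV" "sets borel = sigma_sets UNIV open_cylinders"
  "UNIV \<in> open_cylinders"
proof -
  show "Int_stable open_cylinders"
  proof (rule Int_stableI)
    fix a b :: "(nat \<times> nat \<Rightarrow> real) set" assume "a \<in> open_cylinders" "b \<in> open_cylinders"
    then obtain A B where A: "a = Pi\<^sub>E UNIV A" "\<And>p. open (A p)" "finite {p. A p \<noteq> UNIV}"
      and B: "b = Pi\<^sub>E UNIV B" "\<And>p. open (B p)" "finite {p. B p \<noteq> UNIV}"
      unfolding open_cylinders_def by blast
    have "finite {p. A p \<inter> B p \<noteq> UNIV}"
      by (rule finite_subset[OF _ finite_UnI[OF A(3) B(3)]]) auto
    moreover have "a \<inter> b = Pi\<^sub>E UNIV (\<lambda>p. A p \<inter> B p)"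
      unfolding A(1) B(1) by (simp add: PiE_Int)
    moreover have "open (A p \<inter> B p)" for p using A(2) B(2) by (rule open_Int)
    ultimately show "a \<inter> b \<in> open_cylinders" unfolding open_cylinders_def
      by (intro CollectI exI[of _ "\<lambda>p. A p \<inter> B p"] conjI allI)
  qed
  show "open_cylinders \<subseteq> Pow UNIV" by simp
  have "Pi\<^sub>E UNIV (\<lambda>_. UNIV) \<in> open_cylinders"
    unfolding open_cylinders_def by (intro CollectI exI[of _ "\<lambda>_. UNIV"]) simp
  then show "UNIV \<in> open_cylinders" by simp
  obtain K :: "(nat \<times> nat \<Rightarrow> real) set set" where K: "topological_basis K" "countable K"
    and KX: "\<forall>k\<in>K. \<exists>A. k = Pi\<^sub>E UNIV A \<and> (\<forall>i. open (A i)) \<and> finite {i. A i \<noteq> UNIV}"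
    using product_topology_countable_basis by blast
  have KE: "K \<subseteq> open_cylinders" using KX unfolding open_cylinders_def by blast
  have op: "open a" if "a \<in> open_cylinders" for a
    using that unfolding open_cylinders_def by (auto intro: open_PiE)
  show "sets borel = sigma_sets UNIV open_cylinders"
  proof
    have "sets (borel :: (nat \<times> nat \<Rightarrow> real) measure) = sigma_sets UNIV K"
      using arg_cong[OF borel_eq_countable_basis[OF K(2,1)], of sets] by simp
    then show "sets borel \<subseteq> sigma_sets UNIV open_cylinders" using sigma_sets_mono'[OF KE] by simp
    have "sigma_sets (space (borel :: (nat \<times> nat \<Rightarrow> real) measure)) open_cylinders \<subseteq> sets borel"
      by (rule sets.sigma_sets_subset) (use op in auto)
    then show "sigma_sets UNIV open_cylinders \<subseteq> sets borel" by simp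
  qed
qed

context lipschitz_diffusion
begin

definition dyadic_path :: "real \<Rightarrow> real \<Rightarrow> 'w \<Rightarrow> nat \<times> nat \<Rightarrow> real" where
  "dyadic_path x s \<omega> p = X x (s + dyadic p) \<omega>"

lemma dyadic_path_measurable:
  assumes "x \<in> \<X>" "0 \<le> s" shows "dyadic_path x s \<in> borel_measurable M"
  unfolding dyadic_path_def
  by (rule measurable_coordinatewise_then_product) (rule X_measurable_M[OF assms(1)], use assms(2) in simp)

definition path_law :: "real \<Rightarrow> (nat \<times> nat \<Rightarrow> real) measure" where
  "path_law y = distr M borel (dyadic_path y 0)"

lemma emeasure_dyadic_path_cylinder:
  assumes "x \<in> \<X>" "0 \<le> s" "\<And>p. open (A p)" "finite {p. A p \<noteq> UNIV}"
  shows "emeasure (distr M borel (dyadic_path x s)) (Pi\<^sub>E UNIV A)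
    = (\<integral>\<^sup>+\<omega>. (\<Prod>p\<in>{p. A p \<noteq> UNIV}. indicator (A p) (X x (s + dyadic p) \<omega>)) \<partial>M)"
proof -
  have B: "Pi\<^sub>E UNIV A \<in> sets borel" using open_PiE[OF assms(3,4)] by simp
  have "emeasure (distr M borel (dyadic_path x s)) (Pi\<^sub>E UNIV A)
     = (\<integral>\<^sup>+\<omega>. indicator (Pi\<^sub>E UNIV A) (dyadic_path x s \<omega>) \<partial>M)"
    using nn_integral_distr[OF dyadic_path_measurable[OF assms(1,2)], of "indicator (Pi\<^sub>E UNIV A)"] B
    by (simp add: nn_integral_indicator)
  also have "\<dots> = (\<integral>\<^sup>+\<omega>. (\<Prod>p\<in>{p. A p \<noteq> UNIV}. indicator (A p) (X x (s + dyadic p) \<omega>)) \<partial>M)"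
  proof (rule nn_integral_cong)
    fix \<omega>
    show "indicator (Pi\<^sub>E UNIV A) (dyadic_path x s \<omega>)
        = (\<Prod>p\<in>{p. A p \<noteq> UNIV}. indicator (A p) (X x (s + dyadic p) \<omega>) :: ennreal)"
    proof (cases "\<forall>p. X x (s + dyadic p) \<omega> \<in> A p")
      case True
      have "(\<Prod>p\<in>{p. A p \<noteq> UNIV}. indicator (A p) (X x (s + dyadic p) \<omega>) :: ennreal) = 1"
        by (rule prod.neutral) (simp only: True indicator_simps, simp)
      moreover have "dyadic_path x s \<omega> \<in> Pi\<^sub>E UNIV A" using True by (simp only: dyadic_path_def PiE_UNIV_domain Pi_iff, simp)
      ultimately show ?thesis by simp
    next
      case False
      then obtain p where p: "X x (s + dyadic p) \<omega> \<notin> A p" by auto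
      then have "(\<Prod>p\<in>{p. A p \<noteq> UNIV}. indicator (A p) (X x (s + dyadic p) \<omega>) :: ennreal) = 0"
        using assms(4) by (intro prod_zero bexI[of _ p]) auto
      moreover have "dyadic_path x s \<omega> \<notin> Pi\<^sub>E UNIV A"
        using p PiE_mem[of "dyadic_path x s \<omega>" UNIV A p] unfolding dyadic_path_def by blast
      ultimately show ?thesis by simp
    qed
  qed
  finally show ?thesis .
qed

text \<open>Finitely many dyadic times and the dyadic starting time have a common mesh.\<close>

lemma markov_dyadic_cylinder:
  assumes A: "\<And>p. open (A p)" "finite {p. A p \<noteq> UNIV}"
  shows "(\<lambda>y. emeasure (path_law y) (Pi\<^sub>E UNIV A)) \<in> borel_measurable (restrict_space borel \<X>)"
    and "x \<in> \<X> \<Longrightarrow> emeasure (distr M borel (dyadic_path x (dyadic q))) (Pi\<^sub>E UNIV A)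
      = (\<integral>\<^sup>+\<omega>. emeasure (path_law (X x (dyadic q) \<omega>)) (Pi\<^sub>E UNIV A) \<partial>M)"
proof -
  let ?P = "{p. A p \<noteq> UNIV}"
  define r where "r = Max (insert (fst q) (fst ` ?P))"
  define n where "n p = snd p * 2 ^ (r - fst p)" for p :: "nat \<times> nat"
  have le: "fst p \<le> r" if "p \<in> insert q ?P" for p using A(2) that by (auto simp: r_def intro!: Max_ge)
  have n: "dyadic p = real (n p) / 2 ^ r" if "p \<in> insert q ?P" for p
  proof -
    have "(2::real) ^ r = 2 ^ (r - fst p) * 2 ^ fst p"
      using le[OF that] by (simp flip: power_add)
    then show ?thesis by (simp add: n_def)
  qed
  define U where "U y = (\<integral>\<^sup>+\<omega>. (\<Prod>p\<in>?P. indicator (A p) (X y (real (n p) / 2 ^ r) \<omega>)) \<partial>M)" for y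
  have Um: "U \<in> borel_measurable (restrict_space borel \<X>)"
    unfolding U_def by (rule markov_open_cylinder(1)) (use A in auto)
  have UP: "emeasure (path_law y) (Pi\<^sub>E UNIV A) = U y" if "y \<in> \<X>" for y
    unfolding path_law_def emeasure_dyadic_path_cylinder[OF that order_refl A] U_def
    using n by (intro nn_integral_cong prod.cong) auto
  show "(\<lambda>y. emeasure (path_law y) (Pi\<^sub>E UNIV A)) \<in> borel_measurable (restrict_space borel \<X>)"
    using Um by (rule measurable_cong[THEN iffD1, rotated]) (simp add: UP space_restrict_space)
  assume x: "x \<in> \<X>"
  have "emeasure (distr M borel (dyadic_path x (dyadic q))) (Pi\<^sub>E UNIV A)
     = (\<integral>\<^sup>+\<omega>. (\<Prod>p\<in>?P. indicator (A p) (X x (real (n q + n p) / 2 ^ r) \<omega>)) \<partial>M)"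
    unfolding emeasure_dyadic_path_cylinder[OF x _ A, of "dyadic q", simplified]
    using n by (intro nn_integral_cong prod.cong) (auto simp: add_divide_distrib)
  also have "\<dots> = (\<integral>\<^sup>+\<omega>. U (X x (real (n q) / 2 ^ r) \<omega>) \<partial>M)"
    unfolding U_def by (rule markov_open_cylinder(2)) (use A x in auto)
  also have "\<dots> = (\<integral>\<^sup>+\<omega>. emeasure (path_law (X x (dyadic q) \<omega>)) (Pi\<^sub>E UNIV A) \<partial>M)"
    using n[of q] X_paths(3)[OF x, of _ "dyadic q"] by (intro nn_integral_cong) (simp add: UP)
  finally show "emeasure (distr M borel (dyadic_path x (dyadic q))) (Pi\<^sub>E UNIV A)
      = (\<integral>\<^sup>+\<omega>. emeasure (path_law (X x (dyadic q) \<omega>)) (Pi\<^sub>E UNIV A) \<partial>M)" .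
qed

lemma path_law_measurable: "path_law \<in> measurable (restrict_space borel \<X>) (prob_algebra borel)"
proof (rule measurable_prob_algebra_generated[OF open_cylinders(3,1,2)])
  fix y assume "y \<in> space (restrict_space borel \<X>)"
  then have "y \<in> \<X>" by (simp add: space_restrict_space)
  then show "prob_space (path_law y)"
    unfolding path_law_def by (intro prob_space_distr dyadic_path_measurable) auto
next
  fix a :: "(nat \<times> nat \<Rightarrow> real) set" assume "a \<in> open_cylinders"
  then obtain A where "a = Pi\<^sub>E UNIV A" "\<And>p. open (A p)" "finite {p. A p \<noteq> UNIV}"
    unfolding open_cylinders_def by blast
  then show "(\<lambda>y. emeasure (path_law y) a) \<in> borel_measurable (restrict_space borel \<X>)"
    using markov_dyadic_cylinder(1) by simp
qed (simp add: path_law_def)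

text \<open>The law of the path after time \<open>s\<close> and the mixture of the laws \<open>path_law (X x s)\<close> agree on open
  cylinders, hence on all Borel sets of paths.\<close>

lemma markov_property:
  assumes x: "x \<in> \<X>" and \<Psi>: "\<Psi> \<in> borel_measurable borel"
  shows "(\<integral>\<^sup>+\<omega>. \<Psi> (dyadic_path x (dyadic q) \<omega>) \<partial>M)
    = (\<integral>\<^sup>+\<omega>. (\<integral>\<^sup>+\<omega>'. \<Psi> (dyadic_path (X x (dyadic q) \<omega>) 0 \<omega>') \<partial>M) \<partial>M)"
proof -
  let ?R = "restrict_space borel \<X>"
  let ?D = "distr M ?R (X x (dyadic q))"
  have Xm: "X x (dyadic q) \<in> measurable M ?R" by (rule X_restrict_measurable[OF x]) simp
  have ne: "space ?D \<noteq> {}" using x by (auto simp: space_restrict_space)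
  have Km: "path_law \<in> measurable ?D (subprob_algebra borel)"
    using path_law_measurable by (simp add: measurable_prob_algebraD)
  have Km': "path_law \<in> measurable ?R (subprob_algebra borel)"
    using path_law_measurable by (rule measurable_prob_algebraD)
  have emm: "(\<lambda>y. emeasure (path_law y) a) \<in> borel_measurable ?R" if "a \<in> sets borel" for a
    using measurable_emeasure_kernel[OF Km' that] .
  have "distr M borel (dyadic_path x (dyadic q)) = ?D \<bind> path_law"
  proof (rule measure_eqI_generator_eq[OF open_cylinders(1,2)])
    fix a :: "(nat \<times> nat \<Rightarrow> real) set" assume a: "a \<in> open_cylinders"
    then obtain A where A: "a = Pi\<^sub>E UNIV A" "\<And>p. open (A p)" "finite {p. A p \<noteq> UNIV}"
      unfolding open_cylinders_def by blast
    have ab: "a \<in> sets borel" using a by (simp add: open_cylinders(3))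
    have "emeasure (?D \<bind> path_law) a = (\<integral>\<^sup>+y. emeasure (path_law y) a \<partial>?D)"
      by (rule emeasure_bind[OF ne Km ab])
    also have "\<dots> = (\<integral>\<^sup>+\<omega>. emeasure (path_law (X x (dyadic q) \<omega>)) a \<partial>M)"
      by (rule nn_integral_distr[OF Xm]) (use emm[OF ab] in simp)
    finally show "emeasure (distr M borel (dyadic_path x (dyadic q))) a = emeasure (?D \<bind> path_law) a"
      using markov_dyadic_cylinder(2)[OF A(2,3) x, of q] A(1) by simp
  next
    show "sets (distr M borel (dyadic_path x (dyadic q))) = sigma_sets UNIV open_cylinders"
      by (simp add: open_cylinders(3))
    have "sets (?D \<bind> path_law) = sets borel" by (rule sets_bind[OF _ ne]) (simp add: path_law_def)
    then show "sets (?D \<bind> path_law) = sigma_sets UNIV open_cylinders" by (simp add: open_cylinders(3))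
    interpret D: prob_space "distr M borel (dyadic_path x (dyadic q))"
      by (rule prob_space_distr) (rule dyadic_path_measurable[OF x], simp)
    show "emeasure (distr M borel (dyadic_path x (dyadic q))) UNIV \<noteq> \<infinity>" for i :: nat
      using D.emeasure_space_1 by simp
  qed (use open_cylinders(4) in auto)
  then have "(\<integral>\<^sup>+w. \<Psi> w \<partial>distr M borel (dyadic_path x (dyadic q))) = (\<integral>\<^sup>+w. \<Psi> w \<partial>(?D \<bind> path_law))"
    by simp
  also have "\<dots> = (\<integral>\<^sup>+y. (\<integral>\<^sup>+w. \<Psi> w \<partial>path_law y) \<partial>?D)" by (rule nn_integral_bind[OF \<Psi> Km])
  also have "\<dots> = (\<integral>\<^sup>+\<omega>. (\<integral>\<^sup>+w. \<Psi> w \<partial>path_law (X x (dyadic q) \<omega>)) \<partial>M)"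
    by (rule nn_integral_distr[OF Xm])
       (use measurable_compose[OF Km' nn_integral_measurable_subprob_algebra[OF \<Psi>]] in simp)
  also have "\<dots> = (\<integral>\<^sup>+\<omega>. (\<integral>\<^sup>+\<omega>'. \<Psi> (dyadic_path (X x (dyadic q) \<omega>) 0 \<omega>') \<partial>M) \<partial>M)"
    unfolding path_law_def using X_paths(3)[OF x] \<Psi>
    by (intro nn_integral_cong nn_integral_distr dyadic_path_measurable) auto
  also have "(\<integral>\<^sup>+w. \<Psi> w \<partial>distr M borel (dyadic_path x (dyadic q))) = (\<integral>\<^sup>+\<omega>. \<Psi> (dyadic_path x (dyadic q) \<omega>) \<partial>M)"
    by (rule nn_integral_distr) (use \<Psi> dyadic_path_measurable[OF x] in auto)
  finally show ?thesis .
qed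

end

section \<open>Small-time moments\<close>

lemma young_square:
  fixes a b c :: real assumes "0 < c"
  shows "(a + b)\<^sup>2 \<le> (1 + c) * a\<^sup>2 + (1 + 1 / c) * b\<^sup>2"
proof -
  have "0 \<le> (c * a - b)\<^sup>2 / c" using assms by simp
  also have "\<dots> = c * a\<^sup>2 - 2 * a * b + b\<^sup>2 / c"
    using assms by (simp add: power2_eq_square field_simps)
  finally show ?thesis by (simp add: power2_eq_square algebra_simps)
qed

context lipschitz_diffusion
begin

lemma euler_increment_nn_integral:
  assumes Z: "Z \<in> borel_measurable (F (real k / 2 ^ m))"
    and A: "A \<in> borel_measurable (F (real (k + i) / 2 ^ m))" and h: "h \<in> borel_measurable borel"
  shows "(\<integral>\<^sup>+\<omega>. ennreal ((A \<omega> + \<mu> (euler m k Z i \<omega>) / 2 ^ m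
       + h (euler m k Z i \<omega>) * (W (real (Suc (k + i)) / 2 ^ m) \<omega> - W (real (k + i) / 2 ^ m) \<omega>))\<^sup>2) \<partial>M)
    = (\<integral>\<^sup>+\<omega>. ennreal ((A \<omega> + \<mu> (euler m k Z i \<omega>) / 2 ^ m)\<^sup>2 + (h (euler m k Z i \<omega>))\<^sup>2 / 2 ^ m) \<partial>M)"
proof -
  have t: "0 \<le> real (k + i) / 2 ^ m" "real (k + i) / 2 ^ m < real (Suc (k + i)) / 2 ^ m"
    "real (Suc (k + i)) / 2 ^ m - real (k + i) / 2 ^ m = 1 / 2 ^ m" by (auto simp: field_simps)
  have E: "euler m k Z i \<in> borel_measurable (F (real (k + i) / 2 ^ m))" by (rule euler_measurable[OF Z order_refl])
  have 1: "(\<lambda>\<omega>. A \<omega> + \<mu> (euler m k Z i \<omega>) / 2 ^ m) \<in> borel_measurable (F (real (k + i) / 2 ^ m))"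
    using A measurable_compose[OF E coefficients_measurable(1)] by simp
  have 2: "(\<lambda>\<omega>. h (euler m k Z i \<omega>)) \<in> borel_measurable (F (real (k + i) / 2 ^ m))"
    by (rule measurable_compose[OF E h])
  show ?thesis using nn_integral_increment_square[OF t(1,2) 1 2] t(3) by simp
qed

text \<open>Two recursions with constants that do not depend on the mesh: first \<open>E (E\<^sub>i - x)\<^sup>2 = O(t)\<close> for all \<open>i \<le> n\<close>,
  then the remainder after subtracting the Gaussian leading term, whose volatility \<open>\<sigma> (E\<^sub>i) - \<sigma> x\<close> has second
  moment \<open>O(t)\<close> by the first bound.\<close>

lemma euler_small_time_moments:
  fixes x K :: real and m n :: nat
  defines "\<Delta> \<equiv> 1 / (2::real) ^ m" and "t \<equiv> real n / 2 ^ m"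
  assumes K: "\<bar>\<mu> x\<bar> \<le> K" "\<bar>\<sigma> x\<bar> \<le> K" and n: "0 < n" and t1: "t \<le> 1"
    and Z: "Z \<in> borel_measurable (F 0)" "\<And>\<omega>. \<omega> \<in> space M \<Longrightarrow> Z \<omega> = x"
  defines "C \<equiv> 1 + 6 * L\<^sup>2 + 6 * K\<^sup>2"
  defines "c \<equiv> 4 * K\<^sup>2 + 5 * L\<^sup>2 * (C * exp C)"
  shows "(\<integral>\<^sup>+\<omega>. ennreal ((euler m 0 Z n \<omega> - x - \<sigma> x * (W t \<omega> - W 0 \<omega>))\<^sup>2) \<partial>M) \<le> ennreal (exp 1 * c * t\<^sup>2)"
proof -
  let ?E = "euler m 0 Z"
  let ?w = "\<lambda>i \<omega>. W (real (Suc (0 + i)) / 2 ^ m) \<omega> - W (real (0 + i) / 2 ^ m) \<omega>"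
  have Z0: "Z \<in> borel_measurable (F (real 0 / 2 ^ m))" using Z by simp
  have Em: "?E i \<in> borel_measurable (F (real (0 + i) / 2 ^ m))" for i by (rule euler_measurable[OF Z0 order_refl])
  have EM: "?E i \<in> borel_measurable M" for i by (rule euler_measurable_M[OF Z0])
  have \<Delta>: "0 < \<Delta>" "\<Delta> \<le> 1" by (auto simp: \<Delta>_def)
  have t0: "0 < t" using n by (simp add: t_def)
  have \<Delta>t: "\<Delta> \<le> t" using n by (simp add: \<Delta>_def t_def divide_right_mono)
  have K0: "0 \<le> K" using K by linarith
  have C: "1 \<le> C" by (simp add: C_def)
  have c: "0 \<le> c" using C by (simp add: c_def)
  have grow: "(\<mu> y)\<^sup>2 \<le> 2 * K\<^sup>2 + 2 * L\<^sup>2 * (y - x)\<^sup>2" "(\<sigma> y)\<^sup>2 \<le> 2 * K\<^sup>2 + 2 * L\<^sup>2 * (y - x)\<^sup>2" for y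
  proof -
    have sq: "h\<^sup>2 \<le> 2 * K\<^sup>2 + 2 * L\<^sup>2 * (y - x)\<^sup>2" if "\<bar>h\<bar> \<le> K + L * \<bar>y - x\<bar>" for h
    proof -
      have "h\<^sup>2 \<le> (K + L * \<bar>y - x\<bar>)\<^sup>2" using power_mono[OF that, of 2] by simp
      also have "\<dots> \<le> 2 * K\<^sup>2 + 2 * (L * \<bar>y - x\<bar>)\<^sup>2"
        using young_square[of 1 K "L * \<bar>y - x\<bar>"] by simp
      finally show ?thesis by (simp add: power_mult_distrib)
    qed
    show "(\<mu> y)\<^sup>2 \<le> 2 * K\<^sup>2 + 2 * L\<^sup>2 * (y - x)\<^sup>2" "(\<sigma> y)\<^sup>2 \<le> 2 * K\<^sup>2 + 2 * L\<^sup>2 * (y - x)\<^sup>2"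
      using \<mu>_lip[of y x] \<sigma>_lip[of y x] K by (auto intro!: sq)
  qed
  have v: "(\<integral>\<^sup>+\<omega>. ennreal ((?E i \<omega> - x)\<^sup>2) \<partial>M) \<le> ennreal ((1 + C * \<Delta>) ^ i - 1)" for i
  proof (induction i)
    case 0
    have "(\<integral>\<^sup>+\<omega>. ennreal ((?E 0 \<omega> - x)\<^sup>2) \<partial>M) = (\<integral>\<^sup>+\<omega>. 0 \<partial>M)"
      using Z by (intro nn_integral_cong) simp
    then show ?case by simp
  next
    case (Suc i)
    have [measurable]: "?E i \<in> borel_measurable M" by (rule EM)
    have pow: "1 \<le> (1 + C * \<Delta>) ^ i" using C \<Delta> by (intro one_le_power) simp
    have "(\<integral>\<^sup>+\<omega>. ennreal ((?E (Suc i) \<omega> - x)\<^sup>2) \<partial>M)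
        = (\<integral>\<^sup>+\<omega>. ennreal (((?E i \<omega> - x) + \<mu> (?E i \<omega>) / 2 ^ m)\<^sup>2 + (\<sigma> (?E i \<omega>))\<^sup>2 / 2 ^ m) \<partial>M)"
      using euler_increment_nn_integral[OF Z0, of "\<lambda>\<omega>. ?E i \<omega> - x" i \<sigma>] Em[of i]
      by (simp add: algebra_simps)
    also have "\<dots> \<le> (\<integral>\<^sup>+\<omega>. ennreal (1 + C * \<Delta>) * ennreal ((?E i \<omega> - x)\<^sup>2) + ennreal (C * \<Delta>) \<partial>M)"
    proof (rule nn_integral_mono)
      fix \<omega>
      let ?y = "?E i \<omega>"
      have "((?y - x) + \<mu> ?y * \<Delta>)\<^sup>2 \<le> (1 + \<Delta>) * (?y - x)\<^sup>2 + (1 + 1 / \<Delta>) * (\<mu> ?y * \<Delta>)\<^sup>2"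
        by (rule young_square[OF \<Delta>(1)])
      also have "(1 + 1 / \<Delta>) * (\<mu> ?y * \<Delta>)\<^sup>2 = (\<Delta> + 1) * \<Delta> * (\<mu> ?y)\<^sup>2"
        using \<Delta> by (simp add: power2_eq_square field_simps)
      also have "\<dots> \<le> 2 * \<Delta> * (\<mu> ?y)\<^sup>2" using \<Delta> by (intro mult_right_mono) auto
      also have "\<dots> \<le> 2 * \<Delta> * (2 * K\<^sup>2 + 2 * L\<^sup>2 * (?y - x)\<^sup>2)"
        using grow \<Delta> by (intro mult_left_mono) auto
      finally have 1: "((?y - x) + \<mu> ?y * \<Delta>)\<^sup>2 \<le> (1 + \<Delta>) * (?y - x)\<^sup>2 + 2 * \<Delta> * (2 * K\<^sup>2 + 2 * L\<^sup>2 * (?y - x)\<^sup>2)"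
        by simp
      have 2: "(\<sigma> ?y)\<^sup>2 * \<Delta> \<le> (2 * K\<^sup>2 + 2 * L\<^sup>2 * (?y - x)\<^sup>2) * \<Delta>"
        using grow \<Delta> by (intro mult_right_mono) auto
      have "((?y - x) + \<mu> ?y * \<Delta>)\<^sup>2 + (\<sigma> ?y)\<^sup>2 * \<Delta>
         \<le> (1 + (1 + 6 * L\<^sup>2) * \<Delta>) * (?y - x)\<^sup>2 + 6 * K\<^sup>2 * \<Delta>"
        using 1 2 by (simp add: algebra_simps)
      also have "\<dots> \<le> (1 + C * \<Delta>) * (?y - x)\<^sup>2 + C * \<Delta>"
        using \<Delta> by (intro add_mono mult_right_mono) (auto simp: C_def)
      finally have "ennreal (((?y - x) + \<mu> ?y / 2 ^ m)\<^sup>2 + (\<sigma> ?y)\<^sup>2 / 2 ^ m) \<le> ennreal ((1 + C * \<Delta>) * (?y - x)\<^sup>2 + C * \<Delta>)"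
        by (intro ennreal_leI) (simp add: \<Delta>_def)
      also have "\<dots> = ennreal (1 + C * \<Delta>) * ennreal ((?y - x)\<^sup>2) + ennreal (C * \<Delta>)"
        using C \<Delta> by (subst ennreal_plus) (auto simp: ennreal_mult)
      finally show "ennreal (((?y - x) + \<mu> ?y / 2 ^ m)\<^sup>2 + (\<sigma> ?y)\<^sup>2 / 2 ^ m) \<le> \<dots>" .
    qed
    also have "\<dots> = ennreal (1 + C * \<Delta>) * (\<integral>\<^sup>+\<omega>. ennreal ((?E i \<omega> - x)\<^sup>2) \<partial>M) + ennreal (C * \<Delta>)"
      by (simp add: nn_integral_add nn_integral_cmult emeasure_space_1)
    also have "\<dots> \<le> ennreal (1 + C * \<Delta>) * ennreal ((1 + C * \<Delta>) ^ i - 1) + ennreal (C * \<Delta>)"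
      by (intro add_right_mono mult_left_mono Suc) simp
    also have "\<dots> = ennreal ((1 + C * \<Delta>) * ((1 + C * \<Delta>) ^ i - 1) + C * \<Delta>)"
      using C \<Delta> pow by (subst ennreal_plus) (auto simp: ennreal_mult)
    also have "(1 + C * \<Delta>) * ((1 + C * \<Delta>) ^ i - 1) + C * \<Delta> = (1 + C * \<Delta>) ^ Suc i - 1"
      by (simp add: algebra_simps)
    finally show ?case .
  qed
  have v': "(\<integral>\<^sup>+\<omega>. ennreal ((?E i \<omega> - x)\<^sup>2) \<partial>M) \<le> ennreal (C * exp C * t)" if "i \<le> n" for i
  proof -
    have it: "real i * \<Delta> \<le> t" using that by (simp add: \<Delta>_def t_def divide_right_mono)
    have "(1 + C * \<Delta>) ^ i \<le> exp (C * \<Delta>) ^ i"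
      using C \<Delta> by (intro power_mono exp_ge_add_one_self) simp
    also have "\<dots> = exp (C * (real i * \<Delta>))" by (simp add: exp_of_nat_mult[symmetric] ac_simps)
    also have "\<dots> \<le> exp (C * t)" using it C by simp
    also have "exp (C * t) \<le> 1 + C * t * exp (C * t)"
      using exp_ge_add_one_self[of "- (C * t)"] mult_right_mono[of "1 - C * t" "exp (- (C * t))" "exp (C * t)"]
      by (simp add: algebra_simps mult_exp_exp)
    also have "\<dots> \<le> 1 + C * t * exp C"
      using C t0 t1 by (intro add_left_mono mult_left_mono) (auto simp: mult_left_le)
    finally have "(1 + C * \<Delta>) ^ i - 1 \<le> C * exp C * t" by (simp add: ac_simps)
    then show ?thesis using v[of i] by (meson ennreal_leI order_trans)
  qed
  define D where "D i \<omega> = ?E i \<omega> - x - \<sigma> x * (W (real i / 2 ^ m) \<omega> - W 0 \<omega>)" for i \<omega>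
  define q where "q = 1 + \<Delta> / t"
  have q: "1 \<le> q" using \<Delta> t0 by (simp add: q_def)
  have Dm: "D i \<in> borel_measurable (F (real (0 + i) / 2 ^ m))" for i
  proof -
    have "W (real i / 2 ^ m) \<in> borel_measurable (F (real (0 + i) / 2 ^ m))"
      "W 0 \<in> borel_measurable (F (real (0 + i) / 2 ^ m))" by (auto intro!: W_measurable)
    then show ?thesis unfolding D_def using Em[of i] by (intro borel_measurable_diff borel_measurable_times) auto
  qed
  have w: "i \<le> n \<Longrightarrow> (\<integral>\<^sup>+\<omega>. ennreal ((D i \<omega>)\<^sup>2) \<partial>M) \<le> ennreal (c * t\<^sup>2 * (q ^ i - 1))" for i
  proof (induction i)
    case 0
    have "(\<integral>\<^sup>+\<omega>. ennreal ((D 0 \<omega>)\<^sup>2) \<partial>M) = (\<integral>\<^sup>+\<omega>. 0 \<partial>M)"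
      using Z by (intro nn_integral_cong) (simp add: D_def)
    then show ?case by simp
  next
    case (Suc i)
    have [measurable]: "?E i \<in> borel_measurable M" by (rule EM)
    have [measurable]: "D i \<in> borel_measurable M" using measurable_F_M[OF Dm] by simp
    have pow: "1 \<le> q ^ i" using q by (rule one_le_power)
    define B where "B = 5 * L\<^sup>2 * \<Delta>"
    have B: "0 \<le> B" using \<Delta> by (simp add: B_def)
    have "(\<integral>\<^sup>+\<omega>. ennreal ((D (Suc i) \<omega>)\<^sup>2) \<partial>M)
        = (\<integral>\<^sup>+\<omega>. ennreal ((D i \<omega> + \<mu> (?E i \<omega>) / 2 ^ m)\<^sup>2 + (\<sigma> (?E i \<omega>) - \<sigma> x)\<^sup>2 / 2 ^ m) \<partial>M)"
      using euler_increment_nn_integral[OF Z0 Dm, of "\<lambda>y. \<sigma> y - \<sigma> x"]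
      by (simp add: D_def algebra_simps)
    also have "\<dots> \<le> (\<integral>\<^sup>+\<omega>. (ennreal q * ennreal ((D i \<omega>)\<^sup>2) + ennreal B * ennreal ((?E i \<omega> - x)\<^sup>2)) + ennreal (4 * K\<^sup>2 * (t * \<Delta>)) \<partial>M)"
    proof (rule nn_integral_mono)
      fix \<omega>
      let ?y = "?E i \<omega>"
      \<comment> \<open>The weight \<open>\<Delta> / t\<close> makes the \<open>n\<close> steps multiply up to at most \<open>e\<close>, and leaves a drift term of size \<open>t * \<Delta>\<close> per step.\<close>
      have "(D i \<omega> + \<mu> ?y * \<Delta>)\<^sup>2 \<le> (1 + \<Delta> / t) * (D i \<omega>)\<^sup>2 + (1 + 1 / (\<Delta> / t)) * (\<mu> ?y * \<Delta>)\<^sup>2"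
        by (rule young_square) (use \<Delta> t0 in simp)
      also have "(1 + 1 / (\<Delta> / t)) * (\<mu> ?y * \<Delta>)\<^sup>2 = (\<Delta> + t) * \<Delta> * (\<mu> ?y)\<^sup>2"
        using \<Delta> t0 by (simp add: power2_eq_square field_simps)
      also have "\<dots> \<le> 2 * t * \<Delta> * (\<mu> ?y)\<^sup>2" using \<Delta> \<Delta>t by (intro mult_right_mono) auto
      also have "\<dots> \<le> 2 * t * \<Delta> * (2 * K\<^sup>2 + 2 * L\<^sup>2 * (?y - x)\<^sup>2)"
        using grow \<Delta> t0 by (intro mult_left_mono) auto
      also have "\<dots> = 4 * K\<^sup>2 * (t * \<Delta>) + t * (4 * L\<^sup>2 * \<Delta> * (?y - x)\<^sup>2)" by (simp add: algebra_simps)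
      also have "\<dots> \<le> 4 * K\<^sup>2 * (t * \<Delta>) + 1 * (4 * L\<^sup>2 * \<Delta> * (?y - x)\<^sup>2)"
        using t1 \<Delta> by (intro add_left_mono mult_right_mono) auto
      finally have 1: "(D i \<omega> + \<mu> ?y * \<Delta>)\<^sup>2 \<le> q * (D i \<omega>)\<^sup>2 + (4 * K\<^sup>2 * (t * \<Delta>) + 4 * L\<^sup>2 * \<Delta> * (?y - x)\<^sup>2)"
        by (simp add: q_def)
      have "(\<sigma> ?y - \<sigma> x)\<^sup>2 \<le> L\<^sup>2 * (?y - x)\<^sup>2"
        using power_mono[OF \<sigma>_lip[of ?y x], of 2] by (simp add: power_mult_distrib)
      then have "(\<sigma> ?y - \<sigma> x)\<^sup>2 * \<Delta> \<le> L\<^sup>2 * (?y - x)\<^sup>2 * \<Delta>" using \<Delta> by (intro mult_right_mono) auto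
      with 1 have "(D i \<omega> + \<mu> ?y * \<Delta>)\<^sup>2 + (\<sigma> ?y - \<sigma> x)\<^sup>2 * \<Delta> \<le> (q * (D i \<omega>)\<^sup>2 + B * (?y - x)\<^sup>2) + 4 * K\<^sup>2 * (t * \<Delta>)"
        by (simp add: B_def algebra_simps)
      then have "ennreal ((D i \<omega> + \<mu> ?y / 2 ^ m)\<^sup>2 + (\<sigma> ?y - \<sigma> x)\<^sup>2 / 2 ^ m) \<le> ennreal ((q * (D i \<omega>)\<^sup>2 + B * (?y - x)\<^sup>2) + 4 * K\<^sup>2 * (t * \<Delta>))"
        by (intro ennreal_leI) (simp add: \<Delta>_def)
      also have "\<dots> = (ennreal q * ennreal ((D i \<omega>)\<^sup>2) + ennreal B * ennreal ((?y - x)\<^sup>2)) + ennreal (4 * K\<^sup>2 * (t * \<Delta>))"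
        using q B t0 \<Delta> by (simp add: ennreal_plus ennreal_mult)
      finally show "ennreal ((D i \<omega> + \<mu> ?y / 2 ^ m)\<^sup>2 + (\<sigma> ?y - \<sigma> x)\<^sup>2 / 2 ^ m) \<le> \<dots>" .
    qed
    also have "\<dots> = (ennreal q * (\<integral>\<^sup>+\<omega>. ennreal ((D i \<omega>)\<^sup>2) \<partial>M) + ennreal B * (\<integral>\<^sup>+\<omega>. ennreal ((?E i \<omega> - x)\<^sup>2) \<partial>M))
        + ennreal (4 * K\<^sup>2 * (t * \<Delta>))"
      by (simp add: nn_integral_add nn_integral_cmult emeasure_space_1)
    also have "\<dots> \<le> (ennreal q * ennreal (c * t\<^sup>2 * (q ^ i - 1)) + ennreal B * ennreal (C * exp C * t)) + ennreal (4 * K\<^sup>2 * (t * \<Delta>))"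
      using Suc v'[of i] by (intro add_mono mult_left_mono) auto
    also have "\<dots> = ennreal ((q * (c * t\<^sup>2 * (q ^ i - 1)) + B * (C * exp C * t)) + 4 * K\<^sup>2 * (t * \<Delta>))"
      using q B C c t0 \<Delta> pow by (simp add: ennreal_plus ennreal_mult)
    also have "(q * (c * t\<^sup>2 * (q ^ i - 1)) + B * (C * exp C * t)) + 4 * K\<^sup>2 * (t * \<Delta>) = q * (c * t\<^sup>2 * (q ^ i - 1)) + c * (t * \<Delta>)"
      by (simp add: B_def c_def algebra_simps)
    also have "\<dots> = c * t\<^sup>2 * (q ^ Suc i - 1)"
      using t0 by (simp add: q_def power2_eq_square field_simps)
    finally show ?case .
  qed
  have "q ^ n \<le> exp (\<Delta> / t) ^ n" using q unfolding q_def by (intro power_mono exp_ge_add_one_self) simp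
  also have "\<dots> = exp (real n * (\<Delta> / t))" by (simp add: exp_of_nat_mult[symmetric])
  also have "real n * (\<Delta> / t) = 1" using n by (simp add: \<Delta>_def t_def)
  finally have "q ^ n - 1 \<le> exp 1" by simp
  then have "c * t\<^sup>2 * (q ^ n - 1) \<le> c * t\<^sup>2 * exp 1" using c by (intro mult_left_mono) auto
  then have "(\<integral>\<^sup>+\<omega>. ennreal ((D n \<omega>)\<^sup>2) \<partial>M) \<le> ennreal (c * t\<^sup>2 * exp 1)"
    using w[OF order_refl] by (meson ennreal_leI order_trans)
  then show ?thesis unfolding D_def t_def by (simp add: ac_simps)
qed

text \<open>The bound for the Euler scheme passes to its limit in probability: it is first transferred to the
  square truncated at \<open>N\<close>, and then Fatou's lemma removes the truncation.\<close>

lemma small_time_remainder: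
  assumes x: "x \<in> \<X>"
  obtains C where "0 \<le> C" "\<And>r. (\<integral>\<^sup>+\<omega>. ennreal ((X x (1 / 2 ^ r) \<omega> - x - \<sigma> x * (W (1 / 2 ^ r) \<omega> - W 0 \<omega>))\<^sup>2) \<partial>M)
     \<le> ennreal (C * (1 / 2 ^ r)\<^sup>2)"
proof -
  define K where "K = max \<bar>\<mu> x\<bar> \<bar>\<sigma> x\<bar>"
  define C1 where "C1 = 1 + 6 * L\<^sup>2 + 6 * K\<^sup>2"
  define c where "c = exp 1 * (4 * K\<^sup>2 + 5 * L\<^sup>2 * (C1 * exp C1))"
  have c0: "0 \<le> c" unfolding c_def C1_def by (intro mult_nonneg_nonneg add_nonneg_nonneg) auto
  have "(\<integral>\<^sup>+\<omega>. ennreal ((X x (1 / 2 ^ r) \<omega> - x - \<sigma> x * (W (1 / 2 ^ r) \<omega> - W 0 \<omega>))\<^sup>2) \<partial>M) \<le> ennreal (2 * c * (1 / 2 ^ r)\<^sup>2)" for r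
  proof -
    let ?t = "1 / (2::real) ^ r"
    define R where "R \<omega> = X x ?t \<omega> - x - \<sigma> x * (W ?t \<omega> - W 0 \<omega>)" for \<omega>
    define E where "E l = euler (r + l) (0 * 2 ^ l) (X x (real 0 / 2 ^ r)) (1 * 2 ^ l)" for l
    define S where "S l \<omega> = E l \<omega> - x - \<sigma> x * (W ?t \<omega> - W 0 \<omega>)" for l \<omega>
    have Z: "X x (real 0 / 2 ^ r) \<in> borel_measurable (F 0)" by (rule X_measurable[OF x]) auto
    have [measurable]: "X x ?t \<in> borel_measurable M" "W ?t \<in> borel_measurable M" "W 0 \<in> borel_measurable M"
      using X_measurable_M[OF x] W_measurable_M by auto
    have Em[measurable]: "E l \<in> borel_measurable M" for l
      unfolding E_def by (rule euler_measurable_M) (use Z in simp)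
    have Rm[measurable]: "R \<in> borel_measurable M" unfolding R_def by measurable
    have Sm[measurable]: "S l \<in> borel_measurable M" for l unfolding S_def by measurable
    have Sb: "(\<integral>\<^sup>+\<omega>. ennreal ((S l \<omega>)\<^sup>2) \<partial>M) \<le> ennreal (c * ?t\<^sup>2)" for l
    proof -
      have tt: "real (2 ^ l) / 2 ^ (r + l) = ?t" by (simp add: power_add)
      show ?thesis
        using euler_small_time_moments[of x K "2 ^ l" "r + l" "X x (real 0 / 2 ^ r)"] Z X_paths(1)[OF x]
        unfolding tt S_def E_def c_def C1_def by (simp add: K_def)
    qed
    have conv: "(\<lambda>l. prob {\<omega>\<in>space M. b < \<bar>E l \<omega> - X x ?t \<omega>\<bar>}) \<longlonglongrightarrow> 0" if "0 < b" for b
      using euler_converges[OF x that, of r 0 1] unfolding E_def by simp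
    have trunc: "(\<integral>\<^sup>+\<omega>. ennreal (min (real N) ((R \<omega>)\<^sup>2)) \<partial>M) \<le> ennreal (2 * c * ?t\<^sup>2)" for N
    proof (rule ennreal_le_epsilon)
      fix e :: real assume e: "0 < e"
      define b where "b = sqrt (e / 4)"
      have b: "0 < b" "2 * b\<^sup>2 = e / 2" using e by (auto simp: b_def)
      have "(\<lambda>l. real N * prob {\<omega>\<in>space M. b < \<bar>E l \<omega> - X x ?t \<omega>\<bar>}) \<longlonglongrightarrow> real N * 0"
        by (intro tendsto_mult_left conv b)
      then have "\<forall>\<^sub>F l in sequentially. real N * prob {\<omega>\<in>space M. b < \<bar>E l \<omega> - X x ?t \<omega>\<bar>} < e / 2"
        using e by (intro order_tendstoD) auto
      then obtain l where l: "real N * prob {\<omega>\<in>space M. b < \<bar>E l \<omega> - X x ?t \<omega>\<bar>} < e / 2"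
        using eventually_happens by force
      let ?A = "{\<omega>\<in>space M. b < \<bar>E l \<omega> - X x ?t \<omega>\<bar>}"
      have "(\<integral>\<^sup>+\<omega>. ennreal (min (real N) ((R \<omega>)\<^sup>2)) \<partial>M)
         \<le> (\<integral>\<^sup>+\<omega>. (2 * ennreal ((S l \<omega>)\<^sup>2) + ennreal (e / 2)) + ennreal (real N) * indicator ?A \<omega> \<partial>M)"
      proof (rule nn_integral_mono)
        fix \<omega> assume \<omega>: "\<omega> \<in> space M"
        show "ennreal (min (real N) ((R \<omega>)\<^sup>2)) \<le> (2 * ennreal ((S l \<omega>)\<^sup>2) + ennreal (e / 2)) + ennreal (real N) * indicator ?A \<omega>"
        proof (cases "\<omega> \<in> ?A")
          case True
          have "ennreal (min (real N) ((R \<omega>)\<^sup>2)) \<le> ennreal (real N)" by (intro ennreal_leI) simp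
          then show ?thesis unfolding indicator_simps(1)[OF True] by (simp add: add_increasing)
        next
          case False
          then have "\<bar>R \<omega> - S l \<omega>\<bar> \<le> b" using \<omega> by (auto simp: R_def S_def abs_minus_commute)
          then have "(R \<omega> - S l \<omega>)\<^sup>2 \<le> b\<^sup>2" using power_mono[of "\<bar>R \<omega> - S l \<omega>\<bar>" b 2] by simp
          moreover have "(R \<omega>)\<^sup>2 \<le> 2 * (S l \<omega>)\<^sup>2 + 2 * (R \<omega> - S l \<omega>)\<^sup>2"
            using young_square[of 1 "S l \<omega>" "R \<omega> - S l \<omega>"] by simp
          ultimately have "min (real N) ((R \<omega>)\<^sup>2) \<le> 2 * (S l \<omega>)\<^sup>2 + e / 2" using b by linarith
          then have "ennreal (min (real N) ((R \<omega>)\<^sup>2)) \<le> ennreal (2 * (S l \<omega>)\<^sup>2 + e / 2)" by (rule ennreal_leI)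
          also have "\<dots> = 2 * ennreal ((S l \<omega>)\<^sup>2) + ennreal (e / 2)"
            using e by (simp add: ennreal_plus ennreal_mult)
          finally show ?thesis by (simp add: add_increasing2)
        qed
      qed
      also have "\<dots> = 2 * (\<integral>\<^sup>+\<omega>. ennreal ((S l \<omega>)\<^sup>2) \<partial>M) + ennreal (e / 2) + ennreal (real N) * emeasure M ?A"
        by (simp add: nn_integral_add nn_integral_cmult nn_integral_cmult_indicator emeasure_space_1)
      also have "\<dots> \<le> 2 * ennreal (c * ?t\<^sup>2) + ennreal (e / 2) + ennreal (real N) * emeasure M ?A"
        by (intro add_right_mono mult_left_mono Sb) simp
      also have "\<dots> = ennreal (2 * c * ?t\<^sup>2 + e / 2 + real N * prob ?A)"
        using e c0 by (simp add: emeasure_eq_measure ennreal_plus ennreal_mult mult.assoc)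
      also have "\<dots> \<le> ennreal (2 * c * ?t\<^sup>2 + e)" using l by (intro ennreal_leI) linarith
      also have "\<dots> = ennreal (2 * c * ?t\<^sup>2) + ennreal e" using e c0 by (intro ennreal_plus) auto
      finally show "(\<integral>\<^sup>+\<omega>. ennreal (min (real N) ((R \<omega>)\<^sup>2)) \<partial>M) \<le> ennreal (2 * c * ?t\<^sup>2) + ennreal e" .
    qed
    have "(\<integral>\<^sup>+\<omega>. ennreal ((R \<omega>)\<^sup>2) \<partial>M) = (\<integral>\<^sup>+\<omega>. liminf (\<lambda>N. ennreal (min (real N) ((R \<omega>)\<^sup>2))) \<partial>M)"
    proof (rule nn_integral_cong)
      fix \<omega>
      have "\<forall>\<^sub>F N in sequentially. ennreal (min (real N) ((R \<omega>)\<^sup>2)) = ennreal ((R \<omega>)\<^sup>2)"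
        by (rule eventually_at_top_linorderI[of "nat \<lceil>(R \<omega>)\<^sup>2\<rceil>"], rule arg_cong[where f=ennreal]) linarith
      then have "(\<lambda>N. ennreal (min (real N) ((R \<omega>)\<^sup>2))) \<longlonglongrightarrow> ennreal ((R \<omega>)\<^sup>2)" by (rule tendsto_eventually)
      then show "ennreal ((R \<omega>)\<^sup>2) = liminf (\<lambda>N. ennreal (min (real N) ((R \<omega>)\<^sup>2)))"
        by (intro lim_imp_Liminf[symmetric]) auto
    qed
    also have "\<dots> \<le> liminf (\<lambda>N. \<integral>\<^sup>+\<omega>. ennreal (min (real N) ((R \<omega>)\<^sup>2)) \<partial>M)"
      by (rule nn_integral_liminf) measurable
    also have "\<dots> \<le> ennreal (2 * c * ?t\<^sup>2)"
      using Liminf_mono[of "\<lambda>N. \<integral>\<^sup>+\<omega>. ennreal (min (real N) ((R \<omega>)\<^sup>2)) \<partial>M" "\<lambda>_. ennreal (2 * c * ?t\<^sup>2)" sequentially] trunc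
      by (simp add: Liminf_const)
    finally show ?thesis unfolding R_def .
  qed
  with that[of "2 * c"] c0 show thesis by simp
qed

text \<open>The Gaussian leading term gives \<open>E (max 0 (s * (X t - x)))\<close> the size \<open>\<bar>\<sigma> x\<bar> * sqrt t * sqrt (2 / pi) / 2\<close> and
  \<open>E \<bar>X t - x\<bar>\<close> twice that; the linear term has no contribution of order \<open>sqrt t\<close> since the Gaussian is centred.
  All other contributions are of order \<open>t\<close>.\<close>

lemma kink_expectation:
  assumes x: "x \<in> \<X>"
  obtains C where "0 \<le> C" "\<And>r A q \<kappa> \<eta> B s. \<lbrakk>0 \<le> \<kappa>; 0 \<le> \<eta>; 0 \<le> B; \<bar>s\<bar> = 1\<rbrakk> \<Longrightarrow>
     (let t = 1 / 2 ^ r; l = \<lambda>y. A + q * (y - x) + \<kappa> * max 0 (s * (y - x)) - \<eta> * \<bar>y - x\<bar> - B * (y - x)\<^sup>2 in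
       integrable M (\<lambda>\<omega>. l (X x t \<omega>)) \<and>
       A + (\<kappa> / 2 - \<eta>) * (\<bar>\<sigma> x\<bar> * (sqrt t * sqrt (2 / pi))) - (\<bar>q\<bar> + \<kappa> + \<eta>) * (C * t) - B * (C * t)
         \<le> expectation (\<lambda>\<omega>. l (X x t \<omega>)))"
proof -
  obtain C0 where C0: "0 \<le> C0" and rem: "\<And>r. (\<integral>\<^sup>+\<omega>. ennreal ((X x (1 / 2 ^ r) \<omega> - x - \<sigma> x * (W (1 / 2 ^ r) \<omega> - W 0 \<omega>))\<^sup>2) \<partial>M)
     \<le> ennreal (C0 * (1 / 2 ^ r)\<^sup>2)"
    using small_time_remainder[OF x] by blast
  define C where "C = (1 + C0) + 2 * (\<sigma> x)\<^sup>2 + 2 * C0"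
  have C: "0 \<le> C" "1 + C0 \<le> C" "2 * (\<sigma> x)\<^sup>2 + 2 * C0 \<le> C" using C0 by (auto simp: C_def)
  have main: "let t = 1 / 2 ^ r; l = \<lambda>y. A + q * (y - x) + \<kappa> * max 0 (s * (y - x)) - \<eta> * \<bar>y - x\<bar> - B * (y - x)\<^sup>2 in
       integrable M (\<lambda>\<omega>. l (X x t \<omega>)) \<and>
       A + (\<kappa> / 2 - \<eta>) * (\<bar>\<sigma> x\<bar> * (sqrt t * sqrt (2 / pi))) - (\<bar>q\<bar> + \<kappa> + \<eta>) * (C * t) - B * (C * t)
         \<le> expectation (\<lambda>\<omega>. l (X x t \<omega>))"
    if k: "0 \<le> \<kappa>" "0 \<le> \<eta>" "0 \<le> B" "\<bar>s\<bar> = 1" for r A q \<kappa> \<eta> B s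
  proof -
    define t where "t = 1 / (2::real) ^ r"
    have t: "0 < t" "t \<le> 1" by (auto simp: t_def)
    define G where "G \<omega> = W t \<omega> - W 0 \<omega>" for \<omega>
    define R where "R \<omega> = X x t \<omega> - x - \<sigma> x * G \<omega>" for \<omega>
    have Xd: "X x t \<omega> - x = \<sigma> x * G \<omega> + R \<omega>" for \<omega> by (simp add: R_def)
    have [measurable]: "X x t \<in> borel_measurable M" "W t \<in> borel_measurable M" "W 0 \<in> borel_measurable M"
      using X_measurable_M[OF x] W_measurable_M t by auto
    have Gm[measurable]: "G \<in> borel_measurable M" unfolding G_def by measurable
    have Rm[measurable]: "R \<in> borel_measurable M" unfolding R_def by measurable
    have dG: "distr M borel G = gauss t" using distr_increment[of 0 t] t unfolding G_def by simp
    note gm = gauss_moments[OF t(1)]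
    have Gint: "integrable M G" "integrable M (\<lambda>\<omega>. (G \<omega>)\<^sup>2)" "integrable M (\<lambda>\<omega>. \<bar>G \<omega>\<bar>)"
      using gm(1,3,5) unfolding dG[symmetric] by (simp_all add: integrable_distr_eq)
    have GE: "expectation G = 0" "expectation (\<lambda>\<omega>. (G \<omega>)\<^sup>2) = t" "expectation (\<lambda>\<omega>. \<bar>G \<omega>\<bar>) = sqrt t * sqrt (2 / pi)"
      using gm(2,4,6) unfolding dG[symmetric] by (simp_all add: integral_distr)
    have Rn: "(\<integral>\<^sup>+\<omega>. ennreal ((R \<omega>)\<^sup>2) \<partial>M) \<le> ennreal (C0 * t\<^sup>2)"
      using rem[of r] unfolding R_def G_def t_def .
    have R2: "integrable M (\<lambda>\<omega>. (R \<omega>)\<^sup>2)"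
      by (rule integrableI_bounded) (use Rn in \<open>auto intro: le_less_trans\<close>)
    have R2E: "expectation (\<lambda>\<omega>. (R \<omega>)\<^sup>2) \<le> C0 * t\<^sup>2"
      using Rn nn_integral_eq_integral[OF R2] C0 by (simp add: ennreal_le_iff)
    have Rint: "integrable M R" by (rule square_integrable_imp_integrable[OF Rm R2])
    \<comment> \<open>This turns the second moment \<open>O(t\<^sup>2)\<close> into a first moment \<open>O(t)\<close>.\<close>
    have absR: "\<bar>R \<omega>\<bar> \<le> t + (R \<omega>)\<^sup>2 / t" for \<omega>
    proof -
      have "0 \<le> (\<bar>R \<omega>\<bar> - t)\<^sup>2 + t * \<bar>R \<omega>\<bar>" using t by simp
      then have "\<bar>R \<omega>\<bar> * t \<le> t * t + (R \<omega>)\<^sup>2" by (simp add: power2_diff power2_eq_square algebra_simps)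
      then show ?thesis using t by (simp add: field_simps)
    qed
    have RE: "expectation (\<lambda>\<omega>. \<bar>R \<omega>\<bar>) \<le> C * t"
    proof -
      have "expectation (\<lambda>\<omega>. \<bar>R \<omega>\<bar>) \<le> expectation (\<lambda>\<omega>. t + (R \<omega>)\<^sup>2 / t)"
        by (rule integral_mono) (use Rint R2 absR in auto)
      also have "\<dots> = t + expectation (\<lambda>\<omega>. (R \<omega>)\<^sup>2) / t" using R2 by (simp add: prob_space)
      also have "\<dots> \<le> t + (C0 * t\<^sup>2) / t" using R2E t by (intro add_left_mono divide_right_mono) auto
      also have "\<dots> = (1 + C0) * t" using t by (simp add: power2_eq_square field_simps)
      also have "\<dots> \<le> C * t" using C t by (intro mult_right_mono) auto
      finally show ?thesis .
    qed
    define l where "l y = A + q * (y - x) + \<kappa> * max 0 (s * (y - x)) - \<eta> * \<bar>y - x\<bar> - B * (y - x)\<^sup>2" for y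
    \<comment> \<open>A lower bound for \<open>l (X x t)\<close> in terms of the Gaussian increment and the remainder, from \<open>max 0 u = (u + \<bar>u\<bar>) / 2\<close>.\<close>
    define l' where "l' \<omega> = (A + (q * \<sigma> x) * G \<omega>) + (\<kappa> * (s * \<sigma> x) / 2) * G \<omega> + (\<kappa> / 2 - \<eta>) * (\<bar>\<sigma> x\<bar> * \<bar>G \<omega>\<bar>)
        - (\<bar>q\<bar> + \<kappa> + \<eta>) * \<bar>R \<omega>\<bar> - B * (2 * (\<sigma> x)\<^sup>2 * (G \<omega>)\<^sup>2 + 2 * (R \<omega>)\<^sup>2)" for \<omega>
    have le: "l' \<omega> \<le> l (X x t \<omega>)" for \<omega>
    proof -
      have sa: "\<bar>s * y\<bar> = \<bar>y\<bar>" for y using k(4) by (simp add: abs_mult)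
      have 1: "q * (X x t \<omega> - x) \<ge> (q * \<sigma> x) * G \<omega> - \<bar>q\<bar> * \<bar>R \<omega>\<bar>"
        unfolding Xd using abs_ge_minus_self[of "q * R \<omega>"] by (simp add: abs_mult algebra_simps)
      have mx: "max 0 (s * (X x t \<omega> - x)) \<ge> (s * \<sigma> x * G \<omega> + \<bar>\<sigma> x\<bar> * \<bar>G \<omega>\<bar>) / 2 - \<bar>R \<omega>\<bar>"
      proof -
        have "s * (X x t \<omega> - x) = s * (\<sigma> x * G \<omega>) + s * R \<omega>" unfolding Xd by (simp add: algebra_simps)
        moreover have "\<bar>s * (\<sigma> x * G \<omega>)\<bar> = \<bar>\<sigma> x\<bar> * \<bar>G \<omega>\<bar>" "\<bar>s * R \<omega>\<bar> = \<bar>R \<omega>\<bar>"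
          unfolding sa by (auto simp: abs_mult)
        moreover have "max 0 (u + v) \<ge> (u + \<bar>u\<bar>) / 2 - \<bar>v\<bar>" for u v :: real by (simp add: max_def abs_if)
        ultimately show ?thesis by (metis mult.assoc)
      qed
      have 2: "\<kappa> * max 0 (s * (X x t \<omega> - x)) \<ge> (\<kappa> * (s * \<sigma> x) / 2) * G \<omega> + \<kappa> / 2 * (\<bar>\<sigma> x\<bar> * \<bar>G \<omega>\<bar>) - \<kappa> * \<bar>R \<omega>\<bar>"
        using mult_left_mono[OF mx k(1)] by (simp add: algebra_simps add_divide_distrib)
      have "\<bar>X x t \<omega> - x\<bar> \<le> \<bar>\<sigma> x\<bar> * \<bar>G \<omega>\<bar> + \<bar>R \<omega>\<bar>" unfolding Xd by (metis abs_mult abs_triangle_ineq)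
      then have 3: "\<eta> * \<bar>X x t \<omega> - x\<bar> \<le> \<eta> * (\<bar>\<sigma> x\<bar> * \<bar>G \<omega>\<bar>) + \<eta> * \<bar>R \<omega>\<bar>"
        using mult_left_mono[OF _ k(2)] by (simp add: distrib_left[symmetric])
      have "(X x t \<omega> - x)\<^sup>2 \<le> 2 * (\<sigma> x)\<^sup>2 * (G \<omega>)\<^sup>2 + 2 * (R \<omega>)\<^sup>2"
        unfolding Xd using young_square[of 1 "\<sigma> x * G \<omega>" "R \<omega>"] by (simp add: power_mult_distrib)
      then have 4: "B * (X x t \<omega> - x)\<^sup>2 \<le> B * (2 * (\<sigma> x)\<^sup>2 * (G \<omega>)\<^sup>2 + 2 * (R \<omega>)\<^sup>2)"
        using mult_left_mono[OF _ k(3)] by blast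
      have "(\<kappa> / 2 - \<eta>) * (\<bar>\<sigma> x\<bar> * \<bar>G \<omega>\<bar>) = \<kappa> / 2 * (\<bar>\<sigma> x\<bar> * \<bar>G \<omega>\<bar>) - \<eta> * (\<bar>\<sigma> x\<bar> * \<bar>G \<omega>\<bar>)"
        "(\<bar>q\<bar> + \<kappa> + \<eta>) * \<bar>R \<omega>\<bar> = \<bar>q\<bar> * \<bar>R \<omega>\<bar> + \<kappa> * \<bar>R \<omega>\<bar> + \<eta> * \<bar>R \<omega>\<bar>"
        by (auto simp: algebra_simps)
      then show ?thesis unfolding l_def l'_def using 1 2 3 4 by linarith
    qed
    have Xint: "integrable M (X x t)"
    proof -
      have "integrable M (\<lambda>\<omega>. x + (\<sigma> x * G \<omega> + R \<omega>))" using Gint Rint by auto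
      then show ?thesis unfolding Xd[symmetric] by simp
    qed
    have X2int: "integrable M (\<lambda>\<omega>. (X x t \<omega> - x)\<^sup>2)"
    proof (rule Bochner_Integration.integrable_bound)
      show "integrable M (\<lambda>\<omega>. 2 * (\<sigma> x)\<^sup>2 * (G \<omega>)\<^sup>2 + 2 * (R \<omega>)\<^sup>2)" using Gint R2 by auto
      show "AE \<omega> in M. norm ((X x t \<omega> - x)\<^sup>2) \<le> norm (2 * (\<sigma> x)\<^sup>2 * (G \<omega>)\<^sup>2 + 2 * (R \<omega>)\<^sup>2)"
      proof (rule AE_I2)
        fix \<omega>
        have "(X x t \<omega> - x)\<^sup>2 \<le> 2 * (\<sigma> x)\<^sup>2 * (G \<omega>)\<^sup>2 + 2 * (R \<omega>)\<^sup>2"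
          unfolding Xd using young_square[of 1 "\<sigma> x * G \<omega>" "R \<omega>"] by (simp add: power_mult_distrib)
        then show "norm ((X x t \<omega> - x)\<^sup>2) \<le> norm (2 * (\<sigma> x)\<^sup>2 * (G \<omega>)\<^sup>2 + 2 * (R \<omega>)\<^sup>2)" by simp
      qed
    qed measurable
    have lint: "integrable M (\<lambda>\<omega>. l (X x t \<omega>))"
      unfolding l_def using Xint X2int
      by (intro Bochner_Integration.integrable_diff Bochner_Integration.integrable_add integrable_mult_right
          integrable_max integrable_abs) auto
    have l'int: "integrable M l'"
      unfolding l'_def using Gint Rint R2
      by (intro Bochner_Integration.integrable_diff Bochner_Integration.integrable_add integrable_mult_right
          integrable_abs) auto
    have "A + (\<kappa> / 2 - \<eta>) * (\<bar>\<sigma> x\<bar> * (sqrt t * sqrt (2 / pi))) - (\<bar>q\<bar> + \<kappa> + \<eta>) * (C * t) - B * (C * t)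
       \<le> A + (\<kappa> / 2 - \<eta>) * (\<bar>\<sigma> x\<bar> * (sqrt t * sqrt (2 / pi))) - (\<bar>q\<bar> + \<kappa> + \<eta>) * expectation (\<lambda>\<omega>. \<bar>R \<omega>\<bar>)
          - B * (2 * (\<sigma> x)\<^sup>2 * t + 2 * expectation (\<lambda>\<omega>. (R \<omega>)\<^sup>2))"
    proof -
      have "(\<bar>q\<bar> + \<kappa> + \<eta>) * expectation (\<lambda>\<omega>. \<bar>R \<omega>\<bar>) \<le> (\<bar>q\<bar> + \<kappa> + \<eta>) * (C * t)"
        using RE k by (intro mult_left_mono) auto
      moreover have "2 * (\<sigma> x)\<^sup>2 * t + 2 * expectation (\<lambda>\<omega>. (R \<omega>)\<^sup>2) \<le> C * t"
      proof -
        have "t\<^sup>2 \<le> t" using t by (simp add: power2_eq_square mult_left_le)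
        then have "C0 * t\<^sup>2 \<le> C0 * t" using C0 by (rule mult_left_mono)
        then have "2 * (\<sigma> x)\<^sup>2 * t + 2 * expectation (\<lambda>\<omega>. (R \<omega>)\<^sup>2) \<le> (2 * (\<sigma> x)\<^sup>2 + 2 * C0) * t"
          using R2E by (simp add: distrib_right)
        also have "\<dots> \<le> C * t" using C t by (intro mult_right_mono) auto
        finally show ?thesis .
      qed
      then have "B * (2 * (\<sigma> x)\<^sup>2 * t + 2 * expectation (\<lambda>\<omega>. (R \<omega>)\<^sup>2)) \<le> B * (C * t)"
        using k by (intro mult_left_mono) auto
      ultimately show ?thesis by linarith
    qed
    also have "\<dots> = expectation l'"
      unfolding l'_def using Gint Rint R2 GE by (simp add: prob_space)
    also have "\<dots> \<le> expectation (\<lambda>\<omega>. l (X x t \<omega>))" by (rule integral_mono[OF l'int lint le])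
    finally show ?thesis using lint unfolding Let_def t_def l_def by blast
  qed
  show thesis by (rule that[OF C(1) main])
qed

end

section \<open>The stopped payoff as a function of the path\<close>

text \<open>A continuous path meets a closed set up to time \<open>T\<close> exactly if it comes arbitrarily close to it
  at dyadic times up to \<open>T\<close>, so the hitting time can be read off from the path at dyadic times.\<close>

definition dyadic_hit :: "real set \<Rightarrow> (nat \<times> nat \<Rightarrow> real) \<Rightarrow> ereal" where
  "dyadic_hit S w = (INF p. if \<forall>n::nat. \<exists>q. dyadic q \<le> dyadic p \<and> infdist (w q) S < 1 / (real n + 1)
     then ereal (dyadic p) else \<infinity>)"

text \<open>The position at the hitting time, recovered by continuity from dyadic times above it.\<close>

definition dyadic_stop :: "real set \<Rightarrow> (nat \<times> nat \<Rightarrow> real) \<Rightarrow> real" where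
  "dyadic_stop S w = lim (\<lambda>m. w (m, nat \<lceil>2 ^ m * real_of_ereal (dyadic_hit S w)\<rceil>))"

text \<open>The maximum with \<open>0\<close> and the cut-off outside \<open>\<X>\<close> make this a Borel function of arbitrary sequences;
  neither is visible along a continuous path in \<open>\<X>\<close>.\<close>

definition path_payoff ::
  "real set \<Rightarrow> real set \<Rightarrow> (real \<Rightarrow> real) \<Rightarrow> (real \<Rightarrow> real) \<Rightarrow> real \<Rightarrow> (nat \<times> nat \<Rightarrow> real) \<Rightarrow> ennreal" where
  "path_payoff \<X> S \<delta> f c w = (if dyadic_hit S w = \<infinity> then 0
     else ennreal (\<delta> (max 0 (c + real_of_ereal (dyadic_hit S w)))
       * (if dyadic_stop S w \<in> \<X> then f (dyadic_stop S w) else 0)))"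

lemma coordinate_measurable [measurable]:
  "(\<lambda>w :: nat \<times> nat \<Rightarrow> real. w q) \<in> borel_measurable borel"
  by (rule borel_measurable_continuous_onI) (rule continuous_on_product_coordinates)

lemma dyadic_hit_measurable [measurable]: "dyadic_hit S \<in> borel_measurable borel"
proof -
  have [measurable]: "(\<lambda>w :: nat \<times> nat \<Rightarrow> real. infdist (w q) S) \<in> borel_measurable borel" for q
    by (rule measurable_compose[OF coordinate_measurable])
       (intro borel_measurable_continuous_onI continuous_intros)
  have [measurable]: "Measurable.pred borel (\<lambda>w :: nat \<times> nat \<Rightarrow> real. \<forall>n::nat. \<exists>q. dyadic q \<le> dyadic p \<and> infdist (w q) S < 1 / (real n + 1))" for p
    by measurable
  show ?thesis unfolding dyadic_hit_def by measurable
qed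

lemma dyadic_stop_measurable [measurable]: "dyadic_stop S \<in> borel_measurable borel"
proof -
  have [measurable]: "(\<lambda>w. w (m, nat \<lceil>2 ^ m * real_of_ereal (dyadic_hit S w)\<rceil>)) \<in> borel_measurable borel" for m
    by (rule measurable_compose_countable[where f="\<lambda>k w. w (m, nat k)"]) measurable
  show ?thesis unfolding dyadic_stop_def by measurable
qed

lemma path_payoff_measurable:
  assumes "is_interval \<X>" "continuous_on {0..} \<delta>" "continuous_on \<X> f"
  shows "path_payoff \<X> S \<delta> f c \<in> borel_measurable borel"
proof -
  have [measurable]: "(\<lambda>t. \<delta> (max 0 t)) \<in> borel_measurable borel"
    by (intro borel_measurable_continuous_onI continuous_on_compose2[OF assms(2)] continuous_intros) auto
  have [measurable]: "(\<lambda>y. if y \<in> \<X> then f y else 0) \<in> borel_measurable borel"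
    by (rule borel_measurable_continuous_on_if[OF real_interval_borel_measurable[OF assms(1)] assms(3)]) simp
  have [measurable]: "(\<lambda>w. if dyadic_stop S w \<in> \<X> then f (dyadic_stop S w) else 0) \<in> borel_measurable borel"
    using measurable_compose[OF dyadic_stop_measurable[of S], of "\<lambda>y. if y \<in> \<X> then f y else 0" borel] by simp
  show ?thesis unfolding path_payoff_def by measurable
qed

lemma hitting_time_from_cases:
  assumes "0 \<le> \<epsilon>"
  obtains "hitting_time_from \<epsilon> y S = \<infinity>" "\<And>t. \<epsilon> \<le> t \<Longrightarrow> y t \<notin> S"
  | r where "\<epsilon> \<le> r" "hitting_time_from \<epsilon> y S = ereal r"
proof (cases "{t. \<epsilon> \<le> t \<and> y t \<in> S} = {}")
  case True
  then have "hitting_time_from \<epsilon> y S = \<infinity>"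
    by (simp only: hitting_time_from_def image_empty Inf_empty top_ereal_def)
  then show thesis using that(1) True by blast
next
  case False
  then obtain t where t: "\<epsilon> \<le> t" "y t \<in> S" by auto
  have "hitting_time_from \<epsilon> y S \<le> ereal t" unfolding hitting_time_from_def by (rule INF_lower) (use t in simp)
  moreover have "ereal \<epsilon> \<le> hitting_time_from \<epsilon> y S" unfolding hitting_time_from_def by (rule INF_greatest) simp
  ultimately show thesis using that(2) by (cases "hitting_time_from \<epsilon> y S") auto
qed

lemma hitting_time_from_le: "\<epsilon> \<le> t \<Longrightarrow> y t \<in> S \<Longrightarrow> hitting_time_from \<epsilon> y S \<le> ereal t"
  unfolding hitting_time_from_def by (rule INF_lower) simp

lemma dyadic_hit_eq:
  assumes y: "continuous_on {0..} y" "\<And>t. 0 \<le> t \<Longrightarrow> y t \<in> \<X>" and S: "closedin (top_of_set \<X>) S" "S \<noteq> {}"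
  shows "dyadic_hit S (\<lambda>p. y (dyadic p)) = hitting_time_from 0 y S"
proof -
  have inf: "continuous_on {0..} (\<lambda>t. infdist (y t) S)" by (intro continuous_intros y)
  have hit: "(\<forall>n::nat. \<exists>q. dyadic q \<le> T \<and> infdist (y (dyadic q)) S < 1 / (real n + 1)) \<longleftrightarrow> (\<exists>s\<ge>0. s \<le> T \<and> y s \<in> S)"
    (is "?L \<longleftrightarrow> ?R") if T: "0 \<le> T" for T
  proof
    assume L: ?L
    obtain s where s: "s \<in> {0..T}" "\<And>t. t \<in> {0..T} \<Longrightarrow> infdist (y s) S \<le> infdist (y t) S"
      using continuous_attains_inf[of "{0..T}" "\<lambda>t. infdist (y t) S"] T continuous_on_subset[OF inf, of "{0..T}"] by auto
    have "infdist (y s) S < 1 / (real n + 1)" for n :: nat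
    proof -
      obtain q where "dyadic q \<le> T" "infdist (y (dyadic q)) S < 1 / (real n + 1)" using L by blast
      then show ?thesis using s(2)[of "dyadic q"] by simp
    qed
    moreover have "\<exists>n::nat. 1 / (real n + 1) < e" if "0 < e" for e :: real
      using nat_approx_posE[OF that] by (metis of_nat_Suc add.commute)
    ultimately have "\<not> 0 < infdist (y s) S" by (meson less_asym)
    then have "infdist (y s) S = 0" using infdist_nonneg[of "y s" S] by linarith
    then have "y s \<in> closure S" using in_closure_iff_infdist_zero[OF S(2)] by simp
    moreover obtain C where C: "closed C" "S = \<X> \<inter> C" using S(1) unfolding closedin_closed by blast
    ultimately have "y s \<in> C" using closure_minimal[of S C] by auto
    then show ?R using C y(2) s(1) by auto
  next
    assume ?R
    then obtain s where s: "0 \<le> s" "s \<le> T" "y s \<in> S" by auto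
    have "(\<lambda>m. infdist (y (real (nat \<lfloor>2 ^ m * s\<rfloor>) / 2 ^ m)) S) \<longlonglongrightarrow> infdist (y s) S"
      by (rule continuous_on_tendsto_compose[OF inf dyadic_floor(2)[OF s(1)]]) (use s in auto)
    then have lim: "(\<lambda>m. infdist (y (real (nat \<lfloor>2 ^ m * s\<rfloor>) / 2 ^ m)) S) \<longlonglongrightarrow> 0" using s by simp
    show ?L
    proof
      fix n :: nat
      have "\<forall>\<^sub>F m in sequentially. infdist (y (real (nat \<lfloor>2 ^ m * s\<rfloor>) / 2 ^ m)) S < 1 / (real n + 1)"
        by (rule order_tendstoD(2)[OF lim]) simp
      then obtain m where "infdist (y (real (nat \<lfloor>2 ^ m * s\<rfloor>) / 2 ^ m)) S < 1 / (real n + 1)"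
        using eventually_happens by force
      then show "\<exists>q. dyadic q \<le> T \<and> infdist (y (dyadic q)) S < 1 / (real n + 1)"
        using dyadic_floor(1)[OF s(1), of m] s(2) by (intro exI[of _ "(m, nat \<lfloor>2 ^ m * s\<rfloor>)"]) simp
    qed
  qed
  have eq: "dyadic_hit S (\<lambda>p. y (dyadic p)) = (INF p. if \<exists>s\<ge>0. s \<le> dyadic p \<and> y s \<in> S then ereal (dyadic p) else \<infinity>)"
    unfolding dyadic_hit_def by (intro INF_cong refl if_cong hit) simp_all
  show ?thesis
  proof (rule antisym)
    show "dyadic_hit S (\<lambda>p. y (dyadic p)) \<le> hitting_time_from 0 y S"
      unfolding hitting_time_from_def
    proof (rule INF_greatest, rule ereal_le_epsilon2)
      fix t e :: real assume t: "t \<in> {t. 0 \<le> t \<and> y t \<in> S}" and e: "0 < e"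
      have "\<forall>\<^sub>F m in sequentially. real (nat \<lceil>2 ^ m * t\<rceil>) / 2 ^ m < t + e"
        by (rule order_tendstoD(2)[OF dyadic_ceiling(2)]) (use t e in auto)
      then obtain m where m: "real (nat \<lceil>2 ^ m * t\<rceil>) / 2 ^ m < t + e" using eventually_happens by force
      let ?p = "(m, nat \<lceil>2 ^ m * t\<rceil>)"
      have "\<exists>s\<ge>0. s \<le> dyadic ?p \<and> y s \<in> S" using t dyadic_ceiling(1)[of t m] by auto
      then have "dyadic_hit S (\<lambda>p. y (dyadic p)) \<le> ereal (dyadic ?p)"
        unfolding eq by (intro INF_lower2[of ?p]) auto
      also have "\<dots> \<le> ereal t + ereal e" using m by simp
      finally show "dyadic_hit S (\<lambda>p. y (dyadic p)) \<le> ereal t + ereal e" .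
    qed
    show "hitting_time_from 0 y S \<le> dyadic_hit S (\<lambda>p. y (dyadic p))"
      unfolding eq
    proof (rule INF_greatest)
      fix p
      show "hitting_time_from 0 y S \<le> (if \<exists>s\<ge>0. s \<le> dyadic p \<and> y s \<in> S then ereal (dyadic p) else \<infinity>)"
      proof (cases "\<exists>s\<ge>0. s \<le> dyadic p \<and> y s \<in> S")
        case True
        then obtain s where s: "0 \<le> s" "s \<le> dyadic p" "y s \<in> S" by blast
        have "hitting_time_from 0 y S \<le> ereal s" by (rule hitting_time_from_le) (use s in auto)
        also have "\<dots> \<le> ereal (dyadic p)" using s by simp
        finally show ?thesis using True by simp
      next
        case False
        then show ?thesis unfolding if_not_P[OF False] by simp
      qed
    qed
  qed
qed

lemma path_payoff_eq:
  assumes y: "continuous_on {0..} y" "\<And>t. 0 \<le> t \<Longrightarrow> y t \<in> \<X>" and S: "closedin (top_of_set \<X>) S" "S \<noteq> {}"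
    and c: "0 \<le> c"
  shows "path_payoff \<X> S \<delta> f c (\<lambda>p. y (dyadic p)) = ennreal (discounted_payoff \<delta> f c y (hitting_time_from 0 y S))"
proof -
  note hit = dyadic_hit_eq[OF y S]
  show ?thesis
  proof (cases rule: hitting_time_from_cases[OF order_refl, of y S])
    case 1
    then show ?thesis by (simp add: path_payoff_def hit discounted_payoff_def)
  next
    case (2 r)
    have "0 \<le> real (nat \<lceil>2 ^ m * r\<rceil>) / 2 ^ m" for m by (intro divide_nonneg_nonneg) auto
    then have "\<forall>\<^sub>F m in sequentially. real (nat \<lceil>2 ^ m * r\<rceil>) / 2 ^ m \<in> {0..}" by (simp only: atLeast_iff eventually_True)
    then have "(\<lambda>m. y (real (nat \<lceil>2 ^ m * r\<rceil>) / 2 ^ m)) \<longlonglongrightarrow> y r"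
      by (intro continuous_on_tendsto_compose[OF y(1) dyadic_ceiling(2)]) (use 2 in auto)
    moreover have hr: "real_of_ereal (dyadic_hit S (\<lambda>p. y (dyadic p))) = r" using hit 2 by simp
    ultimately have "dyadic_stop S (\<lambda>p. y (dyadic p)) = y r"
      unfolding dyadic_stop_def hr by (simp add: limI)
    then show ?thesis using 2 c y(2)[of r] by (simp add: path_payoff_def hit discounted_payoff_def)
  qed
qed

text \<open>Waiting until time \<open>\<epsilon>\<close> and then for the first visit is the same as looking for the first visit of the
  path after time \<open>\<epsilon>\<close> with the discount clock already at \<open>\<epsilon>\<close>; this is where the dependence of \<open>V\<close> on its time
  argument comes from.\<close>

lemma discounted_payoff_shift:
  assumes "0 \<le> \<epsilon>"
  shows "discounted_payoff \<delta> f 0 y (hitting_time_from \<epsilon> y S)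
    = discounted_payoff \<delta> f \<epsilon> (\<lambda>u. y (\<epsilon> + u)) (hitting_time_from 0 (\<lambda>u. y (\<epsilon> + u)) S)"
proof -
  let ?z = "\<lambda>u. y (\<epsilon> + u)"
  have set: "{t. \<epsilon> \<le> t \<and> y t \<in> S} = (\<lambda>u. u + \<epsilon>) ` {u. 0 \<le> u \<and> ?z u \<in> S}"
  proof (intro equalityI subsetI)
    fix t assume "t \<in> {t. \<epsilon> \<le> t \<and> y t \<in> S}"
    then show "t \<in> (\<lambda>u. u + \<epsilon>) ` {u. 0 \<le> u \<and> ?z u \<in> S}" by (intro image_eqI[of _ _ "t - \<epsilon>"]) auto
  qed (auto simp: add.commute)
  have shift: "hitting_time_from \<epsilon> y S = hitting_time_from 0 ?z S + ereal \<epsilon>"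
  proof (cases "{u. 0 \<le> u \<and> ?z u \<in> S} = {}")
    case True
    then show ?thesis
      by (simp only: hitting_time_from_def set image_empty Inf_empty top_ereal_def) simp
  next
    case False
    have "hitting_time_from \<epsilon> y S = (INF u\<in>{u. 0 \<le> u \<and> ?z u \<in> S}. ereal u + ereal \<epsilon>)"
      unfolding hitting_time_from_def set image_image by simp
    also have "\<dots> = hitting_time_from 0 ?z S + ereal \<epsilon>"
      unfolding hitting_time_from_def by (rule INF_ereal_add_left[OF False]) auto
    finally show ?thesis .
  qed
  show ?thesis
    by (cases rule: hitting_time_from_cases[OF order_refl, of ?z S])
       (simp_all add: shift discounted_payoff_def add.commute)
qed

text \<open>The strict hitting time is the limit of the hitting times after \<open>1 / 2 ^ r\<close>: they coincide with it
  eventually if it is positive, and decrease to \<open>0\<close> if it is \<open>0\<close>.\<close>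

lemma discounted_payoff_tendsto:
  assumes y: "continuous_on {0..} y" "\<And>t. 0 \<le> t \<Longrightarrow> y t \<in> \<X>" and f: "continuous_on \<X> f" and \<delta>: "continuous_on {0..} \<delta>"
  shows "(\<lambda>r. discounted_payoff \<delta> f 0 y (hitting_time_from (1 / 2 ^ r) y S))
    \<longlonglongrightarrow> discounted_payoff \<delta> f 0 y (hitting_time y S)"
proof -
  let ?h = "hitting_time y S" and ?e = "\<lambda>r. 1 / (2::real) ^ r"
  have elim0: "?e \<longlonglongrightarrow> 0" using LIMSEQ_realpow_zero[of "1/2::real"] by (simp add: power_one_over)
  have lower: "?h \<le> ereal t" if "0 < t" "y t \<in> S" for t
    unfolding hitting_time_def by (rule INF_lower) (use that in simp)
  have h0: "0 \<le> ?h" unfolding hitting_time_def by (rule INF_greatest) simp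
  consider "?h = \<infinity>" | \<rho> where "?h = ereal \<rho>" "0 < \<rho>" | "?h = 0"
    using h0 by (cases ?h) (auto simp: less_le)
  then show ?thesis
  proof cases
    case 1
    have "y t \<notin> S" if "0 < t" for t using lower[OF that] 1 by auto
    moreover have "0 < t" if "?e r \<le> t" for r t using less_le_trans[OF _ that, of 0] by simp
    ultimately have "{t. ?e r \<le> t \<and> y t \<in> S} = {}" for r by blast
    then have "hitting_time_from (?e r) y S = \<infinity>" for r
      by (simp only: hitting_time_from_def image_empty Inf_empty top_ereal_def)
    then show ?thesis using 1 by simp
  next
    case 2
    have "\<forall>\<^sub>F r in sequentially. ?e r < \<rho>" by (rule order_tendstoD(2)[OF elim0 2(2)])
    then have "\<forall>\<^sub>F r in sequentially. hitting_time_from (?e r) y S = ?h"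
    proof eventually_elim
      case (elim r)
      have "{t. ?e r \<le> t \<and> y t \<in> S} = {t. 0 < t \<and> y t \<in> S}"
      proof (intro equalityI subsetI)
        fix t assume "t \<in> {t. ?e r \<le> t \<and> y t \<in> S}"
        then show "t \<in> {t. 0 < t \<and> y t \<in> S}" using less_le_trans[of 0 "?e r" t] by simp
      next
        fix t assume "t \<in> {t. 0 < t \<and> y t \<in> S}"
        then show "t \<in> {t. ?e r \<le> t \<and> y t \<in> S}" using lower[of t] 2(1) elim by simp
      qed
      then show ?case unfolding hitting_time_def hitting_time_from_def by simp
    qed
    then have "\<forall>\<^sub>F r in sequentially. discounted_payoff \<delta> f 0 y (hitting_time_from (?e r) y S)
       = discounted_payoff \<delta> f 0 y ?h" by eventually_elim simp
    then show ?thesis by (rule tendsto_eventually)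
  next
    case 3
    define \<rho> where "\<rho> r = real_of_ereal (hitting_time_from (?e r) y S)" for r
    have small: "\<forall>\<^sub>F r in sequentially. hitting_time_from (?e r) y S = ereal (\<rho> r) \<and> 0 \<le> \<rho> r \<and> \<rho> r < c" if c: "0 < c" for c
    proof -
      have "?h < ereal c" using 3 c by simp
      then obtain t where t: "0 < t" "y t \<in> S" "t < c"
        unfolding hitting_time_def INF_less_iff by auto
      have "\<forall>\<^sub>F r in sequentially. ?e r < t" by (rule order_tendstoD(2)[OF elim0 t(1)])
      then show ?thesis
      proof eventually_elim
        case (elim r)
        have le: "hitting_time_from (?e r) y S \<le> ereal t" by (rule hitting_time_from_le) (use elim t in auto)
        show ?case
        proof (rule hitting_time_from_cases[of "?e r" y S])
          fix s assume 3: "?e r \<le> s" "hitting_time_from (?e r) y S = ereal s"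
          have "0 \<le> ?e r" by simp
          then have "0 \<le> s" using 3(1) by linarith
          then show ?thesis using 3 le t by (simp add: \<rho>_def)
        qed (use le in auto)
      qed
    qed
    have "\<rho> \<longlonglongrightarrow> 0"
    proof (rule order_tendstoI)
      fix a :: real assume "a < 0"
      then show "\<forall>\<^sub>F r in sequentially. a < \<rho> r" using small[of 1] by (auto elim!: eventually_mono)
    next
      fix a :: real assume "0 < a"
      then show "\<forall>\<^sub>F r in sequentially. \<rho> r < a" using small[of a] by (auto elim!: eventually_mono)
    qed
    moreover have "continuous_on {0..} (\<lambda>u. \<delta> (0 + u) * f (y u))"
      by (intro continuous_on_mult continuous_on_compose2[OF \<delta>] continuous_on_compose2[OF f y(1)])
         (use y(2) in \<open>auto intro!: continuous_intros\<close>)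
    moreover have "\<forall>\<^sub>F r in sequentially. \<rho> r \<in> {0..}" using small[of 1] by (auto elim!: eventually_mono)
    ultimately have "(\<lambda>r. \<delta> (0 + \<rho> r) * f (y (\<rho> r))) \<longlonglongrightarrow> \<delta> (0 + 0) * f (y 0)"
      by (intro continuous_on_tendsto_compose[where f="\<lambda>u. \<delta> (0 + u) * f (y u)"]) auto
    moreover have "\<forall>\<^sub>F r in sequentially. \<delta> (0 + \<rho> r) * f (y (\<rho> r))
        = discounted_payoff \<delta> f 0 y (hitting_time_from (?e r) y S)"
      using small[of 1] by (auto elim!: eventually_mono simp: discounted_payoff_def)
    ultimately have "(\<lambda>r. discounted_payoff \<delta> f 0 y (hitting_time_from (?e r) y S)) \<longlonglongrightarrow> \<delta> (0 + 0) * f (y 0)"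
      by (rule Lim_transform_eventually)
    then show ?thesis using 3 by (simp add: discounted_payoff_def)
  qed
qed

section \<open>Expectations above a convex kink\<close>

context lipschitz_diffusion
begin

text \<open>The kink yields a gain of order \<open>sqrt t\<close>.  The factor \<open>d\<close> will be the discount \<open>\<delta> t\<close>, which varies
  with \<open>r\<close>.\<close>

lemma expectation_above_kink:
  fixes U :: "real \<Rightarrow> real"
  assumes x: "x \<in> \<X>" and \<sigma>: "\<sigma> x \<noteq> 0" and A: "0 \<le> A" and \<kappa>: "0 < \<kappa>" and s: "\<bar>s\<bar> = 1"
    and U: "\<And>y. y \<in> \<X> \<Longrightarrow> 0 \<le> U y"
    and kink: "\<And>\<eta>. 0 < \<eta> \<Longrightarrow> \<exists>h>0. \<forall>y\<in>\<X>. \<bar>y - x\<bar> < h \<longrightarrow>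
      A + q * (y - x) + \<kappa> * max 0 (s * (y - x)) - \<eta> * \<bar>y - x\<bar> \<le> U y"
  shows "\<exists>c>0. \<forall>\<^sub>F r in sequentially. \<forall>d\<ge>0.
    ennreal (d * (A + c * sqrt (1 / 2 ^ r))) \<le> (\<integral>\<^sup>+\<omega>. ennreal (d * U (X x (1 / 2 ^ r) \<omega>)) \<partial>M)"
proof -
  \<comment> \<open>The gain from the kink has coefficient \<open>\<kappa> / 2\<close>; half of it is spent on the error \<open>\<eta> * \<bar>y - x\<bar>\<close>.\<close>
  define \<eta> where "\<eta> = \<kappa> / 4"
  obtain h where h: "0 < h" and hU: "\<And>y. y \<in> \<X> \<Longrightarrow> \<bar>y - x\<bar> < h \<Longrightarrow>
      A + q * (y - x) + \<kappa> * max 0 (s * (y - x)) - \<eta> * \<bar>y - x\<bar> \<le> U y"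
    using kink[of \<eta>] \<kappa> unfolding \<eta>_def by auto
  \<comment> \<open>The quadratic penalty pushes \<open>l\<close> below \<open>0 \<le> U\<close> outside \<open>(x - h, x + h)\<close>, and it costs only \<open>O(t)\<close>.\<close>
  define B where "B = A / h\<^sup>2 + (\<bar>q\<bar> + \<kappa>) / h"
  have B: "0 \<le> B" using A h \<kappa> by (auto simp: B_def)
  define l where "l y = A + q * (y - x) + \<kappa> * max 0 (s * (y - x)) - \<eta> * \<bar>y - x\<bar> - B * (y - x)\<^sup>2" for y
  have lU: "l y \<le> U y" if y: "y \<in> \<X>" for y
  proof (cases "\<bar>y - x\<bar> < h")
    case True
    then show ?thesis using hU[OF y True] B unfolding l_def by (smt (verit) mult_nonneg_nonneg zero_le_power2)
  next
    case False
    let ?d = "\<bar>y - x\<bar>"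
    have d: "h \<le> ?d" using False by simp
    have "h\<^sup>2 \<le> ?d\<^sup>2" using power_mono[OF d, of 2] h by simp
    then have "A \<le> A / h\<^sup>2 * ?d\<^sup>2" using A h mult_left_mono[of "h\<^sup>2" "?d\<^sup>2" "A / h\<^sup>2"] by simp
    moreover have "(\<bar>q\<bar> + \<kappa>) * ?d \<le> (\<bar>q\<bar> + \<kappa>) / h * ?d\<^sup>2"
    proof -
      have "h * ?d \<le> ?d * ?d" using d by (intro mult_right_mono) auto
      then have "h * ?d \<le> ?d\<^sup>2" by (simp only: power2_eq_square)
      then have "(\<bar>q\<bar> + \<kappa>) / h * (h * ?d) \<le> (\<bar>q\<bar> + \<kappa>) / h * ?d\<^sup>2"
        using h \<kappa> by (intro mult_left_mono) auto
      then show ?thesis using h by simp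
    qed
    moreover have "q * (y - x) \<le> \<bar>q\<bar> * ?d" by (metis abs_ge_self abs_mult)
    moreover have "\<kappa> * max 0 (s * (y - x)) \<le> \<kappa> * ?d"
    proof -
      have "s * (y - x) \<le> ?d" using abs_ge_self[of "s * (y - x)"] s by (simp add: abs_mult)
      then show ?thesis using \<kappa> by (intro mult_left_mono) auto
    qed
    moreover have "0 \<le> \<eta> * ?d" using \<kappa> by (simp add: \<eta>_def)
    moreover have "B * (y - x)\<^sup>2 = A / h\<^sup>2 * ?d\<^sup>2 + (\<bar>q\<bar> + \<kappa>) / h * ?d\<^sup>2"
      by (simp add: B_def algebra_simps)
    ultimately have "l y \<le> 0" unfolding l_def by (simp add: distrib_right)
    then show ?thesis using U[OF y] by linarith
  qed
  obtain C where C: "0 \<le> C" and CE: "\<And>r A q \<kappa> \<eta> B s. \<lbrakk>0 \<le> \<kappa>; 0 \<le> \<eta>; 0 \<le> B; \<bar>s\<bar> = 1\<rbrakk> \<Longrightarrow>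
     (let t = 1 / 2 ^ r; l = \<lambda>y. A + q * (y - x) + \<kappa> * max 0 (s * (y - x)) - \<eta> * \<bar>y - x\<bar> - B * (y - x)\<^sup>2 in
       integrable M (\<lambda>\<omega>. l (X x t \<omega>)) \<and>
       A + (\<kappa> / 2 - \<eta>) * (\<bar>\<sigma> x\<bar> * (sqrt t * sqrt (2 / pi))) - (\<bar>q\<bar> + \<kappa> + \<eta>) * (C * t) - B * (C * t)
         \<le> expectation (\<lambda>\<omega>. l (X x t \<omega>)))"
    using kink_expectation[OF x] by blast
  define c where "c = \<kappa> / 8 * (\<bar>\<sigma> x\<bar> * sqrt (2 / pi))"
  define D where "D = (\<bar>q\<bar> + \<kappa> + \<eta>) * C + B * C + 1"
  have c: "0 < c" using \<kappa> \<sigma> by (simp add: c_def)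
  have D: "0 < D" using C B \<kappa> by (auto simp: D_def \<eta>_def intro!: add_nonneg_pos)
  have lim: "(\<lambda>r. sqrt (1 / 2 ^ r)) \<longlonglongrightarrow> 0"
  proof -
    have "(\<lambda>r. sqrt ((1/2) ^ r)) \<longlonglongrightarrow> sqrt 0" by (intro tendsto_real_sqrt LIMSEQ_realpow_zero) auto
    then show ?thesis by (simp add: power_one_over)
  qed
  have "\<forall>\<^sub>F r in sequentially. sqrt (1 / 2 ^ r) < c / D"
    by (rule order_tendstoD(2)[OF lim]) (use c D in simp)
  then have "\<forall>\<^sub>F r in sequentially. \<forall>d\<ge>0.
    ennreal (d * (A + c * sqrt (1 / 2 ^ r))) \<le> (\<integral>\<^sup>+\<omega>. ennreal (d * U (X x (1 / 2 ^ r) \<omega>)) \<partial>M)"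
  proof eventually_elim
    case (elim r)
    let ?t = "1 / (2::real) ^ r"
    have int: "integrable M (\<lambda>\<omega>. l (X x ?t \<omega>))"
      and low: "A + (\<kappa> / 2 - \<eta>) * (\<bar>\<sigma> x\<bar> * (sqrt ?t * sqrt (2 / pi))) - (\<bar>q\<bar> + \<kappa> + \<eta>) * (C * ?t) - B * (C * ?t)
         \<le> expectation (\<lambda>\<omega>. l (X x ?t \<omega>))"
      using CE[of \<kappa> \<eta> B s r A q] \<kappa> B s unfolding l_def Let_def by (auto simp: \<eta>_def)
    have st: "sqrt ?t * sqrt ?t = ?t" by simp
    have "D * sqrt ?t \<le> c" using elim D by (simp add: field_simps)
    then have "D * sqrt ?t * sqrt ?t \<le> c * sqrt ?t" by (rule mult_right_mono) simp
    then have Dt: "D * ?t \<le> c * sqrt ?t" unfolding mult.assoc st .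
    have "(\<kappa> / 2 - \<eta>) * (\<bar>\<sigma> x\<bar> * (sqrt ?t * sqrt (2 / pi))) = 2 * c * sqrt ?t"
      by (simp add: c_def \<eta>_def)
    moreover have "(\<bar>q\<bar> + \<kappa> + \<eta>) * (C * ?t) + B * (C * ?t) \<le> D * ?t"
    proof -
      have "D * ?t = (\<bar>q\<bar> + \<kappa> + \<eta>) * (C * ?t) + B * (C * ?t) + ?t" unfolding D_def distrib_right by simp
      moreover have "0 \<le> ?t" by simp
      ultimately show ?thesis by linarith
    qed
    ultimately have E: "A + c * sqrt ?t \<le> expectation (\<lambda>\<omega>. l (X x ?t \<omega>))" using low Dt by linarith
    show ?case
    proof (intro allI impI)
      fix d :: real assume d: "0 \<le> d"
      have "d * (A + c * sqrt ?t) \<le> expectation (\<lambda>\<omega>. d * l (X x ?t \<omega>))"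
        using mult_left_mono[OF E d] by simp
      then have "ennreal (d * (A + c * sqrt ?t)) \<le> ennreal (expectation (\<lambda>\<omega>. d * l (X x ?t \<omega>)))"
        by (rule ennreal_leI)
      also have "\<dots> \<le> ennreal (expectation (\<lambda>\<omega>. max 0 (d * l (X x ?t \<omega>))))"
        using int by (intro ennreal_leI integral_mono) auto
      also have "\<dots> = (\<integral>\<^sup>+\<omega>. ennreal (max 0 (d * l (X x ?t \<omega>))) \<partial>M)"
        using int by (intro nn_integral_eq_integral[symmetric]) auto
      also have "\<dots> \<le> (\<integral>\<^sup>+\<omega>. ennreal (d * U (X x ?t \<omega>)) \<partial>M)"
      proof (rule nn_integral_mono)
        fix \<omega> assume "\<omega> \<in> space M"
        then have y: "X x ?t \<omega> \<in> \<X>" using X_paths(3)[OF x] by simp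
        show "ennreal (max 0 (d * l (X x ?t \<omega>))) \<le> ennreal (d * U (X x ?t \<omega>))"
          using mult_left_mono[OF lU[OF y] d] U[OF y] d by (intro ennreal_leI) auto
      qed
      finally show "ennreal (d * (A + c * sqrt ?t)) \<le> (\<integral>\<^sup>+\<omega>. ennreal (d * U (X x ?t \<omega>)) \<partial>M)" .
    qed
  qed
  with c show ?thesis by blast
qed

text \<open>The state space contains points on both sides of \<open>x\<close>: applied to \<open>max 0 (s * (y - x))\<close>, the kink
  estimate shows that the diffusion reaches each side with positive probability.  Consequently the one-sided
  derivatives at \<open>x\<close> are taken along nontrivial filters.\<close>

lemma diffusion_crosses:
  assumes x: "x \<in> \<X>" and \<sigma>: "\<sigma> x \<noteq> 0" and s: "\<bar>s\<bar> = 1"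
  shows "\<exists>y\<in>\<X>. 0 < s * (y - x)"
proof -
  have "\<exists>c>0. \<forall>\<^sub>F r in sequentially. \<forall>d\<ge>0.
    ennreal (d * (0 + c * sqrt (1 / 2 ^ r))) \<le> (\<integral>\<^sup>+\<omega>. ennreal (d * max 0 (s * (X x (1 / 2 ^ r) \<omega> - x))) \<partial>M)"
    by (rule expectation_above_kink[OF x \<sigma>, where q=0 and \<kappa>=1]) (use s in \<open>auto intro!: exI[of _ 1]\<close>)
  then obtain c where c: "0 < c" and ev: "\<forall>\<^sub>F r in sequentially. \<forall>d\<ge>0.
    ennreal (d * (0 + c * sqrt (1 / 2 ^ r))) \<le> (\<integral>\<^sup>+\<omega>. ennreal (d * max 0 (s * (X x (1 / 2 ^ r) \<omega> - x))) \<partial>M)" by blast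
  obtain r :: nat where r: "\<And>d. d \<ge> 0 \<Longrightarrow>
    ennreal (d * (0 + c * sqrt (1 / 2 ^ r))) \<le> (\<integral>\<^sup>+\<omega>. ennreal (d * max 0 (s * (X x (1 / 2 ^ r) \<omega> - x))) \<partial>M)"
    using eventually_happens[OF ev] by auto
  show ?thesis
  proof (rule ccontr)
    assume no: "\<not> ?thesis"
    have "(\<integral>\<^sup>+\<omega>. ennreal (1 * max 0 (s * (X x (1 / 2 ^ r) \<omega> - x))) \<partial>M) = (\<integral>\<^sup>+\<omega>. 0 \<partial>M)"
    proof (rule nn_integral_cong)
      fix \<omega> assume "\<omega> \<in> space M"
      then have "X x (1 / 2 ^ r) \<omega> \<in> \<X>" using X_paths(3)[OF x] by simp
      then have "s * (X x (1 / 2 ^ r) \<omega> - x) \<le> 0" using no by (auto simp: not_less)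
      then show "ennreal (1 * max 0 (s * (X x (1 / 2 ^ r) \<omega> - x))) = 0" by simp
    qed
    moreover have "0 < 1 * (0 + c * sqrt (1 / 2 ^ r))" using c by simp
    ultimately show False
      using r[of 1] ennreal_less_zero_iff[of "1 * (0 + c * sqrt (1 / 2 ^ r))"] by (simp only: nn_integral_const) simp
  qed
qed

end

section \<open>Weak equilibria\<close>

locale stopping_problem = lipschitz_diffusion M F W \<X> \<mu> \<sigma> X L
  for M :: "'w measure" and F W \<X> \<mu> \<sigma> X L +
  fixes \<delta> f :: "real \<Rightarrow> real" and S :: "real set"
  assumes interval: "is_interval \<X>" and \<sigma>_nonzero: "\<And>y. y \<in> \<X> \<Longrightarrow> \<sigma> y \<noteq> 0"
    and discount: "discount_function \<delta>"
    and supermult: "\<And>s t. 0 \<le> s \<Longrightarrow> 0 \<le> t \<Longrightarrow> \<delta> t * \<delta> s \<le> \<delta> (t + s)"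
    and f_cont: "continuous_on \<X> f" and f_nonneg: "\<And>y. y \<in> \<X> \<Longrightarrow> 0 \<le> f y"
    and growth: "growth_condition M \<X> X \<delta> f"
    and equilibrium: "weak_equilibrium M \<X> X \<delta> f S"
begin

abbreviation v :: "real \<Rightarrow> real" where "v y \<equiv> V M X \<delta> f 0 y S"

lemma S_closed: "closedin (top_of_set \<X>) S" and S_sub: "S \<subseteq> \<X>"
  using equilibrium closedin_subset[of "top_of_set \<X>" S] by (auto simp: weak_equilibrium_def)

lemma \<delta>_derivative: obtains d where "(\<delta> has_real_derivative d) (at 0 within {0..})" "continuous_on {0..} \<delta>"
proof -
  have "Ck_on 1 {0..} \<delta>" using discount by (simp add: discount_function_def)
  then obtain D :: "nat \<Rightarrow> real \<Rightarrow> real" where DD: "\<forall>t\<in>{0..}. D 0 t = \<delta> t"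
    "\<forall>j<1. \<forall>t\<in>{0..}. (D j has_real_derivative D (Suc j) t) (at t within {0..})"
    "\<forall>j\<le>1. continuous_on {0..} (D j)"
    unfolding Ck_on_def by (elim exE conjE)
  have D: "\<And>t. t \<in> {0..} \<Longrightarrow> D 0 t = \<delta> t"
    "\<And>t. t \<in> {0..} \<Longrightarrow> (D 0 has_real_derivative D 1 t) (at t within {0..})" "continuous_on {0..} (D 0)"
    using DD(1) DD(2)[rule_format, of 0] DD(3)[rule_format, of 0] by auto
  have "(\<delta> has_real_derivative D 1 0) (at 0 within {0..})"
    by (rule has_field_derivative_transform_within[OF D(2) zero_less_one]) (use D(1) in auto)
  moreover have "continuous_on {0..} \<delta>" using D(3) by (rule continuous_on_eq) (use D(1) in auto)
  ultimately show thesis by (rule that)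
qed

lemma \<delta>_cont: "continuous_on {0..} \<delta>" using \<delta>_derivative by blast

lemma \<delta>_bounds: "0 \<le> t \<Longrightarrow> 0 \<le> \<delta> t" "0 \<le> t \<Longrightarrow> \<delta> t \<le> 1" "\<delta> 0 = 1"
  using discount by (auto simp: discount_function_def)

lemma \<delta>_lower: obtains b h where "0 \<le> b" "0 < h" "\<And>t. 0 \<le> t \<Longrightarrow> t < h \<Longrightarrow> 1 - b * t \<le> \<delta> t"
proof -
  obtain d where "(\<delta> has_real_derivative d) (at 0 within {0..})" using \<delta>_derivative by blast
  then have "\<forall>e>0. \<exists>h>0. \<forall>t\<in>{0..}. norm (t - 0) < h \<longrightarrow> norm (\<delta> t - \<delta> 0 - d * (t - 0)) \<le> e * norm (t - 0)"
    unfolding has_field_derivative_def has_derivative_within_alt by blast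
  from this[rule_format, OF zero_less_one] obtain h
    where "0 < h" "\<forall>t\<in>{0..}. norm (t - 0) < h \<longrightarrow> norm (\<delta> t - \<delta> 0 - d * (t - 0)) \<le> 1 * norm (t - 0)" by blast
  then have h: "0 < h" "\<And>t. 0 \<le> t \<Longrightarrow> \<bar>t\<bar> < h \<Longrightarrow> \<bar>\<delta> t - 1 - d * t\<bar> \<le> 1 * \<bar>t\<bar>"
    using \<delta>_bounds(3) by auto
  have "1 - (\<bar>d\<bar> + 1) * t \<le> \<delta> t" if "0 \<le> t" "t < h" for t
  proof -
    have "- (d * t) \<le> \<bar>d\<bar> * t" using that abs_ge_minus_self[of "d * t"] by (simp add: abs_mult)
    then show ?thesis using h(2)[of t] that by (simp add: algebra_simps)
  qed
  then show thesis using that[of "\<bar>d\<bar> + 1" h] h(1) by simp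
qed

text \<open>The payoff of the first visit to \<open>S\<close> at or after time \<open>\<epsilon>\<close>.\<close>

definition pay :: "real \<Rightarrow> real \<Rightarrow> 'w \<Rightarrow> real" where
  "pay \<epsilon> y \<omega> = discounted_payoff \<delta> f 0 (\<lambda>u. X y u \<omega>) (hitting_time_from \<epsilon> (\<lambda>u. X y u \<omega>) S)"

text \<open>The second bound is supermultiplicativity of the discount function at the hitting time; the third
  one prepares domination by the growth condition.\<close>

lemma discounted_payoff_cases:
  assumes "y \<in> \<X>" "\<omega> \<in> space M" "0 \<le> \<epsilon>" "0 \<le> t"
  shows "0 \<le> discounted_payoff \<delta> f t (\<lambda>u. X y u \<omega>) (hitting_time_from \<epsilon> (\<lambda>u. X y u \<omega>) S)"
    and "\<delta> t * pay \<epsilon> y \<omega> \<le> discounted_payoff \<delta> f t (\<lambda>u. X y u \<omega>) (hitting_time_from \<epsilon> (\<lambda>u. X y u \<omega>) S)"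
    and "\<exists>r\<ge>0. pay \<epsilon> y \<omega> \<le> \<delta> r * f (X y r \<omega>)"
proof -
  have "0 \<le> discounted_payoff \<delta> f t (\<lambda>u. X y u \<omega>) (hitting_time_from \<epsilon> (\<lambda>u. X y u \<omega>) S) \<and>
    \<delta> t * pay \<epsilon> y \<omega> \<le> discounted_payoff \<delta> f t (\<lambda>u. X y u \<omega>) (hitting_time_from \<epsilon> (\<lambda>u. X y u \<omega>) S) \<and>
    (\<exists>r\<ge>0. pay \<epsilon> y \<omega> \<le> \<delta> r * f (X y r \<omega>))"
  proof (cases rule: hitting_time_from_cases[OF assms(3), of "\<lambda>u. X y u \<omega>" S])
    case 1
    have "0 \<le> \<delta> 0 * f (X y 0 \<omega>)" using f_nonneg[OF X_paths(3)[OF assms(1,2), of 0]] \<delta>_bounds by simp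
    then show ?thesis using 1 by (auto simp: discounted_payoff_def pay_def intro!: exI[of _ 0])
  next
    case (2 r)
    then have r: "0 \<le> r" using assms(3) by linarith
    have f0: "0 \<le> f (X y r \<omega>)" using f_nonneg[OF X_paths(3)[OF assms(1,2) r]] .
    have "\<delta> t * \<delta> r * f (X y r \<omega>) \<le> \<delta> (t + r) * f (X y r \<omega>)"
      by (rule mult_right_mono[OF supermult[OF r assms(4)] f0])
    then show ?thesis using 2 r f0 \<delta>_bounds(1)[of "t + r"] assms(4)
      by (auto simp: discounted_payoff_def pay_def mult.assoc)
  qed
  then show "0 \<le> discounted_payoff \<delta> f t (\<lambda>u. X y u \<omega>) (hitting_time_from \<epsilon> (\<lambda>u. X y u \<omega>) S)"
    "\<delta> t * pay \<epsilon> y \<omega> \<le> discounted_payoff \<delta> f t (\<lambda>u. X y u \<omega>) (hitting_time_from \<epsilon> (\<lambda>u. X y u \<omega>) S)"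
    "\<exists>r\<ge>0. pay \<epsilon> y \<omega> \<le> \<delta> r * f (X y r \<omega>)" by blast+
qed

lemma pay_nonneg: "y \<in> \<X> \<Longrightarrow> \<omega> \<in> space M \<Longrightarrow> 0 \<le> \<epsilon> \<Longrightarrow> 0 \<le> pay \<epsilon> y \<omega>"
  using discounted_payoff_cases(1)[of y \<omega> \<epsilon> 0] by (simp add: pay_def)

lemma path_payoff_dyadic_path:
  assumes "S \<noteq> {}" "y \<in> \<X>" "\<omega> \<in> space M" "0 \<le> s" "0 \<le> c"
  shows "path_payoff \<X> S \<delta> f c (dyadic_path y s \<omega>)
    = ennreal (discounted_payoff \<delta> f c (\<lambda>u. X y (s + u) \<omega>) (hitting_time_from 0 (\<lambda>u. X y (s + u) \<omega>) S))"
  unfolding dyadic_path_def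
proof (rule path_payoff_eq[OF _ _ S_closed assms(1,5)])
  show "continuous_on {0..} (\<lambda>u. X y (s + u) \<omega>)"
    by (rule continuous_on_compose2[OF X_paths(2)[OF assms(2,3)]]) (use assms(4) in \<open>auto intro!: continuous_intros\<close>)
  show "X y (s + t) \<omega> \<in> \<X>" if "0 \<le> t" for t using X_paths(3)[OF assms(2,3)] assms(4) that by simp
qed

lemma path_payoff_pay:
  assumes "S \<noteq> {}" "y \<in> \<X>" "\<omega> \<in> space M" "0 \<le> \<epsilon>"
  shows "path_payoff \<X> S \<delta> f \<epsilon> (dyadic_path y \<epsilon> \<omega>) = ennreal (pay \<epsilon> y \<omega>)"
  using path_payoff_dyadic_path[OF assms assms(4)] discounted_payoff_shift[OF assms(4), of \<delta> f "\<lambda>u. X y u \<omega>" S]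
  by (simp add: pay_def)

lemma pay_measurable:
  assumes "S \<noteq> {}" "y \<in> \<X>" "0 \<le> \<epsilon>"
  shows "pay \<epsilon> y \<in> borel_measurable M"
proof -
  have "(\<lambda>\<omega>. enn2real (path_payoff \<X> S \<delta> f \<epsilon> (dyadic_path y \<epsilon> \<omega>))) \<in> borel_measurable M"
    using measurable_compose[OF dyadic_path_measurable[OF assms(2,3)] path_payoff_measurable[OF interval \<delta>_cont f_cont]]
    by simp
  then show ?thesis
    by (rule measurable_cong[THEN iffD1, rotated])
       (use path_payoff_pay[OF assms(1,2) _ assms(3)] pay_nonneg[OF assms(2) _ assms(3)] in simp)
qed

text \<open>The payoff is bounded by \<open>1\<close> plus its power of exponent \<open>1 + \<zeta>\<close>, and that power lies below the
  supremum in the growth condition.\<close>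

lemma pay_integrable:
  assumes "S \<noteq> {}" "y \<in> \<X>" "0 \<le> \<epsilon>"
  shows "integrable M (pay \<epsilon> y)"
proof -
  have [measurable]: "pay \<epsilon> y \<in> borel_measurable M" by (rule pay_measurable[OF assms])
  obtain \<zeta> where \<zeta>: "0 < \<zeta>"
    and fin: "(\<integral>\<^sup>+\<omega>. (SUP t\<in>{0..}. ennreal ((\<delta> t * f (X y t \<omega>)) powr (1 + \<zeta>))) \<partial>M) < \<infinity>"
    using growth assms(2) unfolding growth_condition_def by blast
  have "(\<integral>\<^sup>+\<omega>. ennreal (norm (pay \<epsilon> y \<omega>)) \<partial>M) \<le> (\<integral>\<^sup>+\<omega>. 1 + ennreal (pay \<epsilon> y \<omega> powr (1 + \<zeta>)) \<partial>M)"
  proof (rule nn_integral_mono)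
    fix \<omega> assume \<omega>: "\<omega> \<in> space M"
    let ?p = "pay \<epsilon> y \<omega>"
    have p: "0 \<le> ?p" by (rule pay_nonneg[OF assms(2) \<omega> assms(3)])
    have "?p \<le> 1 + ?p powr (1 + \<zeta>)"
    proof (cases "?p \<le> 1")
      case False
      then have "?p powr 1 \<le> ?p powr (1 + \<zeta>)" using \<zeta> by (intro powr_mono) auto
      then show ?thesis using p by simp
    qed (simp add: add_increasing2)
    then have "ennreal ?p \<le> ennreal (1 + ?p powr (1 + \<zeta>))" by (rule ennreal_leI)
    then show "ennreal (norm ?p) \<le> 1 + ennreal (?p powr (1 + \<zeta>))" using p by simp
  qed
  also have "\<dots> = 1 + (\<integral>\<^sup>+\<omega>. ennreal (pay \<epsilon> y \<omega> powr (1 + \<zeta>)) \<partial>M)"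
    by (simp add: nn_integral_add emeasure_space_1)
  also have "\<dots> \<le> 1 + (\<integral>\<^sup>+\<omega>. (SUP t\<in>{0..}. ennreal ((\<delta> t * f (X y t \<omega>)) powr (1 + \<zeta>))) \<partial>M)"
  proof (intro add_left_mono nn_integral_mono)
    fix \<omega> assume \<omega>: "\<omega> \<in> space M"
    obtain r where r: "0 \<le> r" "pay \<epsilon> y \<omega> \<le> \<delta> r * f (X y r \<omega>)"
      using discounted_payoff_cases(3)[OF assms(2) \<omega> assms(3), of 0] by auto
    have "ennreal (pay \<epsilon> y \<omega> powr (1 + \<zeta>)) \<le> ennreal ((\<delta> r * f (X y r \<omega>)) powr (1 + \<zeta>))"
      using r(2) pay_nonneg[OF assms(2) \<omega> assms(3)] \<zeta> by (intro ennreal_leI powr_mono2) auto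
    also have "\<dots> \<le> (SUP t\<in>{0..}. ennreal ((\<delta> t * f (X y t \<omega>)) powr (1 + \<zeta>)))"
      by (rule SUP_upper) (use r in simp)
    finally show "ennreal (pay \<epsilon> y \<omega> powr (1 + \<zeta>)) \<le> (SUP t\<in>{0..}. ennreal ((\<delta> t * f (X y t \<omega>)) powr (1 + \<zeta>)))" .
  qed
  also have "\<dots> < \<infinity>" using fin by simp
  finally show ?thesis by (intro integrableI_bounded) auto
qed

text \<open>Hits at time \<open>0\<close> count, so that a start in \<open>S\<close> stops at once.  The first visit at or after time \<open>\<epsilon>\<close> is
  counted in the same way, so \<open>U\<close> and not \<open>v\<close> appears when the Markov property is applied at \<open>\<epsilon>\<close>.\<close>

definition U :: "real \<Rightarrow> real" where "U y = expectation (pay 0 y)"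

lemma U_nonneg: "y \<in> \<X> \<Longrightarrow> 0 \<le> U y"
  unfolding U_def by (intro integral_nonneg_AE AE_I2 pay_nonneg) auto

lemma U_on_S:
  assumes "y \<in> S" shows "U y = f y"
proof -
  have y: "y \<in> \<X>" using assms S_sub by auto
  have "pay 0 y \<omega> = f y" if \<omega>: "\<omega> \<in> space M" for \<omega>
  proof -
    have "hitting_time_from 0 (\<lambda>u. X y u \<omega>) S \<le> ereal 0"
      by (rule hitting_time_from_le) (use X_paths(1)[OF y \<omega>] assms in auto)
    moreover have "0 \<le> hitting_time_from 0 (\<lambda>u. X y u \<omega>) S"
      unfolding hitting_time_from_def by (rule INF_greatest) simp
    ultimately have "hitting_time_from 0 (\<lambda>u. X y u \<omega>) S = 0" by (simp add: zero_ereal_def[symmetric] antisym)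
    then show ?thesis using X_paths(1)[OF y \<omega>] \<delta>_bounds(3) by (simp add: pay_def discounted_payoff_def)
  qed
  then have "U y = expectation (\<lambda>_. f y)" unfolding U_def by (intro Bochner_Integration.integral_cong) auto
  then show ?thesis by (simp add: prob_space)
qed

lemma U_off_S:
  assumes "y \<in> \<X> - S" shows "U y = v y" "f y \<le> v y"
proof -
  show "f y \<le> v y" using equilibrium assms by (auto simp: weak_equilibrium_def J_def)
  have "hitting_time_from 0 (\<lambda>u. X y u \<omega>) S = hitting_time (\<lambda>u. X y u \<omega>) S" if \<omega>: "\<omega> \<in> space M" for \<omega>
  proof -
    have "X y 0 \<omega> \<notin> S" using X_paths(1)[OF _ \<omega>, of y] assms by auto
    then have "{t. 0 \<le> t \<and> X y t \<omega> \<in> S} = {t. 0 < t \<and> X y t \<omega> \<in> S}" by (auto simp: less_le)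
    then show ?thesis by (simp add: hitting_time_from_def hitting_time_def)
  qed
  then show "U y = v y" unfolding U_def V_def pay_def by (intro Bochner_Integration.integral_cong) auto
qed

lemma f_le_U: "y \<in> \<X> \<Longrightarrow> f y \<le> U y"
  using U_on_S U_off_S by (cases "y \<in> S") auto

text \<open>The Markov property at time \<open>t = 1 / 2 ^ r\<close>, followed by \<open>\<delta> (t + \<rho>) \<ge> \<delta> t * \<delta> \<rho>\<close>.\<close>

lemma continuation_value_le:
  assumes S: "S \<noteq> {}" and x: "x \<in> \<X>"
  shows "(\<integral>\<^sup>+\<omega>. ennreal (\<delta> (1 / 2 ^ r) * U (X x (1 / 2 ^ r) \<omega>)) \<partial>M) \<le> ennreal (expectation (pay (1 / 2 ^ r) x))"
proof -
  let ?t = "1 / (2::real) ^ r"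
  have t: "dyadic (r, 1) = ?t" "0 \<le> ?t" by auto
  have meas: "path_payoff \<X> S \<delta> f ?t \<in> borel_measurable borel"
    by (rule path_payoff_measurable[OF interval \<delta>_cont f_cont])
  have "ennreal (expectation (pay ?t x)) = (\<integral>\<^sup>+\<omega>. ennreal (pay ?t x \<omega>) \<partial>M)"
    using pay_nonneg[OF x _ t(2)] by (intro nn_integral_eq_integral[symmetric] pay_integrable[OF S x t(2)] AE_I2)
  also have "\<dots> = (\<integral>\<^sup>+\<omega>. path_payoff \<X> S \<delta> f ?t (dyadic_path x ?t \<omega>) \<partial>M)"
    by (intro nn_integral_cong path_payoff_pay[OF S x _ t(2), symmetric])
  also have "\<dots> = (\<integral>\<^sup>+\<omega>. (\<integral>\<^sup>+\<omega>'. path_payoff \<X> S \<delta> f ?t (dyadic_path (X x ?t \<omega>) 0 \<omega>') \<partial>M) \<partial>M)"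
    using markov_property[OF x meas, of "(r, 1)"] unfolding t(1) .
  also have "\<dots> \<ge> (\<integral>\<^sup>+\<omega>. ennreal (\<delta> ?t * U (X x ?t \<omega>)) \<partial>M)"
  proof (rule nn_integral_mono)
    fix \<omega> assume "\<omega> \<in> space M"
    then have y: "X x ?t \<omega> \<in> \<X>" (is "?y \<in> _") using X_paths(3)[OF x] by simp
    have int: "integrable M (pay 0 ?y)" by (rule pay_integrable[OF S y order_refl])
    have "ennreal (\<delta> ?t * U ?y) = ennreal (expectation (\<lambda>\<omega>'. \<delta> ?t * pay 0 ?y \<omega>'))"
      unfolding U_def by simp
    also have "\<dots> = (\<integral>\<^sup>+\<omega>'. ennreal (\<delta> ?t * pay 0 ?y \<omega>') \<partial>M)"
      using int pay_nonneg[OF y] \<delta>_bounds(1)[OF t(2)] by (intro nn_integral_eq_integral[symmetric] AE_I2) auto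
    also have "\<dots> \<le> (\<integral>\<^sup>+\<omega>'. path_payoff \<X> S \<delta> f ?t (dyadic_path ?y 0 \<omega>') \<partial>M)"
    proof (rule nn_integral_mono)
      fix \<omega>' assume \<omega>': "\<omega>' \<in> space M"
      show "ennreal (\<delta> ?t * pay 0 ?y \<omega>') \<le> path_payoff \<X> S \<delta> f ?t (dyadic_path ?y 0 \<omega>')"
        using discounted_payoff_cases(2)[OF y \<omega>' order_refl t(2)]
        unfolding path_payoff_dyadic_path[OF S y \<omega>' order_refl t(2)] by (intro ennreal_leI) simp
    qed
    finally show "ennreal (\<delta> ?t * U ?y) \<le> (\<integral>\<^sup>+\<omega>'. path_payoff \<X> S \<delta> f ?t (dyadic_path ?y 0 \<omega>') \<partial>M)" .
  qed
  finally show ?thesis .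
qed

lemma equilibrium_dyadic:
  assumes x: "x \<in> S"
  shows "\<forall>\<^sub>F r in sequentially. expectation (pay (1 / 2 ^ r) x) < f x + 1 / 2 ^ r"
proof -
  have "ereal (-1) < Liminf (at_right 0) (\<lambda>\<epsilon>. ereal ((f x - expectation (pay \<epsilon> x)) / \<epsilon>))"
    using equilibrium x less_le_trans[of "ereal (-1)" 0] unfolding weak_equilibrium_def pay_def by auto
  then have "\<forall>\<^sub>F \<epsilon> in at_right 0. ereal (-1) < ereal ((f x - expectation (pay \<epsilon> x)) / \<epsilon>)" by (rule less_LiminfD)
  moreover have "filterlim (\<lambda>r. 1 / (2::real) ^ r) (at_right 0) sequentially"
    unfolding filterlim_at
    using LIMSEQ_realpow_zero[of "1/2::real"] by (auto simp: power_one_over)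
  ultimately have "\<forall>\<^sub>F r in sequentially. ereal (-1) < ereal ((f x - expectation (pay (1 / 2 ^ r) x)) / (1 / 2 ^ r))"
    by (rule eventually_compose_filterlim)
  then show ?thesis
  proof eventually_elim
    case (elim r)
    then have "-1 < (f x - expectation (pay (1 / 2 ^ r) x)) / (1 / 2 ^ r)" by (simp only: less_ereal.simps)
    then show ?case by (simp add: field_simps)
  qed
qed

text \<open>By Fatou's lemma, since the equilibrium condition eventually bounds the expected payoffs of the first
  visits after \<open>1 / 2 ^ r\<close> by \<open>f x + 1 / 2 ^ r\<close>, and these payoffs converge to the one in \<open>v x\<close>.\<close>

lemma v_le_f_on_S:
  assumes x: "x \<in> S" shows "v x \<le> f x"
proof -
  have S: "S \<noteq> {}" and xX: "x \<in> \<X>" using x S_sub by auto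
  let ?Y = "\<lambda>\<omega>. discounted_payoff \<delta> f 0 (\<lambda>s. X x s \<omega>) (hitting_time (\<lambda>s. X x s \<omega>) S)"
  have lim: "(\<lambda>r. pay (1 / 2 ^ r) x \<omega>) \<longlonglongrightarrow> ?Y \<omega>" if "\<omega> \<in> space M" for \<omega>
    unfolding pay_def by (rule discounted_payoff_tendsto[OF X_paths(2,3)[OF xX that] f_cont \<delta>_cont])
  show ?thesis
  proof (cases "integrable M ?Y")
    case True
    have Y0: "0 \<le> ?Y \<omega>" if "\<omega> \<in> space M" for \<omega>
      by (rule LIMSEQ_le_const[OF lim[OF that]]) (use pay_nonneg[OF xX that] in auto)
    have "ennreal (v x) = (\<integral>\<^sup>+\<omega>. ennreal (?Y \<omega>) \<partial>M)"
      unfolding V_def using Y0 by (intro nn_integral_eq_integral[symmetric] True AE_I2)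
    also have "\<dots> = (\<integral>\<^sup>+\<omega>. liminf (\<lambda>r. ennreal (pay (1 / 2 ^ r) x \<omega>)) \<partial>M)"
      by (intro nn_integral_cong lim_imp_Liminf[symmetric] tendsto_ennrealI lim) auto
    also have "\<dots> \<le> liminf (\<lambda>r. \<integral>\<^sup>+\<omega>. ennreal (pay (1 / 2 ^ r) x \<omega>) \<partial>M)"
      using pay_measurable[OF S xX] by (intro nn_integral_liminf) simp
    also have "\<dots> = liminf (\<lambda>r. ennreal (expectation (pay (1 / 2 ^ r) x)))"
      using pay_nonneg[OF xX] pay_integrable[OF S xX]
      by (intro arg_cong[where f=liminf] ext nn_integral_eq_integral AE_I2) auto
    also have "\<dots> \<le> liminf (\<lambda>r. ennreal (f x + 1 / 2 ^ r))"
      by (intro Liminf_mono eventually_mono[OF equilibrium_dyadic[OF x]] ennreal_leI) auto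
    also have "\<dots> = ennreal (f x)"
    proof (intro lim_imp_Liminf tendsto_ennrealI)
      have "(\<lambda>r. f x + (1/2) ^ r) \<longlonglongrightarrow> f x + 0" by (intro tendsto_add tendsto_const LIMSEQ_realpow_zero) auto
      then show "(\<lambda>r. f x + 1 / 2 ^ r) \<longlonglongrightarrow> f x" by (simp add: power_one_over)
    qed simp
    finally show ?thesis using f_nonneg[OF xX] by (simp add: ennreal_le_iff)
  next
    case False
    \<comment> \<open>The Bochner integral of a function that is not integrable is \<open>0\<close>.\<close>
    then have "v x = 0" unfolding V_def by (rule not_integrable_integral_eq)
    then show ?thesis using f_nonneg[OF xX] by simp
  qed
qed

text \<open>Continuity keeps the path in \<open>S\<close> for a short time, so the strict hitting time is \<open>0\<close>.\<close>

lemma v_interior: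
  assumes "y \<in> (top_of_set \<X>) interior_of S" shows "v y = f y"
proof -
  obtain G where G: "open G" "y \<in> G" "\<X> \<inter> G \<subseteq> S" and y: "y \<in> \<X>"
  proof -
    obtain T where "openin (top_of_set \<X>) T" "y \<in> T" "T \<subseteq> S" using assms by (auto simp: interior_of_def)
    then show thesis using that by (auto simp: openin_open)
  qed
  have "discounted_payoff \<delta> f 0 (\<lambda>s. X y s \<omega>) (hitting_time (\<lambda>s. X y s \<omega>) S) = f y" if \<omega>: "\<omega> \<in> space M" for \<omega>
  proof -
    have "hitting_time (\<lambda>s. X y s \<omega>) S \<le> 0 + ereal e" if e: "0 < e" for e
    proof -
      have "(\<lambda>r. X y (e * (1/2) ^ r) \<omega>) \<longlonglongrightarrow> X y 0 \<omega>"
      proof (rule continuous_on_tendsto_compose[OF X_paths(2)[OF y \<omega>]])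
        have "(\<lambda>r. e * (1/2) ^ r) \<longlonglongrightarrow> e * 0" by (intro tendsto_mult tendsto_const LIMSEQ_realpow_zero) auto
        then show "(\<lambda>r. e * (1/2) ^ r) \<longlonglongrightarrow> 0" by simp
      qed (use e in auto)
      then have "\<forall>\<^sub>F r in sequentially. X y (e * (1/2) ^ r) \<omega> \<in> G"
        using G X_paths(1)[OF y \<omega>] by (intro topological_tendstoD) auto
      then obtain r :: nat where r: "X y (e * (1/2) ^ r) \<omega> \<in> G" using eventually_happens by force
      have t: "0 < e * (1/2) ^ r" "e * (1/2) ^ r \<le> e" using e by (auto simp: mult_left_le power_le_one)
      have "X y (e * (1/2) ^ r) \<omega> \<in> S" using r G(3) X_paths(3)[OF y \<omega>] t by auto
      then have "hitting_time (\<lambda>s. X y s \<omega>) S \<le> ereal (e * (1/2) ^ r)"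
        unfolding hitting_time_def by (intro INF_lower) (use t in simp)
      also have "\<dots> \<le> 0 + ereal e" using t by simp
      finally show ?thesis .
    qed
    then have "hitting_time (\<lambda>s. X y s \<omega>) S \<le> 0" by (rule ereal_le_epsilon2)
    moreover have "0 \<le> hitting_time (\<lambda>s. X y s \<omega>) S" unfolding hitting_time_def by (rule INF_greatest) simp
    ultimately have "hitting_time (\<lambda>s. X y s \<omega>) S = 0" by (rule antisym)
    then show ?thesis using X_paths(1)[OF y \<omega>] \<delta>_bounds(3) by (simp add: discounted_payoff_def)
  qed
  then have "v y = expectation (\<lambda>_. f y)" unfolding V_def by (intro Bochner_Integration.integral_cong) auto
  then show ?thesis by (simp add: prob_space)
qed

text \<open>With \<open>t = 1 / 2 ^ r\<close>, the kink gives \<open>\<delta> t * (f x + c * sqrt t) \<le> f x + t\<close>, while \<open>\<delta> t \<ge> 1 - b * t\<close>.  So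
  \<open>sqrt t\<close> would be bounded by a multiple of \<open>t\<close> as \<open>t\<close> tends to \<open>0\<close>.\<close>

lemma no_convex_kink:
  assumes x: "x \<in> S" and s: "\<bar>s\<bar> = 1" and \<kappa>: "0 < \<kappa>"
    and kink: "\<And>\<eta>. 0 < \<eta> \<Longrightarrow> \<exists>h>0. \<forall>y\<in>\<X>. \<bar>y - x\<bar> < h \<longrightarrow>
      f x + q * (y - x) + \<kappa> * max 0 (s * (y - x)) - \<eta> * \<bar>y - x\<bar> \<le> U y"
  shows False
proof -
  have S: "S \<noteq> {}" and xX: "x \<in> \<X>" using x S_sub by auto
  have f0: "0 \<le> f x" by (rule f_nonneg[OF xX])
  obtain c where c: "0 < c" and ev: "\<forall>\<^sub>F r in sequentially. \<forall>d\<ge>0.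
    ennreal (d * (f x + c * sqrt (1 / 2 ^ r))) \<le> (\<integral>\<^sup>+\<omega>. ennreal (d * U (X x (1 / 2 ^ r) \<omega>)) \<partial>M)"
    using expectation_above_kink[OF xX \<sigma>_nonzero[OF xX] f0 \<kappa> s U_nonneg kink] by blast
  obtain b h where b: "0 \<le> b" "0 < h" "\<And>t. 0 \<le> t \<Longrightarrow> t < h \<Longrightarrow> 1 - b * t \<le> \<delta> t" using \<delta>_lower by blast
  define D where "D = 1 + b * f x"
  have D: "0 < D" using b f0 by (auto simp: D_def intro!: add_pos_nonneg)
  have lim: "(\<lambda>r. 1 / (2::real) ^ r) \<longlonglongrightarrow> 0"
    using LIMSEQ_realpow_zero[of "1/2::real"] by (simp add: power_one_over)
  have lims: "(\<lambda>r. sqrt (1 / 2 ^ r)) \<longlonglongrightarrow> 0" using tendsto_real_sqrt[OF lim] by simp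
  have e1: "\<forall>\<^sub>F r in sequentially. 1 / (2::real) ^ r < h" by (rule order_tendstoD(2)[OF lim b(2)])
  have e2: "\<forall>\<^sub>F r in sequentially. 1 / (2::real) ^ r < 1 / (2 * (b + 1))"
    by (rule order_tendstoD(2)[OF lim]) (use b in simp)
  have e3: "\<forall>\<^sub>F r in sequentially. sqrt (1 / 2 ^ r) < c / (2 * D)"
    by (rule order_tendstoD(2)[OF lims]) (use c D in simp)
  have "\<forall>\<^sub>F r in sequentially. False"
    using ev e1 e2 e3 equilibrium_dyadic[OF x]
  proof eventually_elim
    case (elim r)
    let ?t = "1 / (2::real) ^ r"
    have t: "0 < ?t" by simp
    have \<delta>t: "1 - b * ?t \<le> \<delta> ?t" using b(3)[of ?t] elim(2) by simp
    have "?t * (2 * (b + 1)) < 1" using elim(3) b(1) by (simp add: field_simps)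
    moreover have "?t * (2 * (b + 1)) = 2 * (b * ?t) + 2 * ?t" by (simp add: distrib_left)
    ultimately have "b * ?t \<le> 1 / 2" using t by linarith
    then have half: "1 / 2 \<le> \<delta> ?t" "0 \<le> \<delta> ?t" using \<delta>t by linarith+
    have "ennreal (\<delta> ?t * (f x + c * sqrt ?t)) \<le> (\<integral>\<^sup>+\<omega>. ennreal (\<delta> ?t * U (X x ?t \<omega>)) \<partial>M)"
      using elim(1) half(2) by blast
    also have "\<dots> \<le> ennreal (expectation (pay ?t x))" by (rule continuation_value_le[OF S xX])
    also have "\<dots> \<le> ennreal (f x + ?t)" using elim(5) by (intro ennreal_leI) simp
    finally have le: "\<delta> ?t * (f x + c * sqrt ?t) \<le> f x + ?t" using f0 t by (subst (asm) ennreal_le_iff) auto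
    have "1 / 2 * (c * sqrt ?t) \<le> \<delta> ?t * (c * sqrt ?t)" using half c by (intro mult_right_mono) auto
    moreover have "(1 - b * ?t) * f x \<le> \<delta> ?t * f x" using \<delta>t f0 by (rule mult_right_mono)
    ultimately have "c / 2 * sqrt ?t \<le> ?t + b * ?t * f x" using le unfolding distrib_left left_diff_distrib by linarith
    also have "\<dots> = D * sqrt ?t * sqrt ?t" by (simp add: D_def algebra_simps)
    finally have "c / 2 \<le> D * sqrt ?t" by (rule mult_right_le_imp_le) simp
    moreover have "D * sqrt ?t < c / 2" using elim(4) D by (simp add: field_simps)
    ultimately show False by linarith
  qed
  then show False by simp
qed

end

text \<open>The one-sided derivative at \<open>x\<close> on the right for \<open>s = 1\<close> and on the left for \<open>s = -1\<close>.  The sign as a parameter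
  lets both sides share one argument.\<close>

definition side_slope :: "real \<Rightarrow> (real \<Rightarrow> real) \<Rightarrow> real \<Rightarrow> real \<Rightarrow> bool" where
  "side_slope s g x r \<longleftrightarrow> (\<forall>\<eta>>0. \<exists>h>0. \<forall>y. 0 < s * (y - x) \<and> s * (y - x) < h \<longrightarrow>
     \<bar>g y - g x - r * (y - x)\<bar> \<le> \<eta> * \<bar>y - x\<bar>)"

lemma derivative_linear_bound:
  assumes "(g has_real_derivative r) (at x within A)" "0 < \<eta>"
  shows "\<exists>h>0. \<forall>y\<in>A. \<bar>y - x\<bar> < h \<longrightarrow> \<bar>g y - g x - r * (y - x)\<bar> \<le> \<eta> * \<bar>y - x\<bar>"
  using assms unfolding has_field_derivative_def has_derivative_within_alt real_norm_def by blast

lemma side_slope_derivative: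
  assumes "side_slope s g x r" "\<bar>s\<bar> = 1" and A: "\<And>y. y \<in> A \<Longrightarrow> 0 < s * (y - x)"
  shows "(g has_real_derivative r) (at x within A)"
  unfolding has_field_derivative_def has_derivative_within_alt
proof (intro conjI allI impI)
  show "bounded_linear ((*) r)" by (rule bounded_linear_mult_right)
  fix e :: real assume "0 < e"
  then obtain h where h: "0 < h" "\<And>y. 0 < s * (y - x) \<and> s * (y - x) < h \<Longrightarrow> \<bar>g y - g x - r * (y - x)\<bar> \<le> e * \<bar>y - x\<bar>"
    using assms(1) unfolding side_slope_def by blast
  have "s * (y - x) = \<bar>y - x\<bar>" if "y \<in> A" for y
    using A[OF that] assms(2) by (metis abs_mult abs_of_pos mult_1)
  then show "\<exists>d>0. \<forall>y\<in>A. norm (y - x) < d \<longrightarrow> norm (g y - g x - r * (y - x)) \<le> e * norm (y - x)"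
    using h A by (intro exI[of _ h]) auto
qed

context stopping_problem
begin

text \<open>The regularity assumption concerns a closed interval with end point \<open>x\<close>, where it asserts agreement
  with a function that is smooth on all of \<open>\<X>\<close>; the derivative of the latter is the slope.\<close>

lemma continuation_side_slope:
  assumes reg: "\<And>a b. a \<in> \<X> \<Longrightarrow> b \<in> \<X> \<Longrightarrow> a < b \<Longrightarrow> {a<..<b} \<subseteq> \<X> - S \<Longrightarrow>
      C1k 2 \<X> {a..b} (\<lambda>t x. V M X \<delta> f t x S)"
    and x: "x \<in> \<X>" and s: "\<bar>s\<bar> = 1" and h: "0 < h"
    and out: "\<And>y. 0 < s * (y - x) \<Longrightarrow> s * (y - x) < h \<Longrightarrow> y \<in> \<X> - S"
  shows "\<exists>r. side_slope s v x r"
proof -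
  \<comment> \<open>The regularity assumption needs both end points in \<open>\<X>\<close>, hence half the width.\<close>
  define z where "z = x + s * (h / 2)"
  define a where "a = min x z"
  define b where "b = max x z"
  have ss: "s * s = 1" using s by (metis abs_mult_self_eq mult_1)
  have "s * (z - x) = h / 2" using ss by (simp add: z_def mult.assoc[symmetric])
  then have zX: "z \<in> \<X>" using out[of z] h by simp
  have seg: "y \<in> {a..b} \<longleftrightarrow> 0 \<le> s * (y - x) \<and> s * (y - x) \<le> h / 2"
    "y \<in> {a<..<b} \<longleftrightarrow> 0 < s * (y - x) \<and> s * (y - x) < h / 2" for y
    using s h by (auto simp: a_def b_def z_def abs_if min_def max_def split: if_splits)
  have ab: "a < b" using s h by (auto simp: a_def b_def z_def abs_if split: if_splits)
  have abX: "a \<in> \<X>" "b \<in> \<X>" using x zX by (auto simp: a_def b_def min_def max_def)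
  have sub: "{a<..<b} \<subseteq> \<X> - S"
  proof
    fix y assume "y \<in> {a<..<b}"
    then have "0 < s * (y - x)" "s * (y - x) < h" using seg(2)[of y] h by linarith+
    then show "y \<in> \<X> - S" by (rule out)
  qed
  have subX: "{a..b} \<subseteq> \<X>"
    using interval abX unfolding is_interval_1 by (meson atLeastAtMost_iff subsetI)
  obtain u where u: "C1k_on 2 \<X> u" and uv: "\<And>t y. 0 \<le> t \<Longrightarrow> y \<in> {a..b} \<Longrightarrow> u t y = V M X \<delta> f t y S"
    using reg[OF abX ab sub] unfolding C1k_def by blast
  obtain D :: "nat \<Rightarrow> real \<Rightarrow> real \<Rightarrow> real" where D0: "\<forall>t\<ge>0. \<forall>y\<in>\<X>. D 0 t y = u t y"
    and D1: "\<forall>j<2. \<forall>t\<ge>0. \<forall>y\<in>\<X>. (D j t has_real_derivative D (Suc j) t y) (at y within \<X>)"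
    using u unfolding C1k_on_def by (elim exE conjE)
  have Dv: "D 0 0 y = v y" if "y \<in> {a..b}" for y
    using D0[rule_format, of 0 y] uv[of 0 y] that subX by auto
  have xab: "x \<in> {a..b}" by (simp add: a_def b_def)
  have "(D 0 0 has_real_derivative D 1 0 x) (at x within \<X>)" using D1[rule_format, of 0 0 x] x by simp
  then have d: "(D 0 0 has_real_derivative D 1 0 x) (at x within {a..b})" using subX by (rule DERIV_subset)
  have "side_slope s v x (D 1 0 x)"
    unfolding side_slope_def
  proof (intro allI impI)
    fix \<eta> :: real assume "0 < \<eta>"
    from derivative_linear_bound[OF d this] obtain k where k: "0 < k"
      and kb: "\<And>y. y \<in> {a..b} \<Longrightarrow> \<bar>y - x\<bar> < k \<Longrightarrow> \<bar>D 0 0 y - D 0 0 x - D 1 0 x * (y - x)\<bar> \<le> \<eta> * \<bar>y - x\<bar>" by blast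
    show "\<exists>h>0. \<forall>y. 0 < s * (y - x) \<and> s * (y - x) < h \<longrightarrow> \<bar>v y - v x - D 1 0 x * (y - x)\<bar> \<le> \<eta> * \<bar>y - x\<bar>"
    proof (intro exI[of _ "min k (h / 2)"] conjI allI impI)
      fix y assume y: "0 < s * (y - x) \<and> s * (y - x) < min k (h / 2)"
      then have "\<bar>y - x\<bar> = s * (y - x)" using s by (metis abs_mult abs_of_pos mult_1)
      moreover have "y \<in> {a..b}" using y seg(1) by auto
      ultimately show "\<bar>v y - v x - D 1 0 x * (y - x)\<bar> \<le> \<eta> * \<bar>y - x\<bar>"
        using kb[of y] y Dv[of y] Dv[OF xab] by simp
    qed (use k h in simp)
  qed
  then show ?thesis by blast
qed

text \<open>A slope that bends downwards would push \<open>v\<close> below \<open>f\<close> inside the continuation region, and one that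
  bends upwards is a convex kink of \<open>U\<close>: on the side \<open>s\<close> one has \<open>U = v\<close>, on the other side \<open>U \<ge> f\<close>.\<close>

lemma smooth_fit_side:
  assumes x: "x \<in> S" and s: "\<bar>s\<bar> = 1" and h: "0 < h"
    and out: "\<And>y. 0 < s * (y - x) \<Longrightarrow> s * (y - x) < h \<Longrightarrow> y \<in> \<X> - S"
    and df: "(f has_real_derivative q) (at x within \<X>)"
    and slope: "side_slope s v x r" and vx: "v x = f x"
  shows "r = q"
proof (rule ccontr)
  assume "r \<noteq> q"
  have ss: "s * s = 1" using s by (metis abs_mult_self_eq mult_1)
  have sabs: "s * (y - x) = \<bar>y - x\<bar>" if "0 < s * (y - x)" for y
    using that s by (metis abs_mult abs_of_pos mult_1)
  have rq: "(r - q) * (y - x) = s * (r - q) * \<bar>y - x\<bar>" if "0 < s * (y - x)" for y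
  proof -
    have "s * (r - q) * (s * (y - x)) = s * s * ((r - q) * (y - x))" by (simp only: ac_simps)
    then show ?thesis unfolding ss sabs[OF that] by (simp only: mult_1)
  qed
  have "s * (r - q) \<noteq> 0" using \<open>r \<noteq> q\<close> s by auto
  then consider "s * (r - q) < 0" | "0 < s * (r - q)" by linarith
  then show False
  proof cases
    case 1
    define \<eta> where "\<eta> = - (s * (r - q)) / 4"
    have \<eta>: "0 < \<eta>" using 1 by (simp add: \<eta>_def)
    obtain h1 where h1: "0 < h1" "\<And>y. 0 < s * (y - x) \<and> s * (y - x) < h1 \<Longrightarrow> \<bar>v y - v x - r * (y - x)\<bar> \<le> \<eta> * \<bar>y - x\<bar>"
      using slope \<eta> unfolding side_slope_def by blast
    obtain h2 where h2: "0 < h2" "\<And>y. y \<in> \<X> \<Longrightarrow> \<bar>y - x\<bar> < h2 \<Longrightarrow> \<bar>f y - f x - q * (y - x)\<bar> \<le> \<eta> * \<bar>y - x\<bar>"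
      using derivative_linear_bound[OF df \<eta>] by blast
    define d where "d = min h (min h1 h2) / 2"
    have d: "0 < d" "d < h" "d < h1" "d < h2" using h h1(1) h2(1) by (auto simp: d_def)
    define y where "y = x + s * d"
    have sy: "s * (y - x) = d" using ss by (simp add: y_def mult.assoc[symmetric])
    have ay: "\<bar>y - x\<bar> = d" using sabs[of y] sy d by simp
    have yX: "y \<in> \<X> - S" by (rule out) (use sy d in auto)
    have 1: "\<bar>v y - v x - r * (y - x)\<bar> \<le> \<eta> * d" using h1(2)[of y] sy d ay by simp
    have 2: "\<bar>f y - f x - q * (y - x)\<bar> \<le> \<eta> * d" using h2(2)[of y] yX d ay by simp
    have "r * (y - x) - q * (y - x) = - 4 * (\<eta> * d)"
      using rq[of y] sy d ay by (simp add: \<eta>_def left_diff_distrib)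
    moreover have "0 < \<eta> * d" using \<eta> d by simp
    ultimately show False using 1 2 U_off_S(2)[OF yX] vx by linarith
  next
    case 2
    show False
    proof (rule no_convex_kink[OF x s 2])
      fix \<eta> :: real assume \<eta>: "0 < \<eta>"
      obtain h1 where h1: "0 < h1" "\<And>y. 0 < s * (y - x) \<and> s * (y - x) < h1 \<Longrightarrow> \<bar>v y - v x - r * (y - x)\<bar> \<le> \<eta> * \<bar>y - x\<bar>"
        using slope \<eta> unfolding side_slope_def by blast
      obtain h2 where h2: "0 < h2" "\<And>y. y \<in> \<X> \<Longrightarrow> \<bar>y - x\<bar> < h2 \<Longrightarrow> \<bar>f y - f x - q * (y - x)\<bar> \<le> \<eta> * \<bar>y - x\<bar>"
        using derivative_linear_bound[OF df \<eta>] by blast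
      show "\<exists>h>0. \<forall>y\<in>\<X>. \<bar>y - x\<bar> < h \<longrightarrow>
        f x + q * (y - x) + s * (r - q) * max 0 (s * (y - x)) - \<eta> * \<bar>y - x\<bar> \<le> U y"
      proof (intro exI[of _ "min h (min h1 h2)"] conjI ballI impI)
        fix y assume y: "y \<in> \<X>" "\<bar>y - x\<bar> < min h (min h1 h2)"
        show "f x + q * (y - x) + s * (r - q) * max 0 (s * (y - x)) - \<eta> * \<bar>y - x\<bar> \<le> U y"
        proof (cases "0 < s * (y - x)")
          case True
          have yS: "y \<in> \<X> - S" by (rule out[OF True]) (use y sabs[OF True] in auto)
          have "\<bar>v y - v x - r * (y - x)\<bar> \<le> \<eta> * \<bar>y - x\<bar>" using h1(2)[of y] True y sabs[OF True] by simp
          moreover have "s * (r - q) * max 0 (s * (y - x)) = r * (y - x) - q * (y - x)"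
            using True rq[OF True] sabs[OF True] by (simp add: left_diff_distrib)
          ultimately show ?thesis using U_off_S(1)[OF yS] vx by linarith
        next
          case False
          have "\<bar>f y - f x - q * (y - x)\<bar> \<le> \<eta> * \<bar>y - x\<bar>" using h2(2)[of y] y by simp
          moreover have "max 0 (s * (y - x)) = 0" using False by simp
          ultimately show ?thesis using f_le_U[OF y(1)] by simp
        qed
      qed (use h h1 h2 in simp)
    qed
  qed
qed

text \<open>The inequality \<open>f \<le> v\<close> in the continuation region extends to its boundary point \<open>x\<close>, since \<open>v\<close> is
  continuous there from the side \<open>s\<close>.\<close>

lemma v_eq_f_at_boundary:
  assumes x: "x \<in> S" and s: "\<bar>s\<bar> = 1" and h: "0 < h"
    and out: "\<And>y. 0 < s * (y - x) \<Longrightarrow> s * (y - x) < h \<Longrightarrow> y \<in> \<X> - S"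
    and slope: "side_slope s v x r"
  shows "v x = f x"
proof (rule antisym[OF v_le_f_on_S[OF x]])
  have xX: "x \<in> \<X>" using x S_sub by auto
  have ss: "s * s = 1" using s by (metis abs_mult_self_eq mult_1)
  define y where "y n = x + s * (h * (1/2) ^ Suc n)" for n :: nat
  have pow: "0 < h * (1/2) ^ Suc n" "h * (1/2) ^ Suc n < h" for n
  proof -
    show "0 < h * (1/2) ^ Suc n" using h by simp
    have "(1/2::real) ^ Suc n < 1" by (rule power_Suc_less_one) auto
    then show "h * (1/2) ^ Suc n < h" using h mult_strict_left_mono[of "(1/2) ^ Suc n" 1 h] by simp
  qed
  have sy: "s * (y n - x) = h * (1/2) ^ Suc n" for n using ss by (simp add: y_def mult.assoc[symmetric])
  have yX: "y n \<in> \<X> - S" for n by (rule out) (simp_all only: sy pow)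
  have ylim: "y \<longlonglongrightarrow> x"
  proof -
    have "(\<lambda>n. x + s * (h * (1/2) ^ Suc n)) \<longlonglongrightarrow> x + s * (h * 0)"
      by (intro tendsto_intros LIMSEQ_Suc LIMSEQ_realpow_zero) auto
    then show ?thesis by (simp add: y_def[abs_def])
  qed
  have "(v has_real_derivative r) (at x within {y. 0 < s * (y - x)})"
    by (rule side_slope_derivative[OF slope s]) simp
  then have "continuous (at x within {y. 0 < s * (y - x)}) v" by (rule DERIV_continuous)
  then have "(v \<longlongrightarrow> v x) (at x within {y. 0 < s * (y - x)})" by (simp add: continuous_within)
  moreover have "filterlim y (at x within {y. 0 < s * (y - x)}) sequentially"
  proof -
    have "0 < s * (y n - x)" for n unfolding sy by (rule pow)
    moreover from this have "y n \<noteq> x" for n by (metis diff_self less_irrefl mult_zero_right)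
    ultimately show ?thesis unfolding filterlim_at using ylim by simp
  qed
  ultimately have vlim: "(\<lambda>n. v (y n)) \<longlonglongrightarrow> v x" by (rule filterlim_compose)
  have flim: "(\<lambda>n. f (y n)) \<longlonglongrightarrow> f x"
    by (rule continuous_on_tendsto_compose[OF f_cont ylim xX]) (use yX in auto)
  show "f x \<le> v x" by (rule LIMSEQ_le[OF flim vlim]) (use U_off_S(2)[OF yX] in blast)
qed

text \<open>Admissibility leaves three pictures: the interior of \<open>S\<close> on one side and the continuation region on
  the other, in either order, or the continuation region on both sides.  At least one side is thus
  in the continuation region, which yields \<open>v x = f x\<close>, and then each side can be treated alone.\<close>

lemma boundary_derivative:
  assumes adm: "admissible \<X> S"
    and reg: "value_function_regularity M \<X> X \<delta> f"
    and x: "x \<in> (top_of_set \<X>) frontier_of S"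
    and df: "(f has_real_derivative q) (at x within \<X>)"
  shows "\<exists>h>0. {x - h<..<x + h} \<subseteq> \<X>" and "\<bar>s\<bar> = 1 \<Longrightarrow> side_slope s v x q"
proof -
  have xS: "x \<in> S" using x frontier_of_subset_closedin[OF S_closed] by auto
  have xX: "x \<in> \<X>" using xS S_sub by auto
  have reg': "a \<in> \<X> \<Longrightarrow> b \<in> \<X> \<Longrightarrow> a < b \<Longrightarrow> {a<..<b} \<subseteq> \<X> - S \<Longrightarrow>
      C1k 2 \<X> {a..b} (\<lambda>t x. V M X \<delta> f t x S)" for a b
    using reg adm unfolding value_function_regularity_def by blast
  obtain y1 where y1: "y1 \<in> \<X>" "x < y1" using diffusion_crosses[OF xX \<sigma>_nonzero[OF xX], of 1] by auto
  obtain y2 where y2: "y2 \<in> \<X>" "y2 < x" using diffusion_crosses[OF xX \<sigma>_nonzero[OF xX], of "-1"] by auto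
  define h0 where "h0 = min (y1 - x) (x - y2)"
  have h0: "0 < h0" using y1 y2 by (simp add: h0_def)
  have nbhd: "y \<in> \<X>" if "\<bar>y - x\<bar> < h0" for y
    using interval y1 y2 that unfolding is_interval_1 h0_def by (smt (verit))
  then show "\<exists>h>0. {x - h<..<x + h} \<subseteq> \<X>" using h0 by (intro exI[of _ h0]) auto
  define inner where "inner s h \<longleftrightarrow> (\<forall>y. 0 < s * (y - x) \<and> s * (y - x) < h \<longrightarrow> y \<in> (top_of_set \<X>) interior_of S)" for s h
  define outer where "outer s h \<longleftrightarrow> (\<forall>y. 0 < s * (y - x) \<and> s * (y - x) < h \<longrightarrow> y \<in> \<X> - S)" for s h
  have cases: "\<exists>h>0. (inner (-1) h \<and> outer 1 h) \<or> (inner 1 h \<and> outer (-1) h) \<or> (outer 1 h \<and> outer (-1) h)"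
  proof -
    from adm x consider h where "h > 0" "{x-h<..<x} \<subseteq> (top_of_set \<X>) interior_of S" "{x<..<x+h} \<subseteq> \<X> - S"
      | h where "h > 0" "{x<..<x+h} \<subseteq> (top_of_set \<X>) interior_of S" "{x-h<..<x} \<subseteq> \<X> - S"
      | h where "h > 0" "{x-h<..<x+h} \<inter> \<X> - {x} \<subseteq> \<X> - S"
      unfolding admissible_def by blast
    moreover have R: "y \<in> {x<..<x + h}" if "0 < 1 * (y - x) \<and> 1 * (y - x) < h" for y h using that by auto
    moreover have L: "y \<in> {x - h<..<x}" if "0 < -1 * (y - x) \<and> -1 * (y - x) < h" for y h using that by auto
    ultimately show ?thesis
    proof cases
      case (1 h)
      have "inner (-1) h \<and> outer 1 h" unfolding inner_def outer_def using 1 R L by blast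
      then show ?thesis using 1(1) by blast
    next
      case (2 h)
      have "inner 1 h \<and> outer (-1) h" unfolding inner_def outer_def using 2 R L by blast
      then show ?thesis using 2(1) by blast
    next
      case (3 h)
      have "y \<in> \<X> - S" if "\<bar>y - x\<bar> < min h h0" "y \<noteq> x" for y
      proof -
        have "y \<in> {x - h<..<x + h}" using that by (auto simp: abs_less_iff)
        moreover have "y \<in> \<X>" using nbhd[of y] that by simp
        ultimately show ?thesis using 3(2) that by blast
      qed
      then have "outer 1 (min h h0) \<and> outer (-1) (min h h0)"
        unfolding outer_def by (auto simp: abs_if)
      then show ?thesis using 3(1) h0 by (intro exI[of _ "min h h0"]) auto
    qed
  qed
  have out_slope: "\<exists>r. side_slope s v x r \<and> v x = f x \<and> r = q" if s: "\<bar>s\<bar> = 1" and h: "0 < h" and o: "outer s h" for s h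
  proof -
    have out: "\<And>y. 0 < s * (y - x) \<Longrightarrow> s * (y - x) < h \<Longrightarrow> y \<in> \<X> - S" using o by (simp add: outer_def)
    obtain r where r: "side_slope s v x r" using continuation_side_slope[OF reg' xX s h out] by blast
    have vx: "v x = f x" by (rule v_eq_f_at_boundary[OF xS s h out r])
    have "r = q" by (rule smooth_fit_side[OF xS s h out df r vx])
    with r vx show ?thesis by blast
  qed
  have in_slope: "side_slope s v x q" if s: "\<bar>s\<bar> = 1" and h: "0 < h" and i: "inner s h" and vx: "v x = f x" for s h
    unfolding side_slope_def
  proof (intro allI impI)
    fix \<eta> :: real assume "0 < \<eta>"
    then obtain k where k: "0 < k" "\<And>y. y \<in> \<X> \<Longrightarrow> \<bar>y - x\<bar> < k \<Longrightarrow> \<bar>f y - f x - q * (y - x)\<bar> \<le> \<eta> * \<bar>y - x\<bar>"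
      using derivative_linear_bound[OF df] by blast
    show "\<exists>h>0. \<forall>y. 0 < s * (y - x) \<and> s * (y - x) < h \<longrightarrow> \<bar>v y - v x - q * (y - x)\<bar> \<le> \<eta> * \<bar>y - x\<bar>"
    proof (intro exI[of _ "min k h"] conjI allI impI)
      fix y assume y: "0 < s * (y - x) \<and> s * (y - x) < min k h"
      then have a: "\<bar>y - x\<bar> = s * (y - x)" using s by (metis abs_mult abs_of_pos mult_1)
      have yi: "y \<in> (top_of_set \<X>) interior_of S" using i y by (auto simp: inner_def)
      then have "y \<in> S" using interior_of_subset[of "top_of_set \<X>" S] by auto
      then have "y \<in> \<X>" using S_sub by auto
      then show "\<bar>v y - v x - q * (y - x)\<bar> \<le> \<eta> * \<bar>y - x\<bar>"
        using k(2)[of y] y a v_interior[OF yi] vx by simp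
    qed (use k h in simp)
  qed
  assume s: "\<bar>s\<bar> = 1"
  then have "s = 1 \<or> s = -1" by linarith
  then show "side_slope s v x q"
    using cases out_slope[of 1] out_slope[of "-1"] in_slope[of 1] in_slope[of "-1"] by auto
qed

end

section \<open>Smooth fit\<close>

text \<open>Extend to the closure of the interval and compose with the nearest-point projection onto it.\<close>

lemma lipschitz_extension:
  fixes h :: "real \<Rightarrow> real"
  assumes "is_interval \<X>" "\<X> \<noteq> {}" "L-lipschitz_on \<X> h"
  obtains g where "L-lipschitz_on UNIV g" "\<And>y. y \<in> \<X> \<Longrightarrow> g y = h y"
proof -
  obtain k where k: "L-lipschitz_on (closure \<X>) k" "\<And>y. y \<in> \<X> \<Longrightarrow> k y = h y"
    using lipschitz_extend_closure[OF assms(3)] by blast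
  have cv: "convex (closure \<X>)" using assms(1) by (simp add: is_interval_convex convex_closure)
  have ne: "closure \<X> \<noteq> {}" using assms(2) by simp
  let ?p = "closest_point (closure \<X>)"
  have "L-lipschitz_on UNIV (\<lambda>y. k (?p y))"
  proof (rule lipschitz_onI)
    fix y z :: real
    have "dist (k (?p y)) (k (?p z)) \<le> L * dist (?p y) (?p z)"
      by (rule lipschitz_onD[OF k(1)]) (auto intro!: closest_point_in_set ne)
    also have "\<dots> \<le> L * dist y z"
      by (intro mult_left_mono closest_point_lipschitz cv ne lipschitz_on_nonneg[OF k(1)]) simp
    finally show "dist (k (?p y)) (k (?p z)) \<le> L * dist y z" .
  qed (rule lipschitz_on_nonneg[OF k(1)])
  moreover have "k (?p y) = h y" if "y \<in> \<X>" for y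
    using k(2)[OF that] closest_point_self[of y "closure \<X>"] closure_subset[of \<X>] that by auto
  ultimately show thesis by (rule that)
qed

text \<open>The equation sees the coefficients only along paths, which stay in \<open>\<X>\<close>.\<close>

lemma diffusion_cong:
  assumes D: "diffusion M F W \<X> \<mu> \<sigma> X" and eq: "\<And>y. y \<in> \<X> \<Longrightarrow> \<mu>' y = \<mu> y" "\<And>y. y \<in> \<X> \<Longrightarrow> \<sigma>' y = \<sigma> y"
  shows "diffusion M F W \<X> \<mu>' \<sigma>' X"
  unfolding diffusion_def
proof (rule ballI)
  fix x assume x: "x \<in> \<X>"
  have adapt: "adapted F (X x)" using D x by (simp add: diffusion_def)
  have path: "\<forall>\<omega>\<in>space M. X x 0 \<omega> = x \<and> continuous_on {0..} (\<lambda>t. X x t \<omega>) \<and> (\<forall>t\<ge>0. X x t \<omega> \<in> \<X>)"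
    using D x by (simp add: diffusion_def)
  obtain I where I: "is_ito_integral M F W (\<lambda>s \<omega>. \<sigma> (X x s \<omega>)) I"
    and sde: "AE \<omega> in M. \<forall>t\<ge>0. X x t \<omega> = x + (LBINT s:{0..t}. \<mu> (X x s \<omega>)) + I t \<omega>"
    using D x by (auto simp: diffusion_def)
  have sets: "{\<omega> \<in> space M. ennreal e < (\<integral>\<^sup>+s\<in>{0..T}. ennreal ((g s \<omega> - \<sigma> (X x s \<omega>))\<^sup>2) \<partial>lborel)}
     = {\<omega> \<in> space M. ennreal e < (\<integral>\<^sup>+s\<in>{0..T}. ennreal ((g s \<omega> - \<sigma>' (X x s \<omega>))\<^sup>2) \<partial>lborel)}" for e T g
  proof (rule Collect_cong, rule conj_cong[OF refl])
    fix \<omega> assume \<omega>: "\<omega> \<in> space M"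
    have "(\<integral>\<^sup>+s\<in>{0..T}. ennreal ((g s \<omega> - \<sigma> (X x s \<omega>))\<^sup>2) \<partial>lborel)
        = (\<integral>\<^sup>+s\<in>{0..T}. ennreal ((g s \<omega> - \<sigma>' (X x s \<omega>))\<^sup>2) \<partial>lborel)"
      using path \<omega> eq(2) by (intro nn_integral_cong) (auto simp: indicator_def)
    then show "(ennreal e < (\<integral>\<^sup>+s\<in>{0..T}. ennreal ((g s \<omega> - \<sigma> (X x s \<omega>))\<^sup>2) \<partial>lborel))
      = (ennreal e < (\<integral>\<^sup>+s\<in>{0..T}. ennreal ((g s \<omega> - \<sigma>' (X x s \<omega>))\<^sup>2) \<partial>lborel))" by simp
  qed
  have "is_ito_integral M F W (\<lambda>s \<omega>. \<sigma>' (X x s \<omega>)) I"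
    using I unfolding is_ito_integral_def sets .
  moreover have "AE \<omega> in M. \<forall>t\<ge>0. X x t \<omega> = x + (LBINT s:{0..t}. \<mu>' (X x s \<omega>)) + I t \<omega>"
    using sde AE_space
  proof eventually_elim
    case (elim \<omega>)
    have "(LBINT s:{0..t}. \<mu>' (X x s \<omega>)) = (LBINT s:{0..t}. \<mu> (X x s \<omega>))" for t
      using path elim(2) eq(1) by (intro set_lebesgue_integral_cong) auto
    then show ?case using elim(1) by simp
  qed
  ultimately show "adapted F (X x) \<and>
      (\<forall>\<omega>\<in>space M. X x 0 \<omega> = x \<and> continuous_on {0..} (\<lambda>t. X x t \<omega>) \<and> (\<forall>t\<ge>0. X x t \<omega> \<in> \<X>)) \<and>
      (\<exists>I. is_ito_integral M F W (\<lambda>s \<omega>. \<sigma>' (X x s \<omega>)) I \<and>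
        (AE \<omega> in M. \<forall>t\<ge>0. X x t \<omega> = x + (LBINT s:{0..t}. \<mu>' (X x s \<omega>)) + I t \<omega>))"
    using adapt path by blast
qed

theorem corollary3p1:
  fixes M :: "'w measure" and F :: "real \<Rightarrow> 'w measure"
    and W :: "real \<Rightarrow> 'w \<Rightarrow> real" and X :: "real \<Rightarrow> real \<Rightarrow> 'w \<Rightarrow> real"
    and \<X> S :: "real set" and \<mu> \<sigma> \<delta> f :: "real \<Rightarrow> real" and x :: real
  assumes "filtered_prob_space M F"
    and "brownian_motion M F W"
    and "is_interval \<X>"
    and "diffusion M F W \<X> \<mu> \<sigma> X"
    and "\<exists>L. L-lipschitz_on \<X> \<mu>"
    and "\<exists>L. L-lipschitz_on \<X> \<sigma>"
    and "\<forall>y\<in>\<X>. (\<sigma> y)\<^sup>2 > 0"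
    and "discount_function \<delta>"
    and "\<forall>s\<ge>0. \<forall>t\<ge>0. \<delta> (t + s) \<ge> \<delta> t * \<delta> s"
    and "continuous_on \<X> f"
    and "\<forall>y\<in>\<X>. f y \<ge> 0"
    and "growth_condition M \<X> X \<delta> f"
    and "piecewise_C2 \<X> f"
    and "value_function_regularity M \<X> X \<delta> f"
    and "admissible \<X> S"
    and "weak_equilibrium M \<X> X \<delta> f S"
    and "x \<in> (top_of_set \<X>) frontier_of S"
    and "f differentiable (at x within \<X>)"
  shows "(\<lambda>y. V M X \<delta> f 0 y S) differentiable (at x within \<X> \<inter> {..<x}) \<and>
         (\<lambda>y. V M X \<delta> f 0 y S) differentiable (at x within \<X> \<inter> {x<..}) \<and>
         left_derivative \<X> (\<lambda>y. V M X \<delta> f 0 y S) x = right_derivative \<X> (\<lambda>y. V M X \<delta> f 0 y S) x"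
proof -
  have ne: "\<X> \<noteq> {}"
    using assms(17) frontier_of_subset_topspace[of "top_of_set \<X>" S] by auto
  obtain L1 L2 where "L1-lipschitz_on \<X> \<mu>" "L2-lipschitz_on \<X> \<sigma>" using assms(5,6) by blast
  then have lip: "(max L1 L2)-lipschitz_on \<X> \<mu>" "(max L1 L2)-lipschitz_on \<X> \<sigma>"
    by (auto intro: lipschitz_on_le)
  obtain \<mu>' where \<mu>': "(max L1 L2)-lipschitz_on UNIV \<mu>'" "\<And>y. y \<in> \<X> \<Longrightarrow> \<mu>' y = \<mu> y"
    using lipschitz_extension[OF assms(3) ne lip(1)] by blast
  obtain \<sigma>' where \<sigma>': "(max L1 L2)-lipschitz_on UNIV \<sigma>'" "\<And>y. y \<in> \<X> \<Longrightarrow> \<sigma>' y = \<sigma> y"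
    using lipschitz_extension[OF assms(3) ne lip(2)] by blast
  interpret stopping_problem M F W \<X> \<mu>' \<sigma>' X "max L1 L2" \<delta> f S
  proof unfold_locales
    show "diffusion M F W \<X> \<mu>' \<sigma>' X" by (rule diffusion_cong[OF assms(4) \<mu>'(2) \<sigma>'(2)])
    show "\<sigma>' y \<noteq> 0" if "y \<in> \<X>" for y using assms(7) \<sigma>'(2) that by auto
  qed (use assms \<mu>' \<sigma>' in auto)
  obtain q where q: "(f has_real_derivative q) (at x within \<X>)"
    using assms(18) by (auto simp: real_differentiable_def)
  note bd = boundary_derivative[OF assms(15,14,17) q]
  obtain h where h: "0 < h" "{x - h<..<x + h} \<subseteq> \<X>" using bd(1) by blast
  have left: "(v has_real_derivative q) (at x within \<X> \<inter> {..<x})"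
    by (rule side_slope_derivative[OF bd(2)[of "-1"]]) auto
  have right: "(v has_real_derivative q) (at x within \<X> \<inter> {x<..})"
    by (rule side_slope_derivative[OF bd(2)[of 1]]) auto
  have "at x within \<X> \<inter> {..<x} = at_left x"
    by (rule at_within_nhd[of x "{x - h<..<x + h}"]) (use h in auto)
  then have ld: "left_derivative \<X> v x = q"
    unfolding left_derivative_def using left
    by (intro vector_derivative_within) (auto simp: has_real_derivative_iff_has_vector_derivative)
  have "at x within \<X> \<inter> {x<..} = at_right x"
    by (rule at_within_nhd[of x "{x - h<..<x + h}"]) (use h in auto)
  then have rd: "right_derivative \<X> v x = q"
    unfolding right_derivative_def using right
    by (intro vector_derivative_within) (auto simp: has_real_derivative_iff_has_vector_derivative)
  show ?thesis using left right ld rd by (auto simp: real_differentiable_def)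
qed

end
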